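(* Let $f_0\in L^2(\Omega\times\Omega_{\mathrm{TJ}})$. Assume that $\sigma$ is a $C^1$ function on $\mathbb{R}$. Then there exists a weak solution $f$ of the Fokker–Planck problem with initial datum $f_0$.
   Context: $\gamma,\eta,\beta_\theta,\beta_a>0$ are constants satisfying $\frac{6\gamma}{\beta_\theta^2}=\frac{2\eta}{\beta_a^2}$. $\theta=(\theta_1,\theta_2,\theta_3)$ (the misorientations) ranges over $\Omega=\{\theta\in(-\frac{\pi}{4},\frac{\pi}{4})^3:\theta_1+\theta_2+\theta_3=0\}\subset\mathbb{R}^3$, with $d\theta$ the 2-dimensional measure on this plane; $a$ (the triple junction) ranges over a bounded domain $\Omega_{\mathrm{TJ}}\subset\mathbb{R}^2$ with $C^2$ boundary. $\nabla^\Omega_\theta$ is the tangential gradient on the plane of $\Omega$ ($\nabla^\Omega_\theta\phi=(I-\frac13J)(\partial_{\theta_k}\phi)_{k}$, $I$ the identity and $J$ the all-ones $3\times 3$ matrix), with corresponding divergence and Laplacian $\Delta^\Omega_\theta=\nabla^\Omega_\theta\cdot\nabla^\Omega_\theta$; $\nabla_a,\Delta_a$ are the standard gradient and Laplacian in $a$; $\nu_\theta,\nu_a$ are outer unit normals to $\partial\Omega,\partial\Omega_{\mathrm{TJ}}$. $E(\theta,a)=\sum_{j=1}^3\sigma(\theta_j)|a-x^{(j)}|$ with $x^{(j)}\in\mathbb{R}^2$ fixed; $v_\theta=-3\gamma\nabla^\Omega_\theta E$, $v_a=-\eta\nabla_aE$. Fokker–Planck problem: $f_t+\nabla^\Omega_\theta\cdot(v_\theta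 f)+\nabla_a\cdot(v_af)=\frac{\beta_\theta^2}{2}\Delta^\Omega_\theta f+\frac{\beta_a^2}{2}\Delta_af$ in $\Omega\times\Omega_{\mathrm{TJ}}\times(0,\infty)$, with $(\frac{\beta_\theta^2}{2}\nabla^\Omega_\theta f-v_\theta f)\cdot\nu_\theta=0$ on $\partial\Omega\times\Omega_{\mathrm{TJ}}$, $(\frac{\beta_a^2}{2}\nabla_af-v_af)\cdot\nu_a=0$ on $\Omega\times\partial\Omega_{\mathrm{TJ}}$, $f|_{t=0}=f_0$. $f:\Omega\times\Omega_{\mathrm{TJ}}\times[0,\infty)\to\mathbb{R}$ is a weak solution if $f\in L^\infty(0,\infty;L^2(\Omega\times\Omega_{\mathrm{TJ}}))$ with $\nabla^\Omega_\theta f,\nabla_af\in L^2(0,\infty;L^2(\Omega\times\Omega_{\mathrm{TJ}}))$, and for all $\phi\in C^\infty(\overline{\Omega\times\Omega_{\mathrm{TJ}}\times[0,\infty)})$ and almost every $T>0$, $$\iint f\phi\,d\theta da\Big|_{t=T}-\int_0^T\!\!\iint f\phi_t\,d\theta da\,dt+\int_0^T\!\!\iint\Bigl(\bigl(\tfrac{\beta_\theta^2}{2}\nabla^\Omega_\theta f-v_\theta f\bigr)\cdot\nabla^\Omega_\theta\phi+\bigl(\tfrac{\beta_a^2}{2}\nabla_af-v_af\bigr)\cdot\nabla_a\phi\Bigr)d\theta da\,dt=\iint f_0\,\phi\,d\theta da\Big|_{t=0},$$ all space integrals being over $\Omega\times\Omega_{\mathrm{TJ}}$.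
   Formalization: The gradients of f are required in L²(0,T;L²) for every finite T instead of L²(0,∞;L²); the literal clause fails, e.g. for σ=1 and the stationary f_0=exp(-E/d), whose gradient is nonzero and constant in time. *)

theory Defs
  imports "HOL-Analysis.Analysis"
begin

section \<open>Smooth functions and domains with smooth boundary\<close>

text \<open>Functions of class \<open>C\<^sup>k\<close> on the whole (finite-dimensional) space: all iterated directional
  derivatives up to order \<open>k\<close> exist as Frechet derivatives and are continuous.\<close>

primrec Ck :: "nat \<Rightarrow> ('a::euclidean_space \<Rightarrow> 'b::real_normed_vector) \<Rightarrow> bool" where
  "Ck 0 f \<longleftrightarrow> continuous_on UNIV f"
| "Ck (Suc k) f \<longleftrightarrow>
     (\<forall>x. f differentiable (at x)) \<and> (\<forall>v. Ck k (\<lambda>x. frechet_derivative f (at x) v))"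

definition Cinfinity :: "('a::euclidean_space \<Rightarrow> 'b::real_normed_vector) \<Rightarrow> bool" where
  "Cinfinity f \<longleftrightarrow> (\<forall>k. Ck k f)"

text \<open>Near each boundary point and in suitable Cartesian coordinates \<open>(a \<bullet> u, a \<bullet> w)\<close>, the set is
  the region strictly above the graph of a \<open>C\<^sup>2\<close> function.\<close>

definition C2_boundary :: "(real^2) set \<Rightarrow> bool" where
  "C2_boundary D \<longleftrightarrow>
     (\<forall>p \<in> frontier D. \<exists>r > 0. \<exists>u w :: real^2. \<exists>g :: real \<Rightarrow> real.
        norm u = 1 \<and> norm w = 1 \<and> u \<bullet> w = 0 \<and> Ck 2 g \<and>
        D \<inter> ball p r = {a \<in> ball p r. a \<bullet> w > g (a \<bullet> u)})"

definition bounded_C2_domain :: "(real^2) set \<Rightarrow> bool" where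
  "bounded_C2_domain D \<longleftrightarrow> open D \<and> connected D \<and> D \<noteq> {} \<and> bounded D \<and> C2_boundary D"


section \<open>The misorientation domain and its two-dimensional measure\<close>

definition mis_plane :: "(real^3) set" where
  "mis_plane = {\<theta>. \<theta> $ 1 + \<theta> $ 2 + \<theta> $ 3 = 0}"

definition Omega :: "(real^3) set" where
  "Omega = {\<theta> \<in> mis_plane. \<forall>k. \<theta> $ k \<in> {- (pi/4) <..< pi/4}}"

text \<open>The area measure on the plane is the image of Lebesgue measure on \<open>\<real>\<^sup>2\<close> under a linear
  isometry of \<open>\<real>\<^sup>2\<close> onto the plane (the choice of isometry does not matter).\<close>

definition plane_param :: "real^2 \<Rightarrow> real^3" where
  "plane_param s = (s $ 1 / sqrt 2) *\<^sub>R vector [1, -1, 0] + (s $ 2 / sqrt 6) *\<^sub>R vector [1, 1, -2]"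

lemma norm_plane_param: "norm (plane_param s) = norm s"
proof -
  have sq2: "sqrt 2 * sqrt 2 = (2::real)" and sq6: "sqrt 6 * sqrt 6 = (6::real)" by simp_all
  have "plane_param s \<bullet> plane_param s = s \<bullet> s"
    unfolding plane_param_def
    by (simp add: inner_vec_def sum_3 sum_2 vector_3 field_simps sq2 sq6)
  then show ?thesis by (simp add: norm_eq_sqrt_inner)
qed

lemma range_plane_param: "range plane_param = mis_plane"
proof
  show "range plane_param \<subseteq> mis_plane"
    by (auto simp: plane_param_def mis_plane_def vector_3 field_simps)
  show "mis_plane \<subseteq> range plane_param"
  proof
    fix \<theta> :: "real^3" assume "\<theta> \<in> mis_plane"
    then have s: "\<theta> $ 3 = - \<theta> $ 1 - \<theta> $ 2" by (auto simp: mis_plane_def)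
    have "\<theta> = plane_param (vector [sqrt 2 * ((\<theta>$1 - \<theta>$2) / 2), sqrt 6 * ((\<theta>$1 + \<theta>$2) / 2)])"
      by (simp add: vec_eq_iff forall_3 plane_param_def vector_3 vector_2 s field_simps)
    then show "\<theta> \<in> range plane_param" by blast
  qed
qed

definition plane_measure :: "(real^3) measure" where
  "plane_measure = distr lborel borel plane_param"

text \<open>The measure \<open>d\<theta> da\<close> on \<open>\<Omega> \<times> D\<close> and the measure \<open>d\<theta> da dt\<close> on \<open>\<Omega> \<times> D \<times> I\<close>,
  on the (completed) Lebesgue measurable sets.\<close>

definition phase_measure :: "(real^2) set \<Rightarrow> ((real^3) \<times> (real^2)) measure" where
  "phase_measure D =
     completion (restrict_space plane_measure Omega \<Otimes>\<^sub>M restrict_space lborel D)"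

definition cylinder_measure :: "(real^2) set \<Rightarrow> real set \<Rightarrow> ((real^3) \<times> (real^2) \<times> real) measure" where
  "cylinder_measure D I =
     completion (restrict_space plane_measure Omega \<Otimes>\<^sub>M
                   (restrict_space lborel D \<Otimes>\<^sub>M restrict_space lborel I))"


section \<open>Lebesgue and Bochner spaces\<close>

definition in_L2 :: "'x measure \<Rightarrow> ('x \<Rightarrow> 'b::euclidean_space) \<Rightarrow> bool" where
  "in_L2 M g \<longleftrightarrow> g \<in> borel_measurable M \<and> integrable M (\<lambda>x. (norm (g x))\<^sup>2)"

definition L2_norm :: "'x measure \<Rightarrow> ('x \<Rightarrow> 'b::euclidean_space) \<Rightarrow> real" where
  "L2_norm M g = sqrt (LINT x|M. (norm (g x))\<^sup>2)"

text \<open>Elements of \<open>L\<^sup>\<infinity>(I; L\<^sup>2(\<Omega> \<times> D))\<close> and \<open>L\<^sup>2(I; L\<^sup>2(\<Omega> \<times> D))\<close> are given by jointly measurable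
  functions of \<open>(\<theta>, a, t)\<close>; as \<open>L\<^sup>2(\<Omega> \<times> D)\<close> is separable, every strongly measurable \<open>L\<^sup>2\<close>-valued
  function has such a representative.\<close>

definition in_Linf_L2 ::
    "real set \<Rightarrow> (real^2) set \<Rightarrow> (real^3 \<Rightarrow> real^2 \<Rightarrow> real \<Rightarrow> 'b::euclidean_space) \<Rightarrow> bool" where
  "in_Linf_L2 I D g \<longleftrightarrow>
     (\<lambda>(\<theta>, a, t). g \<theta> a t) \<in> borel_measurable (cylinder_measure D I) \<and>
     (\<exists>C. AE t in lebesgue_on I.
        in_L2 (phase_measure D) (\<lambda>(\<theta>, a). g \<theta> a t) \<and>
        L2_norm (phase_measure D) (\<lambda>(\<theta>, a). g \<theta> a t) \<le> C)"

definition in_L2_L2 ::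
    "real set \<Rightarrow> (real^2) set \<Rightarrow> (real^3 \<Rightarrow> real^2 \<Rightarrow> real \<Rightarrow> 'b::euclidean_space) \<Rightarrow> bool" where
  "in_L2_L2 I D g \<longleftrightarrow>
     (\<lambda>(\<theta>, a, t). g \<theta> a t) \<in> borel_measurable (cylinder_measure D I) \<and>
     (AE t in lebesgue_on I. in_L2 (phase_measure D) (\<lambda>(\<theta>, a). g \<theta> a t)) \<and>
     integrable (lebesgue_on I) (\<lambda>t. (L2_norm (phase_measure D) (\<lambda>(\<theta>, a). g \<theta> a t))\<^sup>2)"


section \<open>Classical and weak gradients\<close>

definition grad :: "(real^'n \<Rightarrow> real) \<Rightarrow> real^'n \<Rightarrow> real^'n" where
  "grad \<phi> x = (\<chi> k. frechet_derivative \<phi> (at x) (axis k 1))"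

definition tgrad :: "(real^3 \<Rightarrow> real) \<Rightarrow> real^3 \<Rightarrow> real^3" where
  "tgrad \<phi> \<theta> = (mat 1 - (1/3) *\<^sub>R (\<chi> i j. 1)) *v grad \<phi> \<theta>"

text \<open>Test functions in \<open>C\<^sub>c\<^sup>\<infinity>(\<Omega> \<times> D \<times> (0,\<infinity>))\<close>, where \<open>\<Omega>\<close> is an open subset of the plane. They are
  represented by smooth extensions to the ambient space; only points \<open>\<theta>\<close> of the plane matter for
  the support, and \<open>tgrad\<close> on the plane depends only on the values there.\<close>

definition compact_test :: "(real^2) set \<Rightarrow> (real^3 \<Rightarrow> real^2 \<Rightarrow> real \<Rightarrow> real) \<Rightarrow> bool" where
  "compact_test D \<psi> \<longleftrightarrow>
     Cinfinity (\<lambda>(\<theta>, a, t). \<psi> \<theta> a t) \<and>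
     (\<exists>K. compact K \<and> K \<subseteq> Omega \<times> D \<times> {0<..} \<and>
        (\<forall>\<theta> a t. \<theta> \<in> mis_plane \<and> (\<theta>, a, t) \<notin> K \<longrightarrow> \<psi> \<theta> a t = 0))"

text \<open>Distributional gradients on \<open>\<Omega> \<times> D \<times> (0,\<infinity>)\<close>.\<close>

definition weak_tgrad ::
    "(real^2) set \<Rightarrow> (real^3 \<Rightarrow> real^2 \<Rightarrow> real \<Rightarrow> real) \<Rightarrow> (real^3 \<Rightarrow> real^2 \<Rightarrow> real \<Rightarrow> real^3) \<Rightarrow> bool"
  where
  "weak_tgrad D f g \<longleftrightarrow> (\<forall>\<psi>. compact_test D \<psi> \<longrightarrow>
     (LINT (\<theta>, a, t)|cylinder_measure D {0<..}. f \<theta> a t *\<^sub>R tgrad (\<lambda>\<theta>'. \<psi> \<theta>' a t) \<theta>) =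
     - (LINT (\<theta>, a, t)|cylinder_measure D {0<..}. \<psi> \<theta> a t *\<^sub>R g \<theta> a t))"

definition weak_grad_a ::
    "(real^2) set \<Rightarrow> (real^3 \<Rightarrow> real^2 \<Rightarrow> real \<Rightarrow> real) \<Rightarrow> (real^3 \<Rightarrow> real^2 \<Rightarrow> real \<Rightarrow> real^2) \<Rightarrow> bool"
  where
  "weak_grad_a D f g \<longleftrightarrow> (\<forall>\<psi>. compact_test D \<psi> \<longrightarrow>
     (LINT (\<theta>, a, t)|cylinder_measure D {0<..}. f \<theta> a t *\<^sub>R grad (\<lambda>a'. \<psi> \<theta> a' t) a) =
     - (LINT (\<theta>, a, t)|cylinder_measure D {0<..}. \<psi> \<theta> a t *\<^sub>R g \<theta> a t))"


section \<open>Energy, drift and weak solutions\<close>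

definition energy :: "(real \<Rightarrow> real) \<Rightarrow> (3 \<Rightarrow> real^2) \<Rightarrow> real^3 \<Rightarrow> real^2 \<Rightarrow> real" where
  "energy \<sigma> x \<theta> a = (\<Sum>j\<in>UNIV. \<sigma> (\<theta> $ j) * norm (a - x j))"

definition v_theta :: "real \<Rightarrow> (real \<Rightarrow> real) \<Rightarrow> (3 \<Rightarrow> real^2) \<Rightarrow> real^3 \<Rightarrow> real^2 \<Rightarrow> real^3" where
  "v_theta \<gamma> \<sigma> x \<theta> a = (- (3 * \<gamma>)) *\<^sub>R tgrad (\<lambda>\<theta>'. energy \<sigma> x \<theta>' a) \<theta>"

text \<open>At the points \<open>a = x j\<close>, where the energy need not be differentiable, the value is
  unspecified; these form a null set.\<close>

definition v_a :: "real \<Rightarrow> (real \<Rightarrow> real) \<Rightarrow> (3 \<Rightarrow> real^2) \<Rightarrow> real^3 \<Rightarrow> real^2 \<Rightarrow> real^2" where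
  "v_a \<eta> \<sigma> x \<theta> a = (- \<eta>) *\<^sub>R grad (energy \<sigma> x \<theta>) a"

text \<open>The integrability of the gradients is required on \<open>(0,T)\<close> for every finite \<open>T\<close>, i.e. the
  space written \<open>L\<^sup>2(0,\<infinity>; L\<^sup>2)\<close> is read locally in time, on \<open>[0,\<infinity>)\<close>. Square integrability over all of
  \<open>(0,\<infinity>)\<close> cannot be meant: the stationary solution \<open>f = exp (- E/d)\<close> with
  \<open>d = \<beta>\<theta>\<^sup>2 / (6\<gamma>) = \<beta>a\<^sup>2 / (2\<eta>)\<close> has gradients constant in time, nonzero unless \<open>E\<close> is constant.
  The bound on \<open>f\<close> itself is global in time.

  The functions smooth up to the boundary are the restrictions of smooth functions on the whole
  space.\<close>

definition weak_solution ::
    "real \<Rightarrow> real \<Rightarrow> real \<Rightarrow> real \<Rightarrow> (real \<Rightarrow> real) \<Rightarrow> (3 \<Rightarrow> real^2) \<Rightarrow> (real^2) set \<Rightarrow>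
     (real^3 \<Rightarrow> real^2 \<Rightarrow> real) \<Rightarrow> (real^3 \<Rightarrow> real^2 \<Rightarrow> real \<Rightarrow> real) \<Rightarrow> bool" where
  "weak_solution \<gamma> \<eta> \<beta>\<theta> \<beta>a \<sigma> x D f0 f \<longleftrightarrow>
     in_Linf_L2 {0<..} D f \<and>
     (\<exists>g\<theta> ga.
        weak_tgrad D f g\<theta> \<and> weak_grad_a D f ga \<and>
        (\<forall>T > 0. in_L2_L2 {0<..<T} D g\<theta> \<and> in_L2_L2 {0<..<T} D ga) \<and>
        (\<forall>\<phi> :: real^3 \<Rightarrow> real^2 \<Rightarrow> real \<Rightarrow> real. Cinfinity (\<lambda>(\<theta>, a, t). \<phi> \<theta> a t) \<longrightarrow>
           (AE T in lebesgue_on {0<..}.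
              (LINT (\<theta>, a)|phase_measure D. f \<theta> a T * \<phi> \<theta> a T)
              - (LINT t|lebesgue_on {0<..<T}. LINT (\<theta>, a)|phase_measure D.
                   f \<theta> a t * deriv (\<phi> \<theta> a) t)
              + (LINT t|lebesgue_on {0<..<T}. LINT (\<theta>, a)|phase_measure D.
                   ((\<beta>\<theta>\<^sup>2 / 2) *\<^sub>R g\<theta> \<theta> a t - f \<theta> a t *\<^sub>R v_theta \<gamma> \<sigma> x \<theta> a)
                     \<bullet> tgrad (\<lambda>\<theta>'. \<phi> \<theta>' a t) \<theta>
                 + ((\<beta>a\<^sup>2 / 2) *\<^sub>R ga \<theta> a t - f \<theta> a t *\<^sub>R v_a \<eta> \<sigma> x \<theta> a)
                     \<bullet> grad (\<lambda>a'. \<phi> \<theta> a' t) a)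
              = (LINT (\<theta>, a)|phase_measure D. f0 \<theta> a * \<phi> \<theta> a 0))))"

end

theory Submission
  imports Defs "HOL-Library.Function_Algebras"
begin

text \<open>Put \<open>d = \<beta>\<theta>\<^sup>2 / (6 \<gamma>) = \<beta>a\<^sup>2 / (2 \<eta>)\<close> and \<open>w = exp (- E / d)\<close>. Both fluxes are multiples of
  \<open>\<nabla>f + (f / d) \<nabla>E = w \<nabla>(f / w)\<close>, so the operator acting on \<open>f / w\<close> is symmetric in
  \<open>L\<^sup>2(w d\<theta> da)\<close>. The unknowns are \<open>f\<close> and this flux \<open>P\<close>. The weak formulation tested with functions
  vanishing for large times, together with the distributional relation between \<open>f\<close> and \<open>P\<close>,
  prescribes a linear functional on the fields paired with \<open>(f, P)\<close>. Testing the backward equation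
  for \<open>\<phi>\<close> with \<open>\<phi>\<close> itself bounds that functional by the norm of \<open>L\<^sup>1(L\<^sup>2) \<times> L\<^sup>2(L\<^sup>2)\<close>. A Hahn-Banach extension
  and the Riesz theorem then produce \<open>(f, P)\<close> in the dual \<open>L\<^sup>\<infinity>(L\<^sup>2) \<times> L\<^sup>2(L\<^sup>2)\<close>, without approximation or
  compactness. The du Bois-Reymond lemma in time recovers the identity at almost every end time.\<close>

section \<open>Extension and representation of linear functionals\<close>

text \<open>The drift is merely continuous in \<theta> and jumps in \<open>a\<close> at the points
  \<open>x j\<close>, and tests are free on the boundary, so the argument should need neither
  regularity nor traces of the solution. Keeping the flux as an unknown achieves this: derivatives
  fall only on C^1 tests and on the weight. With u = f / w and p = \<nabla>u, paired over the Gibbs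
  measure, a test \<phi> contributes the field (-\<phi>_t, b \<nabla>\<phi>), and the relation p =
  \<nabla>u contributes fields (z1, z2) built from compactly supported functions. Integration by
  parts makes (z1, z2) orthogonal to (\<phi>, \<nabla>\<phi>) at each time. So if (\<zeta>, q) is
  the sum of the two contributions, pairing it with (\<phi>, \<nabla>\<phi>) leaves -1/2 d/dt of the
  squared norm of \<phi> plus a coercive term, whatever (z1, z2) is. This bounds \<phi> at time 0 by
  \<zeta> in L1(L2) and q in L2(L2), with constants independent of the time at which \<phi>
  vanishes. The L1 norm in time is chosen because its dual norm is the bound on f at almost every
  time.\<close>

instantiation "fun" :: (type, real_vector) real_vector
begin

definition scaleR_fun :: "real \<Rightarrow> ('a \<Rightarrow> 'b) \<Rightarrow> 'a \<Rightarrow> 'b"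
  where "scaleR_fun c f = (\<lambda>x. c *\<^sub>R f x)"

instance
  by standard (simp_all add: scaleR_fun_def fun_eq_iff algebra_simps)

end

lemma scaleR_fun_apply [simp]:
  fixes f :: "'a \<Rightarrow> 'b::real_vector"
  shows "(c *\<^sub>R f) x = c *\<^sub>R f x"
  by (simp add: scaleR_fun_def)

text \<open>Functionals are handled through their graphs, so that a linear relation dominated by a
  sublinear function can be extended without checking first that it is single-valued.\<close>

lemma hahn_banach_step:
  fixes p :: "'v::real_vector \<Rightarrow> real"
  assumes S: "subspace S" and G: "subspace G" and GS: "fst ` G \<subseteq> S"
    and dom: "\<And>s l. (s, l) \<in> G \<Longrightarrow> l \<le> p s"
    and sub: "\<And>s t. s \<in> S \<Longrightarrow> t \<in> S \<Longrightarrow> p (s + t) \<le> p s + p t"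
    and hom: "\<And>c s. s \<in> S \<Longrightarrow> 0 \<le> c \<Longrightarrow> p (c *\<^sub>R s) = c * p s"
    and x: "x \<in> S"
  shows "\<exists>r. \<forall>s l c. (s, l) \<in> G \<longrightarrow> l + c * r \<le> p (s + c *\<^sub>R x)"
proof -
  have GS': "s \<in> S" if "(s, l) \<in> G" for s l
    using GS that by force
  have nx: "- x \<in> S"
    using S x by (simp add: subspace_neg)
  \<comment> \<open>An admissible value \<open>r\<close> at \<open>x\<close> must lie above every
    element of \<open>U\<close> and below every \<open>p (t + x) - k\<close>; \<open>key\<close>
    says that the two families are compatible, and the supremum of the lower one is taken.\<close>
  define U where "U = {l - p (s - x) | s l. (s, l) \<in> G}"
  have key: "l - p (s - x) \<le> p (t + x) - k" if "(s, l) \<in> G" "(t, k) \<in> G" for s l t k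
  proof -
    have "(s + t, l + k) \<in> G"
      using subspace_add[OF G that] by simp
    then have "l + k \<le> p (s + t)"
      by (rule dom)
    also have "s + t = (s - x) + (t + x)"
      by simp
    also have "p \<dots> \<le> p (s - x) + p (t + x)"
      using GS'[OF that(1)] GS'[OF that(2)] S x by (intro sub) (auto intro: subspace_diff subspace_add)
    finally show ?thesis by simp
  qed
  have G0: "(0, 0) \<in> G"
    using subspace_0[OF G] by (simp add: zero_prod_def)
  have ne: "U \<noteq> {}"
    using G0 by (auto simp: U_def)
  have bdd: "bdd_above U"
    using key[OF _ G0] by (auto simp: U_def intro!: bdd_aboveI[where M = "p (0 + x) - 0"])
  define r where "r = Sup U"
  have lo: "l - p (s - x) \<le> r" if "(s, l) \<in> G" for s l
    unfolding r_def by (rule cSup_upper[OF _ bdd]) (use that in \<open>auto simp: U_def\<close>)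
  have up: "r \<le> p (t + x) - k" if "(t, k) \<in> G" for t k
    unfolding r_def by (rule cSup_least[OF ne]) (use key that in \<open>auto simp: U_def\<close>)
  have "l + c * r \<le> p (s + c *\<^sub>R x)" if sl: "(s, l) \<in> G" for s l c
  proof (cases "c = 0")
    case True
    then show ?thesis using dom[OF sl] by simp
  next
    case False
    \<comment> \<open>Division by |c| reduces to c = 1 and c = -1, for which \<open>up\<close> and
      \<open>lo\<close> are the required bounds.\<close>
    define s' where "s' = (1 / \<bar>c\<bar>) *\<^sub>R s"
    define l' where "l' = (1 / \<bar>c\<bar>) * l"
    have sl': "(s', l') \<in> G"
      using subspace_scale[OF G sl, of "1 / \<bar>c\<bar>"] by (simp add: s'_def l'_def)
    have sS: "s' \<in> S" by (rule GS'[OF sl'])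
    have l: "l = \<bar>c\<bar> * l'"
      using False by (simp add: l'_def)
    have s: "s = \<bar>c\<bar> *\<^sub>R s'"
      using False by (simp add: s'_def)
    show ?thesis
    proof (cases "c > 0")
      case True
      have "p (s + c *\<^sub>R x) = p (c *\<^sub>R (s' + x))"
        using True by (simp add: s scaleR_add_right)
      also have "\<dots> = c * p (s' + x)"
        using True S sS x by (intro hom subspace_add) auto
      finally show ?thesis
        using up[OF sl'] True mult_left_mono[of "l' + r" "p (s' + x)" c] by (simp add: l algebra_simps)
    next
      case c: False
      have "p (s + c *\<^sub>R x) = p ((- c) *\<^sub>R (s' - x))"
        using c by (simp add: s scaleR_diff_right)
      also have "\<dots> = (- c) * p (s' - x)"
        using c S sS x by (intro hom subspace_diff) auto
      finally show ?thesis
        using lo[OF sl'] c mult_left_mono[of "l' - r" "p (s' - x)" "- c"] by (simp add: l algebra_simps)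
    qed
  qed
  then show ?thesis by blast
qed

lemma subspace_Union_chain:
  assumes "\<And>X. X \<in> \<C> \<Longrightarrow> subspace X" "\<C> \<noteq> {}"
    and "\<And>X Y. X \<in> \<C> \<Longrightarrow> Y \<in> \<C> \<Longrightarrow> X \<subseteq> Y \<or> Y \<subseteq> X"
  shows "subspace (\<Union>\<C>)"
  unfolding subspace_def
proof (intro conjI ballI allI)
  show "0 \<in> \<Union>\<C>"
    using assms(1,2) subspace_0 by blast
next
  fix x y assume "x \<in> \<Union>\<C>" "y \<in> \<Union>\<C>"
  then obtain X Y where "X \<in> \<C>" "Y \<in> \<C>" "x \<in> X" "y \<in> Y" by blast
  then show "x + y \<in> \<Union>\<C>"
    using assms(1,3) subspace_add by (metis (no_types, lifting) UnionI subsetD)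
next
  fix c x assume "x \<in> \<Union>\<C>"
  then show "c *\<^sub>R x \<in> \<Union>\<C>"
    using assms(1) subspace_scale by blast
qed

text \<open>Zorn's lemma is applied to dominated subspaces of pairs. A maximal one reaches every
  point of \<open>S\<close>, since otherwise the line through (x, r) could be adjoined. Domination
  alone makes it single-valued: two values over the same point give pairs over 0 of both signs,
  while p 0 = 0.\<close>

lemma hahn_banach_graph:
  fixes p :: "'v::real_vector \<Rightarrow> real"
  assumes S: "subspace S" and G: "subspace G" and GS: "fst ` G \<subseteq> S"
    and dom: "\<And>s l. (s, l) \<in> G \<Longrightarrow> l \<le> p s"
    and sub: "\<And>s t. s \<in> S \<Longrightarrow> t \<in> S \<Longrightarrow> p (s + t) \<le> p s + p t"
    and hom: "\<And>c s. s \<in> S \<Longrightarrow> 0 \<le> c \<Longrightarrow> p (c *\<^sub>R s) = c * p s"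
  obtains f where "\<And>s t. s \<in> S \<Longrightarrow> t \<in> S \<Longrightarrow> f (s + t) = f s + f t"
    and "\<And>c s. s \<in> S \<Longrightarrow> f (c *\<^sub>R s) = c * f s"
    and "\<And>s. s \<in> S \<Longrightarrow> f s \<le> p s"
    and "\<And>s l. (s, l) \<in> G \<Longrightarrow> f s = l"
proof -
  define \<A> where "\<A> = {H. subspace H \<and> G \<subseteq> H \<and> fst ` H \<subseteq> S \<and> (\<forall>(s, l)\<in>H. l \<le> p s)}"
  have "\<exists>M\<in>\<A>. \<forall>X\<in>\<A>. M \<subseteq> X \<longrightarrow> X = M"
  proof (rule subset_Zorn)
    fix \<C> assume C: "subset.chain \<A> \<C>"
    show "\<exists>U\<in>\<A>. \<forall>X\<in>\<C>. X \<subseteq> U"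
    proof (cases "\<C> = {}")
      case True
      have "G \<in> \<A>"
        using G GS dom by (auto simp: \<A>_def)
      then show ?thesis using True by auto
    next
      case False
      have sub: "\<C> \<subseteq> \<A>" and tot: "\<And>X Y. X \<in> \<C> \<Longrightarrow> Y \<in> \<C> \<Longrightarrow> X \<subseteq> Y \<or> Y \<subseteq> X"
        using C unfolding subset_chain_def by auto
      have "subspace (\<Union>\<C>)"
        using sub tot False by (intro subspace_Union_chain) (auto simp: \<A>_def)
      moreover have "G \<subseteq> \<Union>\<C>"
        using False sub unfolding \<A>_def by blast
      moreover have "fst ` \<Union>\<C> \<subseteq> S"
        using sub unfolding \<A>_def by blast
      moreover have "\<forall>(s, l)\<in>\<Union>\<C>. l \<le> p s"
        using sub unfolding \<A>_def by blast
      ultimately have "\<Union>\<C> \<in> \<A>" by (simp add: \<A>_def)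
      then show ?thesis by blast
    qed
  qed
  then obtain M where M: "M \<in> \<A>" and max: "\<And>X. X \<in> \<A> \<Longrightarrow> M \<subseteq> X \<Longrightarrow> X = M" by blast
  have Ms: "subspace M" and GM: "G \<subseteq> M" and MS: "fst ` M \<subseteq> S"
    and Mp: "\<And>s l. (s, l) \<in> M \<Longrightarrow> l \<le> p s"
    using M by (auto simp: \<A>_def)
  have tot: "\<exists>l. (x, l) \<in> M" if x: "x \<in> S" for x
  proof -
    obtain r where r: "\<And>s l c. (s, l) \<in> M \<Longrightarrow> l + c * r \<le> p (s + c *\<^sub>R x)"
      using hahn_banach_step[OF S Ms MS Mp sub hom x] by blast
    define H where "H = {y + z | y z. y \<in> M \<and> z \<in> span {(x, r)}}"
    have H: "subspace H"
      unfolding H_def using subspace_sums[OF Ms subspace_span] .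
    have memH: "(s, l) \<in> H \<longleftrightarrow> (\<exists>c s' l'. (s', l') \<in> M \<and> s = s' + c *\<^sub>R x \<and> l = l' + c * r)" for s l
      by (fastforce simp: H_def span_singleton)
    have MH: "M \<subseteq> H"
    proof
      fix y assume "y \<in> M"
      then have "y + 0 \<in> H"
        unfolding H_def using span_zero by blast
      then show "y \<in> H" by simp
    qed
    have "H \<in> \<A>"
      unfolding \<A>_def
    proof (intro CollectI conjI)
      show "subspace H" by (rule H)
      show "G \<subseteq> H" using GM MH by simp
      show "fst ` H \<subseteq> S"
        using MS x S by (force simp: memH intro: subspace_add subspace_scale)
      show "\<forall>(s, l)\<in>H. l \<le> p s"
        using r by (auto simp: memH)
    qed
    then have "H = M" using max MH by blast
    moreover have "(x, r) \<in> H"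
      unfolding memH using subspace_0[OF Ms] by (intro exI[of _ 1] exI[of _ 0]) (simp add: zero_prod_def)
    ultimately show ?thesis by blast
  qed
  have uniq: "l = k" if "(s, l) \<in> M" "(s, k) \<in> M" for s l k
  proof -
    have p0: "p 0 = 0"
      using hom[of 0 0] S by (simp add: subspace_0)
    have "(0, l - k) \<in> M" "(0, k - l) \<in> M"
      using subspace_diff[OF Ms that] subspace_diff[OF Ms that(2,1)] by simp_all
    then have "l - k \<le> 0" "k - l \<le> 0"
      using Mp p0 by (metis, metis)
    then show ?thesis by simp
  qed
  define f where "f s = (THE l. (s, l) \<in> M)" for s
  have f: "(s, f s) \<in> M" if "s \<in> S" for s
    unfolding f_def using tot[OF that] uniq by (metis the_equality)
  have feq: "f s = l" if "(s, l) \<in> M" for s l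
    unfolding f_def using that uniq by blast
  show ?thesis
  proof (rule that)
    show "f (s + t) = f s + f t" if "s \<in> S" "t \<in> S" for s t
      using subspace_add[OF Ms f[OF that(1)] f[OF that(2)]] by (intro feq) simp
    show "f (c *\<^sub>R s) = c * f s" if "s \<in> S" for c s
      using subspace_scale[OF Ms f[OF that], of c] by (intro feq) simp
    show "f s \<le> p s" if "s \<in> S" for s
      using Mp f that by blast
    show "f s = l" if "(s, l) \<in> G" for s l
      using that GM feq by blast
  qed
qed


section \<open>Square-integrable functions: Cauchy-Schwarz, completeness and the Riesz
  theorem\<close>

text \<open>The discriminant criterion, evaluated at the minimiser c = -p / b. It serves for
  Cauchy-Schwarz and, in \<open>L2_riesz\<close>, for turning near-minimality into an error
  bound.\<close>

lemma quadratic_nonneg_imp_product_bound: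
  fixes a b p :: real
  assumes "\<And>c. 0 \<le> a + 2 * c * p + c\<^sup>2 * b" "0 \<le> a" "0 \<le> b"
  shows "\<bar>p\<bar> \<le> sqrt a * sqrt b"
proof (cases "b = 0")
  case True
  have "p = 0"
  proof (rule ccontr)
    assume "p \<noteq> 0"
    \<comment> \<open>For b = 0 this c gives the expression the value -1.\<close>
    then show False
      using assms(1)[of "- (a + 1) / (2 * p)"] True by (simp add: field_simps)
  qed
  then show ?thesis using assms(2,3) by simp
next
  case False
  then have b: "b > 0" using assms(3) by simp
  have "0 \<le> b * (a + 2 * (- p / b) * p + (- p / b)\<^sup>2 * b)"
    using assms(1)[of "- p / b"] b by simp
  also have "\<dots> = a * b - p\<^sup>2"
    using b by (simp add: field_simps power2_eq_square)
  finally have "p\<^sup>2 \<le> a * b" by simp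
  then have "sqrt (p\<^sup>2) \<le> sqrt (a * b)"
    by (rule real_sqrt_le_mono)
  then show ?thesis by (simp add: real_sqrt_mult)
qed

lemma in_L2_scaleR:
  assumes "in_L2 M f" shows "in_L2 M (\<lambda>x. c *\<^sub>R f x)"
  using assms by (auto simp: in_L2_def power_mult_distrib)

lemma in_L2_add:
  assumes "in_L2 M f" "in_L2 M g" shows "in_L2 M (\<lambda>x. f x + g x)"
  unfolding in_L2_def
proof
  show m: "(\<lambda>x. f x + g x) \<in> borel_measurable M"
    using assms by (auto simp: in_L2_def)
  have "(norm (f x + g x))\<^sup>2 \<le> 2 * (norm (f x))\<^sup>2 + 2 * (norm (g x))\<^sup>2" for x
  proof -
    have "(norm (f x + g x))\<^sup>2 \<le> (norm (f x) + norm (g x))\<^sup>2"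
      by (intro power_mono norm_triangle_ineq) simp
    also have "\<dots> \<le> 2 * (norm (f x))\<^sup>2 + 2 * (norm (g x))\<^sup>2"
      using sum_squares_bound[of "norm (f x)" "norm (g x)"] by (simp add: power2_sum)
    finally show ?thesis .
  qed
  moreover have "integrable M (\<lambda>x. 2 * (norm (f x))\<^sup>2 + 2 * (norm (g x))\<^sup>2)"
    using assms by (auto simp: in_L2_def)
  ultimately show "integrable M (\<lambda>x. (norm (f x + g x))\<^sup>2)"
    by (elim Bochner_Integration.integrable_bound) (use m in auto)
qed

lemma in_L2_diff:
  assumes "in_L2 M f" "in_L2 M g" shows "in_L2 M (\<lambda>x. f x - g x)"
  using in_L2_add[OF assms(1) in_L2_scaleR[OF assms(2), of "-1"]] by simp

lemma in_L2_bound: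
  assumes "in_L2 M f" "g \<in> borel_measurable M" "AE x in M. norm (g x) \<le> norm (f x)"
  shows "in_L2 M g"
  unfolding in_L2_def
proof
  show "integrable M (\<lambda>x. (norm (g x))\<^sup>2)"
  proof (rule Bochner_Integration.integrable_bound)
    show "integrable M (\<lambda>x. (norm (f x))\<^sup>2)" using assms(1) by (simp add: in_L2_def)
    show "AE x in M. norm ((norm (g x))\<^sup>2) \<le> norm ((norm (f x))\<^sup>2)"
      using assms(3) by (auto elim!: eventually_mono intro: power_mono)
  qed (use assms in auto)
qed fact

lemma in_L2_bounded:
  assumes "finite_measure M" "g \<in> borel_measurable M" "\<And>x. x \<in> space M \<Longrightarrow> norm (g x) \<le> C"
  shows "in_L2 M g"
proof -
  interpret finite_measure M by fact
  have "norm (g x) \<le> norm C" if "x \<in> space M" for x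
    using assms(3)[OF that] unfolding real_norm_def by linarith
  then have "AE x in M. norm (g x) \<le> norm C"
    by (rule AE_I2)
  moreover have "in_L2 M (\<lambda>_. C)"
    by (simp add: in_L2_def)
  ultimately show ?thesis
    using in_L2_bound assms(2) by blast
qed

lemma in_L2_inner_integrable:
  assumes "in_L2 M f" "in_L2 M g" shows "integrable M (\<lambda>x. f x \<bullet> g x)"
proof (rule Bochner_Integration.integrable_bound)
  show "integrable M (\<lambda>x. (norm (f x))\<^sup>2 + (norm (g x))\<^sup>2)"
    using assms by (auto simp: in_L2_def)
  show "(\<lambda>x. f x \<bullet> g x) \<in> borel_measurable M"
    using assms by (auto simp: in_L2_def)
  have "\<bar>f x \<bullet> g x\<bar> \<le> (norm (f x))\<^sup>2 + (norm (g x))\<^sup>2" for x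
  proof -
    have "0 \<le> norm (f x) * norm (g x)" by simp
    then show ?thesis
      using Cauchy_Schwarz_ineq2[of "f x" "g x"] sum_squares_bound[of "norm (f x)" "norm (g x)"] by linarith
  qed
  then show "AE x in M. norm (f x \<bullet> g x) \<le> norm ((norm (f x))\<^sup>2 + (norm (g x))\<^sup>2)"
    by auto
qed

lemma in_L2_norm_sq_add:
  assumes "in_L2 M f" "in_L2 M g"
  shows "(LINT x|M. (norm (f x + c *\<^sub>R g x))\<^sup>2) =
    (LINT x|M. (norm (f x))\<^sup>2) + 2 * c * (LINT x|M. f x \<bullet> g x) + c\<^sup>2 * (LINT x|M. (norm (g x))\<^sup>2)"
proof -
  have "(norm (f x + c *\<^sub>R g x))\<^sup>2 = (norm (f x))\<^sup>2 + 2 * c * (f x \<bullet> g x) + c\<^sup>2 * (norm (g x))\<^sup>2" for x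
    unfolding power2_norm_eq_inner
    by (simp add: inner_add_left inner_add_right inner_commute power2_eq_square algebra_simps)
  then show ?thesis
    using assms in_L2_inner_integrable[OF assms] by (simp add: in_L2_def)
qed

lemma L2_Cauchy_Schwarz:
  assumes "in_L2 M f" "in_L2 M g"
  shows "\<bar>LINT x|M. f x \<bullet> g x\<bar> \<le> sqrt (LINT x|M. (norm (f x))\<^sup>2) * sqrt (LINT x|M. (norm (g x))\<^sup>2)"
  by (rule quadratic_nonneg_imp_product_bound)
    (auto simp flip: in_L2_norm_sq_add[OF assms] intro!: integral_nonneg_AE)

lemma L2_triangle:
  assumes "in_L2 M f" "in_L2 M g"
  shows "sqrt (LINT x|M. (norm (f x + g x))\<^sup>2) \<le>
    sqrt (LINT x|M. (norm (f x))\<^sup>2) + sqrt (LINT x|M. (norm (g x))\<^sup>2)"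
proof (rule real_le_lsqrt)
  have nn: "0 \<le> (LINT x|M. (norm (f x))\<^sup>2)" "0 \<le> (LINT x|M. (norm (g x))\<^sup>2)"
    by simp_all
  show "(LINT x|M. (norm (f x + g x))\<^sup>2) \<le>
      (sqrt (LINT x|M. (norm (f x))\<^sup>2) + sqrt (LINT x|M. (norm (g x))\<^sup>2))\<^sup>2"
    using in_L2_norm_sq_add[OF assms, of 1] L2_Cauchy_Schwarz[OF assms] nn
    by (simp add: power2_sum)
qed simp

text \<open>The rate 1/8 leaves room for a weight 2^n: the weighted series of squared increments
  still has finite integral, so almost everywhere the increments decay geometrically and the
  sequence converges pointwise. Fatou's lemma carries the quadratic bounds to the limit.\<close>

lemma L2_complete:
  fixes X :: "nat \<Rightarrow> 'a \<Rightarrow> 'b::euclidean_space"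
  assumes X: "\<And>n. in_L2 M (X n)"
    and cauchy: "\<And>n m. n \<le> m \<Longrightarrow> (LINT x|M. (norm (X m x - X n x))\<^sup>2) \<le> (1 / 8) ^ n"
  obtains U where "in_L2 M U" "\<And>n. (LINT x|M. (norm (U x - X n x))\<^sup>2) \<le> (1 / 8) ^ n"
proof -
  have [measurable]: "X n \<in> borel_measurable M" for n
    using X by (simp add: in_L2_def)
  have nn: "(\<integral>\<^sup>+x. ennreal ((norm (X m x - X n x))\<^sup>2) \<partial>M) \<le> ennreal ((1 / 8) ^ n)" if "n \<le> m" for n m
    using in_L2_diff[OF X X] cauchy[OF that]
    by (subst nn_integral_eq_integral) (auto simp: in_L2_def intro!: ennreal_leI)
  have "(\<integral>\<^sup>+x. (\<Sum>n. ennreal (2 ^ n) * ennreal ((norm (X (Suc n) x - X n x))\<^sup>2)) \<partial>M) =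
      (\<Sum>n. ennreal (2 ^ n) * (\<integral>\<^sup>+x. ennreal ((norm (X (Suc n) x - X n x))\<^sup>2) \<partial>M))"
    by (subst nn_integral_suminf) (auto simp: nn_integral_cmult)
  also have "\<dots> \<le> (\<Sum>n. ennreal (2 ^ n) * ennreal ((1 / 8) ^ n))"
    by (intro suminf_le mult_left_mono nn) auto
  also have "\<dots> = (\<Sum>n. ennreal ((1 / 4) ^ n))"
    by (intro suminf_cong) (simp add: ennreal_mult[symmetric] power_mult_distrib[symmetric])
  also have "\<dots> < \<infinity>"
    by (subst suminf_ennreal2) auto
  finally have "AE x in M. (\<Sum>n. ennreal (2 ^ n) * ennreal ((norm (X (Suc n) x - X n x))\<^sup>2)) \<noteq> \<infinity>"
    by (intro nn_integral_PInf_AE) auto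
  moreover have "convergent (\<lambda>n. X n x)"
    if fin: "(\<Sum>n. ennreal (2 ^ n) * ennreal ((norm (X (Suc n) x - X n x))\<^sup>2)) \<noteq> \<infinity>" for x
  proof -
    obtain c where c: "0 \<le> c" "(\<Sum>n. ennreal (2 ^ n) * ennreal ((norm (X (Suc n) x - X n x))\<^sup>2)) = ennreal c"
      using fin by (cases "\<Sum>n. ennreal (2 ^ n) * ennreal ((norm (X (Suc n) x - X n x))\<^sup>2)") auto
    have "norm (X (Suc n) x - X n x) \<le> sqrt c * sqrt (1 / 2) ^ n" for n
    proof -
      have "ennreal (2 ^ n * (norm (X (Suc n) x - X n x))\<^sup>2) \<le> ennreal c"
        using sum_le_suminf[of "\<lambda>n. ennreal (2 ^ n) * ennreal ((norm (X (Suc n) x - X n x))\<^sup>2)" "{n}"] c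
        by (simp add: ennreal_mult)
      then have "2 ^ n * (norm (X (Suc n) x - X n x))\<^sup>2 \<le> c"
        using c by simp
      then have "(norm (X (Suc n) x - X n x))\<^sup>2 \<le> c * (1 / 2) ^ n"
        by (simp add: field_simps)
      then have "sqrt ((norm (X (Suc n) x - X n x))\<^sup>2) \<le> sqrt (c * (1 / 2) ^ n)"
        by (rule real_sqrt_le_mono)
      then show ?thesis by (simp add: real_sqrt_mult real_sqrt_power)
    qed
    note norm_le = this
    have summ: "summable (\<lambda>n. sqrt c * sqrt (1 / 2) ^ n)"
      by (intro summable_mult summable_geometric) (simp add: real_sqrt_lt_1_iff)
    have "summable (\<lambda>n. norm (X (Suc n) x - X n x))"
      by (rule summable_comparison_test'[OF summ, where N = 0]) (simp add: norm_le)
    then have "summable (\<lambda>n. X (Suc n) x - X n x)"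
      by (rule summable_norm_cancel)
    then have "convergent (\<lambda>n. \<Sum>k<n. X (Suc k) x - X k x)"
      by (simp add: summable_iff_convergent)
    then have "convergent (\<lambda>n. X n x - X 0 x)"
      unfolding sum_lessThan_telescope[of "\<lambda>k. X k x"] .
    then show ?thesis
      using convergent_add_const_right_iff[of "\<lambda>n. X n x" "- X 0 x"] by simp
  qed
  ultimately have conv: "AE x in M. convergent (\<lambda>n. X n x)"
    by (auto elim: eventually_mono)
  define U where "U x = lim (\<lambda>n. X n x)" for x
  have Um [measurable]: "U \<in> borel_measurable M"
    unfolding U_def by measurable
  have lim: "AE x in M. (\<lambda>n. X n x) \<longlonglongrightarrow> U x"
    using conv by (auto simp: U_def convergent_LIMSEQ_iff elim: eventually_mono)
  have fatou: "(\<integral>\<^sup>+x. ennreal ((norm (U x - X n x))\<^sup>2) \<partial>M) \<le> ennreal ((1 / 8) ^ n)" for n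
  proof -
    have "(\<integral>\<^sup>+x. ennreal ((norm (U x - X n x))\<^sup>2) \<partial>M) =
        (\<integral>\<^sup>+x. liminf (\<lambda>m. ennreal ((norm (X m x - X n x))\<^sup>2)) \<partial>M)"
    proof (rule nn_integral_cong_AE)
      show "AE x in M. ennreal ((norm (U x - X n x))\<^sup>2) = liminf (\<lambda>m. ennreal ((norm (X m x - X n x))\<^sup>2))"
        using lim
      proof eventually_elim
        case (elim x)
        have "(\<lambda>m. ennreal ((norm (X m x - X n x))\<^sup>2)) \<longlonglongrightarrow> ennreal ((norm (U x - X n x))\<^sup>2)"
          by (intro tendsto_intros elim)
        then show ?case
          by (rule lim_imp_Liminf[OF sequentially_bot, symmetric])
      qed
    qed
    also have "\<dots> \<le> liminf (\<lambda>m. \<integral>\<^sup>+x. ennreal ((norm (X m x - X n x))\<^sup>2) \<partial>M)"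
      by (rule nn_integral_liminf) auto
    also have "\<dots> \<le> ennreal ((1 / 8) ^ n)"
    proof -
      have "eventually (\<lambda>m. (\<integral>\<^sup>+x. ennreal ((norm (X m x - X n x))\<^sup>2) \<partial>M) \<le> ennreal ((1 / 8) ^ n)) sequentially"
        using nn by (auto simp: eventually_sequentially)
      then have "liminf (\<lambda>m. \<integral>\<^sup>+x. ennreal ((norm (X m x - X n x))\<^sup>2) \<partial>M) \<le> liminf (\<lambda>m::nat. ennreal ((1 / 8) ^ n))"
        by (rule Liminf_mono)
      then show ?thesis by (simp add: Liminf_const)
    qed
    finally show ?thesis .
  qed
  have d: "in_L2 M (\<lambda>x. U x - X n x)" for n
    unfolding in_L2_def
    using fatou[of n] by (auto intro!: integrableI_bounded simp: top.not_eq_extremum le_less_trans)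
  show ?thesis
  proof (rule that)
    show "in_L2 M U"
      using in_L2_add[OF d[of 0] X[of 0]] by simp
    show "(LINT x|M. (norm (U x - X n x))\<^sup>2) \<le> (1 / 8) ^ n" for n
      using fatou[of n] d[of n] by (subst (asm) nn_integral_eq_integral) (auto simp: in_L2_def)
  qed
qed

text \<open>Dirichlet's principle: \<open>U\<close> is the limit of a minimising sequence for
  \<open>J\<close>. The limit may leave \<open>S\<close>, so the Euler equation is not tested at
  \<open>U\<close> but obtained by passing to the limit in approximate equations at the members of
  the sequence.\<close>

lemma L2_riesz:
  fixes S :: "('a \<Rightarrow> 'b::euclidean_space) set"
  assumes S: "subspace S" and L2: "\<And>s. s \<in> S \<Longrightarrow> in_L2 M s"
    and add: "\<And>s t. s \<in> S \<Longrightarrow> t \<in> S \<Longrightarrow> F (s + t) = F s + F t"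
    and scale: "\<And>c s. s \<in> S \<Longrightarrow> F (c *\<^sub>R s) = c * F s"
    and bound: "\<And>s. s \<in> S \<Longrightarrow> F s \<le> C * sqrt (LINT x|M. (norm (s x))\<^sup>2)"
  obtains U where "in_L2 M U" "\<And>s. s \<in> S \<Longrightarrow> (LINT x|M. U x \<bullet> s x) = F s"
proof -
  define Q where "Q s = (LINT x|M. (norm (s x))\<^sup>2)" for s :: "'a \<Rightarrow> 'b"
  define J where "J s = Q s / 2 - F s" for s
  have Qnn: "0 \<le> Q s" for s
    by (simp add: Q_def)
  \<comment> \<open>Completing the square in sqrt (Q s), after bounding F s by C sqrt (Q s).\<close>
  have J_low: "- (C\<^sup>2 / 2) \<le> J s" if "s \<in> S" for s
  proof -
    have "0 \<le> (sqrt (Q s) - C)\<^sup>2" by simp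
    then show ?thesis
      using bound[OF that] Qnn[of s] unfolding J_def Q_def[symmetric] power2_diff
      by (simp add: algebra_simps)
  qed
  have Q_add: "Q (s + c *\<^sub>R t) = Q s + 2 * c * (LINT x|M. s x \<bullet> t x) + c\<^sup>2 * Q t"
    if "s \<in> S" "t \<in> S" for s t c
    using in_L2_norm_sq_add[OF L2[OF that(1)] L2[OF that(2)], of c] by (simp add: Q_def)
  have J_add: "J (s + c *\<^sub>R t) = J s + c * ((LINT x|M. s x \<bullet> t x) - F t) + c\<^sup>2 * Q t / 2"
    if "s \<in> S" "t \<in> S" for s t c
  proof -
    have "F (s + c *\<^sub>R t) = F s + c * F t"
      using that S by (simp add: add scale subspace_scale)
    then show ?thesis
      unfolding J_def Q_add[OF that] by (simp add: field_simps)
  qed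
  define I where "I = Inf (J ` S)"
  have bdd: "bdd_below (J ` S)"
    using J_low by (rule bdd_belowI2)
  have ne: "J ` S \<noteq> {}"
    using subspace_0[OF S] by auto
  have I_le: "I \<le> J s" if "s \<in> S" for s
    unfolding I_def by (rule cInf_lower[OF _ bdd]) (use that in auto)
  \<comment> \<open>The tolerance is chosen for the midpoint argument below, where passing to the
    midpoint gains Q D / 8; it yields exactly the rate required by
    \<open>L2_complete\<close>.\<close>
  have "\<exists>s\<in>S. J s < I + (1 / 8) ^ n / 8" for n :: nat
    using cInf_lessD[OF ne, of "I + (1 / 8) ^ n / 8"] by (auto simp: I_def)
  then obtain X where XS: "\<And>n. X n \<in> S" and XJ: "\<And>n. J (X n) < I + (1 / 8) ^ n / 8"
    by metis
  have cauchy: "Q (X m - X n) \<le> (1 / 8) ^ n" if "n \<le> m" for n m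
  proof -
    define D where "D = X m - X n"
    have D: "D \<in> S"
      using XS S by (simp add: D_def subspace_diff)
    define P where "P = (LINT x|M. X n x \<bullet> D x) - F D"
    have "J (X m) = J (X n) + P + Q D / 2"
      using J_add[OF XS[of n] D, of 1] by (simp add: D_def P_def)
    moreover have "J (X n + (1/2) *\<^sub>R D) = J (X n) + P / 2 + Q D / 8"
      using J_add[OF XS[of n] D, of "1/2"] by (simp add: power2_eq_square P_def)
    moreover have "I \<le> J (X n + (1/2) *\<^sub>R D)"
      using XS D S by (intro I_le subspace_add subspace_scale)
    ultimately have "Q D / 8 \<le> (J (X n) + J (X m)) / 2 - I"
      by (simp add: field_simps)
    also have "\<dots> \<le> (1 / 8) ^ n / 8"
    proof -
      have "(1 / 8) ^ m \<le> ((1 / 8) ^ n :: real)"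
        using that by (intro power_decreasing) auto
      moreover have "b \<le> a \<Longrightarrow> u < I + a / 8 \<Longrightarrow> v < I + b / 8 \<Longrightarrow> (u + v) / 2 - I \<le> a / 8"
        for a b u v :: real
        by (simp add: field_simps)
      ultimately show ?thesis
        using XJ by blast
    qed
    finally show ?thesis by (simp add: D_def)
  qed
  obtain U where U: "in_L2 M U" and UX: "\<And>n. (LINT x|M. (norm (U x - X n x))\<^sup>2) \<le> (1 / 8) ^ n"
    using L2_complete[of M X] L2[OF XS] cauchy unfolding Q_def by auto
  have "(LINT x|M. U x \<bullet> s x) = F s" if s: "s \<in> S" for s
  proof -
    let ?e = "\<lambda>n::nat. sqrt ((1 / 8) ^ n)"
    have e0: "?e \<longlonglongrightarrow> 0"
      using tendsto_real_sqrt[OF LIMSEQ_power_zero[of "1/8 :: real"]] by simp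
    \<comment> \<open>Moving from a near-minimiser along \<open>s\<close> cannot lower
      \<open>J\<close> by more than the tolerance. This is a nonnegative quadratic in c whose linear
      coefficient is the defect in the Euler equation.\<close>
    have 1: "\<bar>(LINT x|M. X n x \<bullet> s x) - F s\<bar> \<le> ?e n * sqrt (Q s)" for n
    proof (rule quadratic_nonneg_imp_product_bound)
      show "0 \<le> (1 / 8) ^ n + 2 * c * ((LINT x|M. X n x \<bullet> s x) - F s) + c\<^sup>2 * Q s" for c
      proof -
        have "I \<le> J (X n + c *\<^sub>R s)"
          using XS s S by (intro I_le subspace_add subspace_scale)
        then have "0 \<le> (1 / 8) ^ n / 8 + c * ((LINT x|M. X n x \<bullet> s x) - F s) + c\<^sup>2 * Q s / 2"
          unfolding J_add[OF XS s] using XJ[of n] by linarith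
        moreover have "(1 / 8) ^ n / 8 \<le> ((1 / 8) ^ n / 2 :: real)" by simp
        ultimately show ?thesis by linarith
      qed
    qed (use Qnn in auto)
    have 2: "\<bar>(LINT x|M. U x \<bullet> s x) - (LINT x|M. X n x \<bullet> s x)\<bar> \<le> ?e n * sqrt (Q s)" for n
    proof -
      have "(LINT x|M. U x \<bullet> s x) - (LINT x|M. X n x \<bullet> s x) = (LINT x|M. (U x - X n x) \<bullet> s x)"
        using in_L2_inner_integrable[OF U L2[OF s]] in_L2_inner_integrable[OF L2[OF XS] L2[OF s]]
        by (simp add: inner_diff_left)
      also have "\<bar>\<dots>\<bar> \<le> sqrt (LINT x|M. (norm (U x - X n x))\<^sup>2) * sqrt (Q s)"
        unfolding Q_def by (rule L2_Cauchy_Schwarz[OF in_L2_diff[OF U L2[OF XS]] L2[OF s]])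
      also have "\<dots> \<le> ?e n * sqrt (Q s)"
        using UX[of n] Qnn by (intro mult_right_mono real_sqrt_le_mono) auto
      finally show ?thesis .
    qed
    have "\<bar>(LINT x|M. U x \<bullet> s x) - F s\<bar> \<le> 2 * (?e n * sqrt (Q s))" for n
      using 1[of n] 2[of n] by linarith
    moreover have "(\<lambda>n. 2 * (?e n * sqrt (Q s))) \<longlonglongrightarrow> 2 * (0 * sqrt (Q s))"
      by (intro tendsto_intros e0)
    ultimately have "\<bar>(LINT x|M. U x \<bullet> s x) - F s\<bar> \<le> 2 * (0 * sqrt (Q s))"
      using LIMSEQ_le_const by blast
    then show ?thesis by simp
  qed
  with U show ?thesis by (rule that)
qed


section \<open>Duality on a time cylinder\<close>

abbreviation half_line :: "real measure"
  where "half_line \<equiv> restrict_space lborel {0<..}"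

lemma measurable_half_line_id: "(\<lambda>t. t) \<in> borel_measurable half_line"
  by (rule measurable_restrict_space1) simp

lemma sigma_finite_half_line: "sigma_finite_measure half_line"
  by (rule sigma_finite_measure_restrict_space) (auto intro: lborel.sigma_finite_measure_axioms)

lemma emeasure_half_line_atMost: "emeasure half_line ({..T} \<inter> {0<..}) < \<infinity>"
proof -
  have "emeasure half_line ({..T} \<inter> {0<..}) = emeasure lborel {0<..T}"
    by (subst emeasure_restrict_space) (auto simp: Int_def greaterThanAtMost_def conj_commute intro!: arg_cong[where f = "emeasure lborel"])
  also have "\<dots> < \<infinity>"
    by (cases "0 \<le> T") auto
  finally show ?thesis .
qed

lemma integrable_half_line_bounded:
  fixes h :: "real \<Rightarrow> 'b::{banach, second_countable_topology}"
  assumes "h \<in> borel_measurable half_line" "\<And>t. 0 < t \<Longrightarrow> norm (h t) \<le> C" "\<And>t. t > T \<Longrightarrow> h t = 0"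
  shows "integrable half_line h"
proof (rule integrableI_bounded_set[where A = "{..T} \<inter> {0<..}" and B = C])
  show "{..T} \<inter> {0<..} \<in> sets half_line"
    by (auto simp: sets_restrict_space)
  show "emeasure half_line ({..T} \<inter> {0<..}) < \<infinity>"
    by (rule emeasure_half_line_atMost)
  show "AE x\<in>{..T} \<inter> {0<..} in half_line. norm (h x) \<le> C"
    using assms(2) by (intro AE_I2) auto
  show "AE x in half_line. x \<notin> {..T} \<inter> {0<..} \<longrightarrow> h x = 0"
    using assms(3) by (intro AE_I2) (auto simp: space_restrict_space)
qed fact

text \<open>Mass one of this density is what gives \<open>slice_norm_integral_le\<close> the
  constant 1.\<close>

lemma exp_minus_half_line:
  "integrable half_line (\<lambda>t. exp (- t))" "(LINT t|half_line. exp (- t)) = 1"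
proof -
  have "has_bochner_integral lborel (\<lambda>t. exp (- t) * indicator {0..} t) (0 - (- exp (- 0 :: real)))"
  proof (rule has_bochner_integral_nn_integral)
    show "(\<integral>\<^sup>+t. ennreal (exp (- t) * indicator {0..} t) \<partial>lborel) = ennreal (0 - (- exp (- 0 :: real)))"
    proof (subst nn_integral_cong[where v = "\<lambda>t. ennreal (exp (- t)) * indicator {0..} t"])
      show "(\<integral>\<^sup>+t. ennreal (exp (- t)) * indicator {0..} t \<partial>lborel) = ennreal (0 - (- exp (- 0 :: real)))"
      proof (rule nn_integral_FTC_atLeast)
        show "((\<lambda>t. - exp (- t)) has_real_derivative exp (- t)) (at t)" for t :: real
          by (auto intro!: derivative_eq_intros)
        have "((\<lambda>t::real. exp (- t)) \<longlongrightarrow> 0) at_top"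
          by (intro filterlim_compose[OF exp_at_bot] filterlim_uminus_at_bot_at_top)
        then show "((\<lambda>t::real. - exp (- t)) \<longlongrightarrow> 0) at_top"
          using tendsto_minus by fastforce
      qed auto
    qed (auto simp: indicator_def)
  qed auto
  then have 1: "has_bochner_integral lborel (\<lambda>t. exp (- t) * indicator {0..} t) (1::real)"
    by simp
  have "AE t in lborel. t \<noteq> (0::real)"
    by (rule AE_lborel_singleton)
  then have 2: "AE t in lborel. indicator {0<..} t *\<^sub>R exp (- t) = exp (- t) * indicator {0..} (t::real)"
    by eventually_elim (auto simp: indicator_def)
  have "has_bochner_integral lborel (\<lambda>t. indicator {0<..} t *\<^sub>R exp (- t)) (1::real)"
    by (rule has_bochner_integral_cong_AE[THEN iffD2, OF _ _ 2 1]) auto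
  then show "integrable half_line (\<lambda>t. exp (- t))" "(LINT t|half_line. exp (- t)) = 1"
    by (auto simp: integrable_restrict_space integral_restrict_space has_bochner_integral_iff)
qed

lemma borel_measurable_fst_snd:
  fixes s :: "'a \<Rightarrow> 'b::euclidean_space \<times> 'c::euclidean_space"
  assumes "s \<in> borel_measurable M"
  shows "(\<lambda>z. fst (s z)) \<in> borel_measurable M" "(\<lambda>z. snd (s z)) \<in> borel_measurable M"
  by (rule measurable_compose[OF assms borel_measurable_continuous_onI], intro continuous_intros)+

text \<open>The measure \<open>m\<close> on states stays abstract because two instances occur: the
  Gibbs measure, for which the estimates hold, and the unweighted state measure, in which the
  solution is finally expressed.\<close>

locale time_cylinder = finite_measure m for m :: "'x measure"
begin

abbreviation cyl :: "('x \<times> real) measure"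
  where "cyl \<equiv> m \<Otimes>\<^sub>M half_line"

sublocale time: sigma_finite_measure half_line
  by (rule sigma_finite_half_line)

sublocale pair_sigma_finite m half_line ..

lemma space_cyl: "space cyl = space m \<times> {0<..}"
  by (simp add: space_pair_measure space_restrict_space)

lemma measurable_slice: "h \<in> borel_measurable cyl \<Longrightarrow> 0 < t \<Longrightarrow> (\<lambda>x. h (x, t)) \<in> borel_measurable m"
  by (rule measurable_compose[OF measurable_Pair2'])
    (auto simp: space_restrict_space)

lemma measurable_slice_integral [measurable]:
  fixes h :: "_ \<Rightarrow> 'b::{banach, second_countable_topology}"
  assumes [measurable]: "h \<in> borel_measurable cyl"
  shows "(\<lambda>t. LINT x|m. h (x, t)) \<in> borel_measurable half_line"
  by measurable

text \<open>Genuine functions rather than classes modulo null sets. Boundedness and vanishing after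
  a finite time make all norms and pairings below finite, as \<open>m\<close> is finite. The bound
  is asked only on the space, the vanishing at every point.\<close>

definition bounded_fields :: "('x \<times> real \<Rightarrow> 'b::euclidean_space) set" where
  "bounded_fields = {s. s \<in> borel_measurable cyl \<and> (\<exists>C. \<forall>z\<in>space cyl. norm (s z) \<le> C) \<and>
     (\<exists>T. \<forall>x t. t > T \<longrightarrow> s (x, t) = 0)}"

lemma bounded_fields_bounds:
  assumes "s \<in> bounded_fields"
  shows "\<exists>C T. 0 \<le> C \<and> (\<forall>x\<in>space m. \<forall>t>0. norm (s (x, t)) \<le> C) \<and> (\<forall>x. \<forall>t>T. s (x, t) = 0)"
proof -
  obtain C T where "\<forall>z\<in>space cyl. norm (s z) \<le> C" "\<forall>x t. t > T \<longrightarrow> s (x, t) = 0"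
    using assms by (auto simp: bounded_fields_def)
  then show ?thesis
    by (intro exI[of _ "max 0 C"] exI[of _ T]) (auto simp: space_cyl le_max_iff_disj)
qed

lemma bounded_fields_measurable: "s \<in> bounded_fields \<Longrightarrow> s \<in> borel_measurable cyl"
  by (simp add: bounded_fields_def)

lemma bounded_fieldsI:
  assumes "s \<in> borel_measurable cyl" "\<And>x t. x \<in> space m \<Longrightarrow> 0 < t \<Longrightarrow> norm (s (x, t)) \<le> C"
    "\<And>x t. t > T \<Longrightarrow> s (x, t) = 0"
  shows "s \<in> bounded_fields"
  using assms unfolding bounded_fields_def space_cyl by blast

lemma subspace_bounded_fields: "subspace (bounded_fields :: ('x \<times> real \<Rightarrow> 'b::euclidean_space) set)"
  unfolding subspace_def
proof (intro conjI ballI allI)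
  show "0 \<in> bounded_fields"
    by (rule bounded_fieldsI[where C = 0 and T = 0]) (auto simp: zero_fun_def)
next
  fix s t :: "'x \<times> real \<Rightarrow> 'b" assume s: "s \<in> bounded_fields" and t: "t \<in> bounded_fields"
  have [measurable]: "s \<in> borel_measurable cyl"
    by (rule bounded_fields_measurable[OF s])
  obtain C T where "0 \<le> C" and
    1: "\<And>x t. x \<in> space m \<Longrightarrow> 0 < t \<Longrightarrow> norm (s (x, t)) \<le> C" "\<And>x t. t > T \<Longrightarrow> s (x, t) = 0"
    using bounded_fields_bounds[OF s] by blast
  have [measurable]: "t \<in> borel_measurable cyl"
    by (rule bounded_fields_measurable[OF t])
  obtain D R where "0 \<le> D" and
    2: "\<And>x r. x \<in> space m \<Longrightarrow> 0 < r \<Longrightarrow> norm (t (x, r)) \<le> D" "\<And>x r. r > R \<Longrightarrow> t (x, r) = 0"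
    using bounded_fields_bounds[OF t] by blast
  show "s + t \<in> bounded_fields"
  proof (rule bounded_fieldsI[where C = "C + D" and T = "max T R"])
    show "s + t \<in> borel_measurable cyl"
      unfolding plus_fun_def by measurable
  qed (use 1 2 in \<open>auto intro: norm_triangle_mono\<close>)
next
  fix s :: "'x \<times> real \<Rightarrow> 'b" and c assume s: "s \<in> bounded_fields"
  have [measurable]: "s \<in> borel_measurable cyl"
    by (rule bounded_fields_measurable[OF s])
  obtain C T where "0 \<le> C" and
    1: "\<And>x t. x \<in> space m \<Longrightarrow> 0 < t \<Longrightarrow> norm (s (x, t)) \<le> C" "\<And>x t. t > T \<Longrightarrow> s (x, t) = 0"
    using bounded_fields_bounds[OF s] by blast
  show "c *\<^sub>R s \<in> bounded_fields"
  proof (rule bounded_fieldsI[where C = "\<bar>c\<bar> * C" and T = T])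
    show "c *\<^sub>R s \<in> borel_measurable cyl"
      unfolding scaleR_fun_def by measurable
  qed (use 1 in \<open>auto intro: mult_left_mono\<close>)
qed

lemma bounded_fields_integrable:
  assumes "s \<in> bounded_fields"
  shows "integrable cyl s"
proof -
  obtain C T where *: "0 \<le> C"
    "\<And>x t. x \<in> space m \<Longrightarrow> 0 < t \<Longrightarrow> norm (s (x, t)) \<le> C" "\<And>x t. t > T \<Longrightarrow> s (x, t) = 0"
    using bounded_fields_bounds[OF assms] by blast
  show ?thesis
  proof (rule integrableI_bounded_set[where A = "space m \<times> ({..T} \<inter> {0<..})" and B = C])
    have T: "{..T} \<inter> {0<..} \<in> sets half_line"
      by (auto simp: sets_restrict_space)
    then show "space m \<times> ({..T} \<inter> {0<..}) \<in> sets cyl" by auto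
    show "emeasure cyl (space m \<times> ({..T} \<inter> {0<..})) < \<infinity>"
      using T emeasure_half_line_atMost[of T]
      by (subst time.emeasure_pair_measure_Times) (auto simp: ennreal_mult_eq_top_iff less_top[symmetric])
    show "AE z\<in>space m \<times> ({..T} \<inter> {0<..}) in cyl. norm (s z) \<le> C"
      using *(2) by (intro AE_I2) auto
    show "AE z in cyl. z \<notin> space m \<times> ({..T} \<inter> {0<..}) \<longrightarrow> s z = 0"
      using *(3) by (intro AE_I2) (auto simp: space_cyl intro: leI)
  qed (rule bounded_fields_measurable[OF assms])
qed

lemma bounded_fields_norm_sq:
  assumes "s \<in> bounded_fields"
  shows "(\<lambda>z. (norm (s z))\<^sup>2) \<in> bounded_fields"
proof -
  have [measurable]: "s \<in> borel_measurable cyl"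
    by (rule bounded_fields_measurable[OF assms])
  obtain C T where "0 \<le> C" and **: "\<And>x t. x \<in> space m \<Longrightarrow> 0 < t \<Longrightarrow> norm (s (x, t)) \<le> C" "\<And>x t. t > T \<Longrightarrow> s (x, t) = 0"
    using bounded_fields_bounds[OF assms] by blast
  show ?thesis
    by (rule bounded_fieldsI[where C = "C\<^sup>2" and T = T]) (use ** in \<open>auto intro: power_mono\<close>)
qed

lemma bounded_fields_in_L2: "s \<in> bounded_fields \<Longrightarrow> in_L2 cyl s"
  unfolding in_L2_def using bounded_fields_integrable[OF bounded_fields_norm_sq]
  by (auto dest: bounded_fields_measurable)

lemma bounded_fields_bound:
  assumes "s \<in> bounded_fields" "r \<in> borel_measurable cyl"
    "\<And>x t. x \<in> space m \<Longrightarrow> 0 < t \<Longrightarrow> norm (r (x, t)) \<le> norm (s (x, t))"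
    "\<And>x t. s (x, t) = 0 \<Longrightarrow> r (x, t) = 0"
  shows "r \<in> bounded_fields"
proof -
  obtain C T where "0 \<le> C" and **: "\<And>x t. x \<in> space m \<Longrightarrow> 0 < t \<Longrightarrow> norm (s (x, t)) \<le> C" "\<And>x t. t > T \<Longrightarrow> s (x, t) = 0"
    using bounded_fields_bounds[OF assms(1)] by blast
  show ?thesis
    by (rule bounded_fieldsI[where C = C and T = T])
      (use assms(2,3,4) ** order_trans in blast)+
qed

definition slice_norm :: "('x \<times> real \<Rightarrow> 'b::euclidean_space) \<Rightarrow> real \<Rightarrow> real" where
  "slice_norm s t = sqrt (LINT x|m. (norm (s (x, t)))\<^sup>2)"

lemma slice_norm_nonneg: "0 \<le> slice_norm s t"
  by (simp add: slice_norm_def)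

lemma slice_norm_sq: "(slice_norm s t)\<^sup>2 = (LINT x|m. (norm (s (x, t)))\<^sup>2)"
  by (simp add: slice_norm_def)

lemma slice_norm_measurable [measurable]:
  assumes [measurable]: "s \<in> borel_measurable cyl"
  shows "slice_norm s \<in> borel_measurable half_line"
  unfolding slice_norm_def[abs_def] by measurable

lemma bounded_fields_slice:
  assumes "s \<in> bounded_fields" "0 < t"
  shows "in_L2 m (\<lambda>x. s (x, t))"
proof -
  obtain C T where *: "0 \<le> C"
    "\<And>x t. x \<in> space m \<Longrightarrow> 0 < t \<Longrightarrow> norm (s (x, t)) \<le> C" "\<And>x t. t > T \<Longrightarrow> s (x, t) = 0"
    using bounded_fields_bounds[OF assms(1)] by blast
  show ?thesis
    by (rule in_L2_bounded[where C = C]) (use * assms(2) bounded_fields_measurable[OF assms(1)] in \<open>auto intro: measurable_slice finite_measure_axioms\<close>)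
qed

lemma slice_norm_bounded:
  assumes "s \<in> bounded_fields"
  shows "\<exists>C T. (\<forall>t>0. slice_norm s t \<le> C) \<and> (\<forall>t>T. slice_norm s t = 0)"
proof -
  obtain C T where *: "0 \<le> C"
    "\<And>x t. x \<in> space m \<Longrightarrow> 0 < t \<Longrightarrow> norm (s (x, t)) \<le> C" "\<And>x t. t > T \<Longrightarrow> s (x, t) = 0"
    using bounded_fields_bounds[OF assms(1)] by blast
  have 1: "slice_norm s t \<le> sqrt (LINT x|m. C\<^sup>2)" if "0 < t" for t
    unfolding slice_norm_def
  proof (intro real_sqrt_le_mono integral_mono)
    show "integrable m (\<lambda>x. (norm (s (x, t)))\<^sup>2)"
      using bounded_fields_slice[OF assms that] by (simp add: in_L2_def)
  qed (use *(2)[OF _ that] in \<open>auto intro: power_mono\<close>)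
  show ?thesis
    using 1 *(3) by (intro exI[of _ "sqrt (LINT x|m. C\<^sup>2)"] exI[of _ T]) (auto simp: slice_norm_def)
qed

lemma slice_norm_integrable:
  assumes "s \<in> bounded_fields"
  shows "integrable half_line (slice_norm s)"
proof -
  have [measurable]: "s \<in> borel_measurable cyl"
    by (rule bounded_fields_measurable[OF assms])
  obtain C T where *: "\<And>t. 0 < t \<Longrightarrow> slice_norm s t \<le> C" "\<And>t. t > T \<Longrightarrow> slice_norm s t = 0"
    using slice_norm_bounded[OF assms] by blast
  show ?thesis
    by (rule integrable_half_line_bounded[where C = C and T = T]) (use * in \<open>auto simp: abs_of_nonneg[OF slice_norm_nonneg]\<close>)
qed

lemma slice_norm_add:
  assumes "s \<in> bounded_fields" "r \<in> bounded_fields" "0 < t"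
  shows "slice_norm (s + r) t \<le> slice_norm s t + slice_norm r t"
  using L2_triangle[OF bounded_fields_slice[OF assms(1,3)] bounded_fields_slice[OF assms(2,3)]]
  by (simp add: slice_norm_def)

lemma slice_norm_scaleR: "slice_norm (c *\<^sub>R s) t = \<bar>c\<bar> * slice_norm s t"
  by (simp add: slice_norm_def power_mult_distrib real_sqrt_mult)

lemma Fubini_slices:
  fixes h :: "'x \<times> real \<Rightarrow> 'b::{banach, second_countable_topology}"
  assumes "integrable cyl h"
  shows "(LINT t|half_line. LINT x|m. h (x, t)) = (LINT z|cyl. h z)"
    and "AE t in half_line. integrable m (\<lambda>x. h (x, t))"
    and "integrable half_line (\<lambda>t. LINT x|m. h (x, t))"
  using integral_snd[of "\<lambda>x t. h (x, t)"] AE_integrable_snd[of "\<lambda>x t. h (x, t)"]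
    integrable_snd[of "\<lambda>x t. h (x, t)"] assms by auto


text \<open>The weight \<open>exp t\<close> makes the norm of \<open>L\<^sup>1(0, \<infinity>; L\<^sup>2)\<close> continuous for a Hilbert norm.\<close>

lemma slice_norm_integral_le:
  assumes s: "s \<in> bounded_fields"
  shows "(LINT t|half_line. slice_norm s t) \<le> sqrt (LINT z|cyl. exp (snd z) * (norm (s z))\<^sup>2)"
proof -
  have [measurable]: "s \<in> borel_measurable cyl"
    by (rule bounded_fields_measurable[OF s])
  obtain C T where CT: "\<And>t. 0 < t \<Longrightarrow> slice_norm s t \<le> C" "\<And>t. t > T \<Longrightarrow> slice_norm s t = 0"
    using slice_norm_bounded[OF s] by blast
  note [measurable] = measurable_half_line_id
  have [measurable]: "slice_norm s \<in> borel_measurable half_line"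
    by (rule slice_norm_measurable) measurable
  have e: "(exp (- (t / 2)))\<^sup>2 = exp (- t)" "(exp (t / 2))\<^sup>2 = exp t" for t :: real
    by (simp_all add: power2_eq_square flip: exp_add)
  have 1: "in_L2 half_line (\<lambda>t. exp (- (t / 2)))"
    unfolding in_L2_def using exp_minus_half_line(1)
    by (auto simp: e intro!: measurable_restrict_space1)
  have sq: "(norm (exp (t / 2) * slice_norm s t))\<^sup>2 = exp t * (slice_norm s t)\<^sup>2" for t
    by (simp add: power_mult_distrib e)
  have le: "exp t * (slice_norm s t)\<^sup>2 \<le> exp T * C\<^sup>2" if "0 < t" for t
  proof (cases "t > T")
    case False
    then show ?thesis
      using CT(1)[OF that] slice_norm_nonneg[of s t] by (intro mult_mono power_mono) auto
  qed (use CT(2) in simp)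
  have 2: "in_L2 half_line (\<lambda>t. exp (t / 2) * slice_norm s t)"
    unfolding in_L2_def sq
  proof
    show "integrable half_line (\<lambda>t. exp t * (slice_norm s t)\<^sup>2)"
      by (rule integrable_half_line_bounded[where C = "exp T * C\<^sup>2" and T = T]) (use CT le in auto)
  qed auto
  have I: "integrable cyl (\<lambda>z. exp (snd z) * (norm (s z))\<^sup>2)"
  proof -
    obtain D R where D: "0 \<le> D" "\<And>x t. x \<in> space m \<Longrightarrow> 0 < t \<Longrightarrow> norm (s (x, t)) \<le> D" "\<And>x t. t > R \<Longrightarrow> s (x, t) = 0"
      using bounded_fields_bounds[OF s] by blast
    have "exp t * (norm (s (x, t)))\<^sup>2 \<le> exp R * D\<^sup>2" if "x \<in> space m" "0 < t" for x t
    proof (cases "t > R")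
      case False
      then show ?thesis
        using D(2)[OF that] by (intro mult_mono power_mono) auto
    qed (use D in auto)
    then have "(\<lambda>z. exp (snd z) * (norm (s z))\<^sup>2) \<in> bounded_fields"
      by (intro bounded_fieldsI[where C = "exp R * D\<^sup>2" and T = R]) (use D in auto)
    then show ?thesis by (rule bounded_fields_integrable)
  qed
  \<comment> \<open>The factors exp (-t/2) and exp (t/2) are inserted for Cauchy-Schwarz; the first
    has unit L2 norm.\<close>
  have "(LINT t|half_line. slice_norm s t) = (LINT t|half_line. exp (- (t / 2)) \<bullet> (exp (t / 2) * slice_norm s t))"
    by (intro Bochner_Integration.integral_cong) (auto simp: mult.assoc[symmetric] simp flip: exp_add)
  also have "\<dots> \<le> sqrt (LINT t|half_line. exp (- t)) * sqrt (LINT t|half_line. exp t * (slice_norm s t)\<^sup>2)"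
    using L2_Cauchy_Schwarz[OF 1 2] unfolding sq by (simp add: e)
  also have "(LINT t|half_line. exp t * (slice_norm s t)\<^sup>2) = (LINT z|cyl. exp (snd z) * (norm (s z))\<^sup>2)"
    using Fubini_slices(1)[OF I] by (simp add: slice_norm_sq)
  finally show ?thesis by (simp add: exp_minus_half_line)
qed

lemma bounded_fields_indicator:
  assumes "s \<in> bounded_fields" "{z\<in>space cyl. P z} \<in> sets cyl"
  shows "(\<lambda>z. of_bool (P z) *\<^sub>R s z) \<in> bounded_fields"
proof (rule bounded_fields_bound[OF assms(1)])
  have [measurable]: "s \<in> borel_measurable cyl" "Measurable.pred cyl P"
    using bounded_fields_measurable[OF assms(1)] assms(2) by (simp_all add: pred_def)
  have "(\<lambda>z. if P z then s z else 0) \<in> borel_measurable cyl" by measurable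
  then show "(\<lambda>z. of_bool (P z) *\<^sub>R s z) \<in> borel_measurable cyl"
    by (rule back_subst[where P = "\<lambda>f. f \<in> _"]) auto
qed auto

text \<open>If the slices had norm above \<open>C\<close> on a set of times of positive measure,
  testing with \<open>u\<close> restricted to these times would violate the duality bound. As
  \<open>u\<close> itself is not an admissible test, values above \<open>n\<close> are cut off and
  times are limited to \<open>N\<close>; Fatou's lemma removes the cut-off in the end.\<close>

lemma dual_slice_bound:
  fixes u :: "'x \<times> real \<Rightarrow> real"
  assumes [measurable]: "u \<in> borel_measurable cyl" and C: "0 \<le> C"
    and dual: "\<And>s. s \<in> bounded_fields \<Longrightarrow> (LINT z|cyl. u z * s z) \<le> C * (LINT t|half_line. slice_norm s t)"
  shows "AE t in half_line. in_L2 m (\<lambda>x. u (x, t)) \<and> (LINT x|m. (u (x, t))\<^sup>2) \<le> C\<^sup>2"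
proof -
  define u' where "u' n z = (if \<bar>u z\<bar> \<le> real n then u z else 0)" for n z
  have [measurable]: "u' n \<in> borel_measurable cyl" for n
    unfolding u'_def[abs_def] by measurable
  have bnd: "AE t in half_line. t \<le> real N \<longrightarrow> slice_norm (u' n) t \<le> C" for n N :: nat
  proof -
    define B where "B t \<longleftrightarrow> t \<le> real N \<and> C < slice_norm (u' n) t" for t
    note [measurable] = measurable_half_line_id
    have [measurable]: "slice_norm (u' n) \<in> borel_measurable half_line"
      by (rule slice_norm_measurable) measurable
    have [measurable]: "Measurable.pred half_line B"
      unfolding B_def by measurable
    \<comment> \<open>On the exceptional times (slice norm)^2 - C (slice norm) is positive,
      elsewhere both terms vanish; duality makes the integral of this difference nonpositive, so the
      exceptional set is null.\<close>
    define s where "s z = of_bool (B (snd z)) * u' n z" for z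
    have sm [measurable]: "s \<in> borel_measurable cyl"
    proof -
      have "(\<lambda>z. if B (snd z) then u' n z else 0) \<in> borel_measurable cyl" by measurable
      then show ?thesis
        by (rule back_subst[where P = "\<lambda>f. f \<in> _"]) (auto simp: s_def)
    qed
    have s: "s \<in> bounded_fields"
      by (rule bounded_fieldsI[where C = "real n" and T = "real N"]) (auto simp: s_def u'_def B_def)
    have us: "u z * s z = (norm (s z))\<^sup>2" for z
      by (auto simp: s_def u'_def power2_eq_square)
    have sl: "slice_norm s t = of_bool (B t) * slice_norm (u' n) t" for t
      by (auto simp: slice_norm_def s_def)
    have is1: "integrable half_line (slice_norm s)"
      by (rule slice_norm_integrable[OF s])
    have is2: "integrable half_line (\<lambda>t. (slice_norm s t)\<^sup>2)"
      using Fubini_slices(3)[OF bounded_fields_integrable[OF bounded_fields_norm_sq[OF s]]]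
      by (simp add: slice_norm_sq)
    have "(LINT t|half_line. (slice_norm s t)\<^sup>2) = (LINT z|cyl. u z * s z)"
      using Fubini_slices(1)[OF bounded_fields_integrable[OF bounded_fields_norm_sq[OF s]]]
      by (simp add: slice_norm_sq us)
    also have "\<dots> \<le> C * (LINT t|half_line. slice_norm s t)"
      by (rule dual[OF s])
    finally have "(LINT t|half_line. (slice_norm s t)\<^sup>2 - C * slice_norm s t) \<le> 0"
      using is1 is2 by simp
    moreover have nn: "0 \<le> (slice_norm s t)\<^sup>2 - C * slice_norm s t" for t
      using C by (auto simp: sl B_def power2_eq_square intro: mult_right_mono)
    ultimately have "(LINT t|half_line. (slice_norm s t)\<^sup>2 - C * slice_norm s t) = 0"
      by (intro antisym integral_nonneg_AE) auto
    then have "AE t in half_line. (slice_norm s t)\<^sup>2 - C * slice_norm s t = 0"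
      using is1 is2 nn by (subst (asm) integral_nonneg_eq_0_iff_AE) auto
    then show ?thesis
    proof eventually_elim
      case (elim t)
      have "\<not> B t"
      proof
        assume B: "B t"
        then have "slice_norm s t > C" by (simp add: sl B_def)
        moreover have "slice_norm s t * (slice_norm s t - C) = 0"
          using elim by (simp add: power2_eq_square algebra_simps)
        ultimately show False using C by auto
      qed
      then show ?case by (auto simp: B_def)
    qed
  qed
  have "AE t in half_line. \<forall>n N. t \<le> real N \<longrightarrow> slice_norm (u' n) t \<le> C"
    using bnd unfolding AE_all_countable by blast
  moreover have "AE t in half_line. t \<in> space half_line" by (rule AE_space)
  ultimately show ?thesis
  proof eventually_elim
    case (elim t)
    then have t: "0 < t" by (simp add: space_restrict_space)
    have [measurable]: "(\<lambda>x. u (x, t)) \<in> borel_measurable m" "(\<lambda>x. u' n (x, t)) \<in> borel_measurable m" for n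
      using t by (auto intro: measurable_slice)
    have b: "(LINT x|m. (u' n (x, t))\<^sup>2) \<le> C\<^sup>2" for n
    proof -
      have "slice_norm (u' n) t \<le> C"
        using elim real_arch_simple[of t] by blast
      then show ?thesis
        using power_mono[of "slice_norm (u' n) t" C 2] slice_norm_nonneg[of "u' n" t]
        by (simp add: slice_norm_sq)
    qed
    have "(\<integral>\<^sup>+x. ennreal ((u (x, t))\<^sup>2) \<partial>m) = (\<integral>\<^sup>+x. liminf (\<lambda>n. ennreal ((u' n (x, t))\<^sup>2)) \<partial>m)"
    proof (rule nn_integral_cong)
      fix x
      obtain n0 where "\<bar>u (x, t)\<bar> \<le> real n0" using real_arch_simple by blast
      then have "eventually (\<lambda>n. ennreal ((u' n (x, t))\<^sup>2) = ennreal ((u (x, t))\<^sup>2)) sequentially"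
        by (auto simp: u'_def eventually_sequentially intro!: exI[of _ n0])
      then have "(\<lambda>n. ennreal ((u' n (x, t))\<^sup>2)) \<longlonglongrightarrow> ennreal ((u (x, t))\<^sup>2)"
        by (rule tendsto_eventually)
      then show "ennreal ((u (x, t))\<^sup>2) = liminf (\<lambda>n. ennreal ((u' n (x, t))\<^sup>2))"
        by (rule lim_imp_Liminf[OF sequentially_bot, symmetric])
    qed
    also have "\<dots> \<le> liminf (\<lambda>n. \<integral>\<^sup>+x. ennreal ((u' n (x, t))\<^sup>2) \<partial>m)"
      by (rule nn_integral_liminf) auto
    also have "\<dots> \<le> liminf (\<lambda>n::nat. ennreal (C\<^sup>2))"
    proof (intro Liminf_mono always_eventually allI)
      fix n
      have "in_L2 m (\<lambda>x. u' n (x, t))"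
        by (rule in_L2_bounded[where C = "real n"]) (auto simp: u'_def finite_measure_axioms)
      then show "(\<integral>\<^sup>+x. ennreal ((u' n (x, t))\<^sup>2) \<partial>m) \<le> ennreal (C\<^sup>2)"
        using b by (subst nn_integral_eq_integral) (auto simp: in_L2_def intro!: ennreal_leI)
    qed
    finally have *: "(\<integral>\<^sup>+x. ennreal ((u (x, t))\<^sup>2) \<partial>m) \<le> ennreal (C\<^sup>2)"
      by (simp add: Liminf_const)
    have i: "integrable m (\<lambda>x. (u (x, t))\<^sup>2)"
      using * by (auto intro!: integrableI_bounded simp: le_less_trans)
    moreover have "(LINT x|m. (u (x, t))\<^sup>2) \<le> C\<^sup>2"
      using * by (subst (asm) nn_integral_eq_integral[OF i]) auto
    ultimately show ?case
      by (simp add: in_L2_def)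
  qed
qed

text \<open>The bound uniform in time comes from the Hahn-Banach extension, since \<open>L\<^sup>\<infinity>(L\<^sup>2) \<times> L\<^sup>2(L\<^sup>2)\<close> is the
  dual for the dominating norm; the Riesz theorem only supplies a representing function.\<close>

theorem mixed_norm_representation:
  fixes G :: "(('x \<times> real \<Rightarrow> real \<times> 'g::euclidean_space) \<times> real) set"
  assumes G: "subspace G" and GB: "fst ` G \<subseteq> bounded_fields" and C1: "0 \<le> C1" and C2: "0 \<le> C2"
    and dom: "\<And>s l. (s, l) \<in> G \<Longrightarrow>
      l \<le> C1 * (LINT t|half_line. slice_norm (\<lambda>z. fst (s z)) t) + C2 * sqrt (LINT z|cyl. (norm (snd (s z)))\<^sup>2)"
  obtains V where "V \<in> borel_measurable cyl"
    and "\<And>T. in_L2 cyl (\<lambda>z. of_bool (snd z \<le> T) *\<^sub>R V z)"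
    and "AE t in half_line. in_L2 m (\<lambda>x. fst (V (x, t))) \<and> (LINT x|m. (fst (V (x, t)))\<^sup>2) \<le> C1\<^sup>2"
    and "\<And>s l. (s, l) \<in> G \<Longrightarrow> (LINT z|cyl. V z \<bullet> s z) = l"
proof -
  note [measurable] = measurable_half_line_id
  let ?S = "bounded_fields :: ('x \<times> real \<Rightarrow> real \<times> 'g) set"
  define N where "N s = C1 * (LINT t|half_line. slice_norm (\<lambda>z. fst (s z)) t) +
    C2 * sqrt (LINT z|cyl. (norm (snd (s z)))\<^sup>2)" for s :: "'x \<times> real \<Rightarrow> real \<times> 'g"
  have fst_B: "(\<lambda>z. fst (s z)) \<in> bounded_fields" and snd_B: "(\<lambda>z. snd (s z)) \<in> bounded_fields" if s: "s \<in> ?S" for s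
  proof -
    note borel_measurable_fst_snd[OF bounded_fields_measurable[OF s], measurable]
    show "(\<lambda>z. fst (s z)) \<in> bounded_fields" "(\<lambda>z. snd (s z)) \<in> bounded_fields"
      using norm_fst_le[of "fst (s z)" "snd (s z)" for z] norm_snd_le[of "snd (s z)" "fst (s z)" for z]
      by (auto intro!: bounded_fields_bound[OF s])
  qed
  have sub: "N (s + r) \<le> N s + N r" if s: "s \<in> ?S" and r: "r \<in> ?S" for s r
  proof -
    have "(LINT t|half_line. slice_norm (\<lambda>z. fst ((s + r) z)) t) \<le>
        (LINT t|half_line. slice_norm (\<lambda>z. fst (s z)) t + slice_norm (\<lambda>z. fst (r z)) t)"
    proof (rule integral_mono_AE)
      show "integrable half_line (slice_norm (\<lambda>z. fst ((s + r) z)))"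
        using subspace_add[OF subspace_bounded_fields s r] by (intro slice_norm_integrable fst_B)
      show "integrable half_line (\<lambda>t. slice_norm (\<lambda>z. fst (s z)) t + slice_norm (\<lambda>z. fst (r z)) t)"
        using s r by (intro Bochner_Integration.integrable_add slice_norm_integrable fst_B)
      show "AE t in half_line. slice_norm (\<lambda>z. fst ((s + r) z)) t \<le>
          slice_norm (\<lambda>z. fst (s z)) t + slice_norm (\<lambda>z. fst (r z)) t"
        using slice_norm_add[OF fst_B[OF s] fst_B[OF r]]
        by (intro AE_I2) (auto simp: space_restrict_space plus_fun_def)
    qed
    also have "\<dots> = (LINT t|half_line. slice_norm (\<lambda>z. fst (s z)) t) + (LINT t|half_line. slice_norm (\<lambda>z. fst (r z)) t)"
      using s r by (intro Bochner_Integration.integral_add slice_norm_integrable fst_B)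
    finally have 1: "C1 * (LINT t|half_line. slice_norm (\<lambda>z. fst ((s + r) z)) t) \<le>
        C1 * (LINT t|half_line. slice_norm (\<lambda>z. fst (s z)) t) + C1 * (LINT t|half_line. slice_norm (\<lambda>z. fst (r z)) t)"
      using C1 by (metis distrib_left mult_left_mono)
    have "sqrt (LINT z|cyl. (norm (snd ((s + r) z)))\<^sup>2) \<le>
        sqrt (LINT z|cyl. (norm (snd (s z)))\<^sup>2) + sqrt (LINT z|cyl. (norm (snd (r z)))\<^sup>2)"
      using L2_triangle[OF bounded_fields_in_L2[OF snd_B[OF s]] bounded_fields_in_L2[OF snd_B[OF r]]] by simp
    then have 2: "C2 * sqrt (LINT z|cyl. (norm (snd ((s + r) z)))\<^sup>2) \<le>
        C2 * sqrt (LINT z|cyl. (norm (snd (s z)))\<^sup>2) + C2 * sqrt (LINT z|cyl. (norm (snd (r z)))\<^sup>2)"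
      using C2 by (metis distrib_left mult_left_mono)
    show ?thesis using 1 2 by (simp add: N_def)
  qed
  have hom: "N (c *\<^sub>R s) = c * N s" if "s \<in> ?S" "0 \<le> c" for c s
  proof -
    have "slice_norm (\<lambda>z. fst ((c *\<^sub>R s) z)) t = c * slice_norm (\<lambda>z. fst (s z)) t" for t
      using slice_norm_scaleR[of c "\<lambda>z. fst (s z)" t] that by (simp add: scaleR_fun_def)
    then show ?thesis
      using that by (simp add: N_def power_mult_distrib real_sqrt_mult algebra_simps)
  qed
  have domN: "l \<le> N s" if "(s, l) \<in> G" for s l
    using dom[OF that] by (simp add: N_def)
  obtain F where F: "\<And>s r. s \<in> ?S \<Longrightarrow> r \<in> ?S \<Longrightarrow> F (s + r) = F s + F r"
      "\<And>c s. s \<in> ?S \<Longrightarrow> F (c *\<^sub>R s) = c * F s"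
      "\<And>s. s \<in> ?S \<Longrightarrow> F s \<le> N s" and FG: "\<And>s l. (s, l) \<in> G \<Longrightarrow> F s = l"
  proof (rule hahn_banach_graph[of ?S G N])
    show "subspace ?S" by (rule subspace_bounded_fields)
    show "subspace G" by (rule G)
    show "fst ` G \<subseteq> ?S" by (rule GB)
  qed (use domN sub hom in auto)
  define w where "w z = exp (snd z)" for z :: "'x \<times> real"
  have [measurable]: "w \<in> borel_measurable cyl"
    unfolding w_def[abs_def] by measurable
  \<comment> \<open>In L2(\<nu>) the sublinear function \<open>N\<close> is at most C1 + C2 times
    the norm: its first term by \<open>slice_norm_integral_le\<close>, its second because exp t >=
    1.\<close>
  define \<nu> where "\<nu> = density cyl (\<lambda>z. ennreal (w z))"
  have int_\<nu>: "integrable \<nu> h \<longleftrightarrow> integrable cyl (\<lambda>z. w z *\<^sub>R h z)"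
    "integral\<^sup>L \<nu> h = (LINT z|cyl. w z *\<^sub>R h z)" if "h \<in> borel_measurable cyl" for h :: "'x \<times> real \<Rightarrow> real"
  proof -
    have w0: "AE z in cyl. 0 \<le> w z"
      by (simp add: w_def)
    show "integrable \<nu> h \<longleftrightarrow> integrable cyl (\<lambda>z. w z *\<^sub>R h z)"
      "integral\<^sup>L \<nu> h = (LINT z|cyl. w z *\<^sub>R h z)"
      unfolding \<nu>_def using that w0 by (intro integrable_density integral_density; simp)+
  qed
  have wB: "(\<lambda>z. w z *\<^sub>R s z) \<in> bounded_fields" if s: "s \<in> bounded_fields" for s :: "'x \<times> real \<Rightarrow> 'b::euclidean_space"
  proof -
    have [measurable]: "s \<in> borel_measurable cyl"
      by (rule bounded_fields_measurable[OF s])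
    obtain C T where C: "0 \<le> C"
      "\<And>x t. x \<in> space m \<Longrightarrow> 0 < t \<Longrightarrow> norm (s (x, t)) \<le> C" "\<And>x t. t > T \<Longrightarrow> s (x, t) = 0"
      using bounded_fields_bounds[OF s] by blast
    have "norm (w (x, t) *\<^sub>R s (x, t)) \<le> exp T * C" if "x \<in> space m" "0 < t" for x t
    proof (cases "t > T")
      case False
      then show ?thesis
        using C(2)[OF that] C(1) by (auto simp: w_def intro!: mult_mono)
    qed (use C in auto)
    then show ?thesis
      by (intro bounded_fieldsI[where C = "exp T * C" and T = T]) (use C in auto)
  qed
  have S\<nu>: "in_L2 \<nu> s" if s: "s \<in> ?S" for s
  proof -
    have [measurable]: "s \<in> borel_measurable cyl"
      by (rule bounded_fields_measurable[OF s])
    show ?thesis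
      unfolding in_L2_def
      using bounded_fields_integrable[OF wB[OF bounded_fields_norm_sq[OF s]]]
      by (auto simp: int_\<nu>) (simp add: \<nu>_def)
  qed
  have bound: "F s \<le> (C1 + C2) * sqrt (LINT z|\<nu>. (norm (s z))\<^sup>2)" if s: "s \<in> ?S" for s
  proof -
    have [measurable]: "s \<in> borel_measurable cyl"
      by (rule bounded_fields_measurable[OF s])
    have i: "integrable cyl (\<lambda>z. exp (snd z) * (norm (r z))\<^sup>2)" if "r \<in> bounded_fields" for r :: "'x \<times> real \<Rightarrow> 'b::euclidean_space"
      using bounded_fields_integrable[OF wB[OF bounded_fields_norm_sq[OF that]]] by (simp add: w_def)
    have n: "(norm (fst (s z)))\<^sup>2 \<le> (norm (s z))\<^sup>2" "(norm (snd (s z)))\<^sup>2 \<le> (norm (s z))\<^sup>2" for z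
      by (metis norm_fst_le norm_ge_zero power_mono prod.collapse)
        (metis norm_snd_le norm_ge_zero power_mono prod.collapse)
    have "(LINT t|half_line. slice_norm (\<lambda>z. fst (s z)) t) \<le> sqrt (LINT z|cyl. exp (snd z) * (norm (fst (s z)))\<^sup>2)"
      by (rule slice_norm_integral_le[OF fst_B[OF s]])
    also have "\<dots> \<le> sqrt (LINT z|cyl. exp (snd z) * (norm (s z))\<^sup>2)"
      using n by (intro real_sqrt_le_mono integral_mono i[OF fst_B[OF s]] i[OF s]) (auto intro: mult_left_mono)
    finally have 1: "(LINT t|half_line. slice_norm (\<lambda>z. fst (s z)) t) \<le> sqrt (LINT z|\<nu>. (norm (s z))\<^sup>2)"
      by (simp add: int_\<nu> w_def)
    have "(LINT z|cyl. (norm (snd (s z)))\<^sup>2) \<le> (LINT z|cyl. exp (snd z) * (norm (s z))\<^sup>2)"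
    proof (rule integral_mono_AE)
      show "integrable cyl (\<lambda>z. (norm (snd (s z)))\<^sup>2)"
        by (rule bounded_fields_integrable[OF bounded_fields_norm_sq[OF snd_B[OF s]]])
      have "(norm (snd (s z)))\<^sup>2 \<le> exp (snd z) * (norm (s z))\<^sup>2" if "z \<in> space cyl" for z
      proof -
        have "1 * (norm (snd (s z)))\<^sup>2 \<le> exp (snd z) * (norm (s z))\<^sup>2"
          using that n[of z] by (intro mult_mono) (auto simp: space_cyl)
        then show ?thesis by simp
      qed
      then show "AE z in cyl. (norm (snd (s z)))\<^sup>2 \<le> exp (snd z) * (norm (s z))\<^sup>2"
        by (rule AE_I2)
    qed (rule i[OF s])
    then have 2: "sqrt (LINT z|cyl. (norm (snd (s z)))\<^sup>2) \<le> sqrt (LINT z|\<nu>. (norm (s z))\<^sup>2)"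
      by (simp add: int_\<nu> w_def)
    have "F s \<le> N s" by (rule F(3)[OF s])
    also have "\<dots> \<le> (C1 + C2) * sqrt (LINT z|\<nu>. (norm (s z))\<^sup>2)"
      unfolding N_def distrib_right using 1 2 C1 C2 by (intro add_mono mult_left_mono)
    finally show ?thesis .
  qed
  obtain U where U: "in_L2 \<nu> U" and UF: "\<And>s. s \<in> ?S \<Longrightarrow> (LINT z|\<nu>. U z \<bullet> s z) = F s"
    using L2_riesz[OF subspace_bounded_fields S\<nu> F(1,2) bound] by blast
  have [measurable]: "U \<in> borel_measurable cyl"
    using U by (simp add: in_L2_def \<nu>_def)
  \<comment> \<open>The density is moved from the measure to the representative. The price is that
    square integrability is asserted only up to a time T, with a factor exp T.\<close>
  define V where "V z = w z *\<^sub>R U z" for z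
  have Vm [measurable]: "V \<in> borel_measurable cyl"
    unfolding V_def[abs_def] by measurable
  have VF: "(LINT z|cyl. V z \<bullet> s z) = F s" if "s \<in> ?S" for s
  proof -
    have [measurable]: "s \<in> borel_measurable cyl"
      by (rule bounded_fields_measurable[OF that])
    show ?thesis
      using UF[OF that] by (simp add: int_\<nu> V_def)
  qed
  show ?thesis
  proof (rule that[OF Vm])
    show "in_L2 cyl (\<lambda>z. of_bool (snd z \<le> T) *\<^sub>R V z)" for T
    proof -
      have i: "integrable cyl (\<lambda>z. exp T * (w z *\<^sub>R (norm (U z))\<^sup>2))"
        using U by (intro integrable_mult_right) (auto simp: in_L2_def int_\<nu>)
      have m: "(\<lambda>z. of_bool (snd z \<le> T) *\<^sub>R V z) \<in> borel_measurable cyl"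
      proof -
        have "(\<lambda>z. if snd z \<le> T then V z else 0) \<in> borel_measurable cyl" by measurable
        then show ?thesis by (rule back_subst[where P = "\<lambda>f. f \<in> _"]) auto
      qed
      show ?thesis
        unfolding in_L2_def
      proof (intro conjI m Bochner_Integration.integrable_bound[OF i] AE_I2)
        fix z assume "z \<in> space cyl"
        show "norm ((norm (of_bool (snd z \<le> T) *\<^sub>R V z))\<^sup>2) \<le> norm (exp T * (w z *\<^sub>R (norm (U z))\<^sup>2))"
        proof (cases "snd z \<le> T")
          case True
          have "w z * (w z * (norm (U z))\<^sup>2) \<le> exp T * (w z * (norm (U z))\<^sup>2)"
            using True by (intro mult_right_mono) (auto simp: w_def)
          then show ?thesis
            using True by (simp add: V_def power_mult_distrib power2_eq_square w_def abs_mult mult.assoc mult.left_commute)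
        qed simp
      qed (use m in measurable)
    qed
    show "AE t in half_line. in_L2 m (\<lambda>x. fst (V (x, t))) \<and> (LINT x|m. (fst (V (x, t)))\<^sup>2) \<le> C1\<^sup>2"
    proof (rule dual_slice_bound)
      fix s :: "'x \<times> real \<Rightarrow> real" assume s: "s \<in> bounded_fields"
      have [measurable]: "s \<in> borel_measurable cyl"
        by (rule bounded_fields_measurable[OF s])
      \<comment> \<open>On fields without second component \<open>N\<close> reduces to its first
        term, so the domination of \<open>F\<close> becomes a bound with \<open>C1\<close>
        alone.\<close>
      have sS: "(\<lambda>z. (s z, 0 :: 'g)) \<in> ?S"
      proof -
        obtain C T where "0 \<le> C" "\<And>x t. x \<in> space m \<Longrightarrow> 0 < t \<Longrightarrow> norm (s (x, t)) \<le> C" "\<And>x t. t > T \<Longrightarrow> s (x, t) = 0"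
          using bounded_fields_bounds[OF s] by blast
        then show ?thesis
          by (intro bounded_fieldsI[where C = C and T = T]) (auto simp: norm_Pair zero_prod_def)
      qed
      have "(LINT z|cyl. fst (V z) * s z) = (LINT z|cyl. V z \<bullet> (s z, 0 :: 'g))"
        by (simp add: inner_prod_def)
      also have "\<dots> \<le> N (\<lambda>z. (s z, 0))"
        using VF[OF sS] F(3)[OF sS] by simp
      finally show "(LINT z|cyl. fst (V z) * s z) \<le> C1 * (LINT t|half_line. slice_norm s t)"
        by (simp add: N_def)
    qed (use C1 borel_measurable_fst_snd(1)[OF Vm] in auto)
    show "(LINT z|cyl. V z \<bullet> s z) = l" if "(s, l) \<in> G" for s l
      using VF[of s] FG[OF that] GB that by force
  qed
qed

end


section \<open>The energy estimate\<close>

text \<open>The outcome must be linear in A and in the root of B: A will be an L1(L2) norm, B a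
  multiple of a squared L2 norm, and the functional has to be dominated by a norm.\<close>

lemma quadratic_inequality_bound:
  fixes M A B :: real
  assumes "M\<^sup>2 / 2 \<le> M * A + B" "0 \<le> A" "0 \<le> B"
  shows "M \<le> 2 * A + sqrt (2 * B)"
proof (rule ccontr)
  assume "\<not> ?thesis"
  then have less: "2 * A + sqrt (2 * B) < M" by simp
  then have M: "0 < M" and le: "sqrt (2 * B) \<le> M"
    using assms(2,3) by (auto intro: le_less_trans[OF _ less])
  have "2 * B = sqrt (2 * B) * sqrt (2 * B)"
    using assms(3) by simp
  also have "\<dots> \<le> M * sqrt (2 * B)"
    using le assms(3) by (intro mult_right_mono) auto
  finally have "M\<^sup>2 \<le> M * (2 * A + sqrt (2 * B))"
    using assms(1) by (simp add: algebra_simps)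
  also have "\<dots> < M * M"
    using M less by (intro mult_strict_left_mono)
  finally show False by (simp add: power2_eq_square)
qed

lemma young_inner:
  fixes q g :: "'b::real_inner"
  assumes "0 < b"
  shows "q \<bullet> g \<le> b * (norm g)\<^sup>2 + (norm q)\<^sup>2 / (4 * b)"
proof -
  have "0 \<le> (norm (q - (2 * b) *\<^sub>R g))\<^sup>2 / (4 * b)"
    using assms by simp
  also have "(norm (q - (2 * b) *\<^sub>R g))\<^sup>2 = (norm q)\<^sup>2 - 4 * b * (q \<bullet> g) + 4 * b\<^sup>2 * (norm g)\<^sup>2"
    by (simp only: power2_norm_eq_inner)
      (simp add: inner_diff_left inner_diff_right inner_commute power2_eq_square algebra_simps)
  finally show ?thesis
    using assms by (simp add: field_simps power2_eq_square)
qed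

lemma half_line_integral_derivative:
  fixes q q' :: "real \<Rightarrow> real"
  assumes d: "\<And>t. (q has_real_derivative q' t) (at t)" and q': "continuous_on UNIV q'"
    and z: "\<And>t. t > T \<Longrightarrow> q t = 0" and s: "0 \<le> s"
  shows "(LINT t|half_line. of_bool (s < t) * q' t) = - q s"
proof -
  \<comment> \<open>Beyond T, hence q R = 0; the 1 is added because q is known to vanish only
    strictly after T.\<close>
  define R where "R = max (T + 1) s"
  have q'z: "q' t = 0" if "t > T" for t
  proof -
    have "((\<lambda>_. 0) has_real_derivative q' t) (at t)"
      by (rule has_field_derivative_transform_within_open[OF d, of "{T<..}"]) (use that z in auto)
    then show ?thesis
      using DERIV_unique DERIV_const by blast
  qed
  have "(LINT t|half_line. of_bool (s < t) * q' t) = (LINT t|lborel. indicator {0<..} t *\<^sub>R (of_bool (s < t) * q' t))"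
    by (rule integral_restrict_space) simp
  also have "\<dots> = (LINT t|lborel. indicator {s..R} t *\<^sub>R q' t)"
  proof (rule integral_cong_AE)
    have [measurable]: "q' \<in> borel_measurable borel"
      using q' by (simp add: borel_measurable_continuous_onI)
    have "(\<lambda>t. if 0 < t \<and> s < t then q' t else 0) \<in> borel_measurable lborel"
      by measurable
    then show "(\<lambda>t. indicator {0<..} t *\<^sub>R (of_bool (s < t) * q' t)) \<in> borel_measurable lborel"
      by (rule back_subst[where P = "\<lambda>f. f \<in> _"]) (auto simp: indicator_def)
    show "(\<lambda>t. indicator {s..R} t *\<^sub>R q' t) \<in> borel_measurable lborel"
      by measurable
    have "AE t in lborel. t \<noteq> s" by (rule AE_lborel_singleton)
    then show "AE t in lborel. indicator {0<..} t *\<^sub>R (of_bool (s < t) * q' t) = indicator {s..R} t *\<^sub>R q' t"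
    proof eventually_elim
      case (elim t)
      then show ?case
        using s q'z[of t] by (cases "T < t") (auto simp: indicator_def R_def)
    qed
  qed
  also have "\<dots> = q R - q s"
  proof (rule integral_FTC_Icc)
    show "s \<le> R" by (simp add: R_def)
    show "(q has_vector_derivative q' t) (at t within {s..R})" for t
      unfolding has_real_derivative_iff_has_vector_derivative[symmetric]
      by (rule DERIV_subset[OF d]) simp
    show "continuous_on {s..R} q'"
      using q' by (rule continuous_on_subset) simp
  qed
  also have "q R = 0"
    using z[of R] by (auto simp: R_def)
  finally show ?thesis by simp
qed

context time_cylinder
begin

lemma bounded_fields_mult:
  fixes s r :: "'x \<times> real \<Rightarrow> 'b::euclidean_space"
  assumes "s \<in> bounded_fields" "r \<in> bounded_fields"
  shows "(\<lambda>z. s z \<bullet> r z) \<in> bounded_fields"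
proof -
  note [measurable] = assms[THEN bounded_fields_measurable]
  obtain C T where C: "0 \<le> C" "\<And>x t. x \<in> space m \<Longrightarrow> 0 < t \<Longrightarrow> norm (s (x, t)) \<le> C" "\<And>x t. t > T \<Longrightarrow> s (x, t) = 0"
    using bounded_fields_bounds[OF assms(1)] by blast
  obtain D R where D: "0 \<le> D" "\<And>x t. x \<in> space m \<Longrightarrow> 0 < t \<Longrightarrow> norm (r (x, t)) \<le> D" "\<And>x t. t > R \<Longrightarrow> r (x, t) = 0"
    using bounded_fields_bounds[OF assms(2)] by blast
  have "\<bar>s (x, t) \<bullet> r (x, t)\<bar> \<le> C * D" if "x \<in> space m" "0 < t" for x t
    using Cauchy_Schwarz_ineq2[of "s (x, t)" "r (x, t)"] mult_mono[OF C(2) D(2)[of x t] C(1)] that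
    by fastforce
  then show ?thesis
    by (intro bounded_fieldsI[where C = "C * D" and T = T]) (use C in auto)
qed

text \<open>Since \<phi> vanishes for late times, integrating d/dt (\<phi>^2 / 2) over (s,
  \<infinity>) controls it at each s. The terms z1 and z2 hidden in the data \<zeta> and q drop out
  by \<open>orth\<close>. One factor of \<zeta> \<phi> is estimated by the supremum M of the norms
  of \<phi>, finite beforehand because \<phi> is bounded, and the resulting quadratic inequality is
  solved for M. The constants do not depend on when \<phi> vanishes.\<close>

lemma energy_estimate:
  fixes \<phi> \<kappa> z1 \<zeta> :: "'x \<times> real \<Rightarrow> real" and g z2 q :: "'x \<times> real \<Rightarrow> 'g::euclidean_space"
    and b :: "'g \<Rightarrow> 'g"
  assumes deriv: "\<And>x t. x \<in> space m \<Longrightarrow> ((\<lambda>t. \<phi> (x, t)) has_real_derivative \<kappa> (x, t)) (at t)"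
    and cont: "\<And>x. x \<in> space m \<Longrightarrow> continuous_on UNIV (\<lambda>t. \<kappa> (x, t))"
    and fields: "\<phi> \<in> bounded_fields" "\<kappa> \<in> bounded_fields" "z1 \<in> bounded_fields"
      "g \<in> bounded_fields" "z2 \<in> bounded_fields" "q \<in> bounded_fields"
    and \<phi>0: "(\<lambda>x. \<phi> (x, 0)) \<in> borel_measurable m" "\<And>x. x \<in> space m \<Longrightarrow> \<bar>\<phi> (x, 0)\<bar> \<le> K"
    and \<zeta>: "\<And>z. \<zeta> z = - \<kappa> z + z1 z" and q: "\<And>z. q z = b (g z) + z2 z"
    and orth: "\<And>t. 0 < t \<Longrightarrow> (LINT x|m. z1 (x, t) * \<phi> (x, t) + z2 (x, t) \<bullet> g (x, t)) = 0"
    and b0: "0 < b0" and coercive: "\<And>v. b0 * (norm v)\<^sup>2 \<le> b v \<bullet> v"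
    and u0: "in_L2 m u0"
  shows "(LINT x|m. u0 x * \<phi> (x, 0)) \<le>
    2 * sqrt (LINT x|m. (u0 x)\<^sup>2) * (LINT t|half_line. slice_norm \<zeta> t) +
    sqrt (LINT x|m. (u0 x)\<^sup>2) * sqrt (1 / (2 * b0)) * sqrt (LINT z|cyl. (norm (q z))\<^sup>2)"
proof -
  have zf: "\<zeta> \<in> bounded_fields"
  proof -
    have "(-1) *\<^sub>R \<kappa> + z1 \<in> bounded_fields"
      by (intro subspace_add[OF subspace_bounded_fields] subspace_scale[OF subspace_bounded_fields] fields)
    then show ?thesis
      by (rule back_subst[where P = "\<lambda>f. f \<in> _"]) (auto simp: \<zeta>)
  qed
  note [measurable] = measurable_half_line_id
  define N where "N t = slice_norm \<phi> t" for t
  obtain C T where C: "0 \<le> C" "\<And>x t. x \<in> space m \<Longrightarrow> 0 < t \<Longrightarrow> norm (\<phi> (x, t)) \<le> C" 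
    "\<And>x t. t > T \<Longrightarrow> \<phi> (x, t) = 0"
    using bounded_fields_bounds[OF fields(1)] by blast
  \<comment> \<open>The bound for fields concerns positive times only, so the slice at time 0 brings
    its own bound K.\<close>
  define K' where "K' = max C K"
  have K': "\<bar>\<phi> (x, t)\<bar> \<le> K'" if "x \<in> space m" "0 \<le> t" for x t
    using C(2)[OF that(1), of t] \<phi>0(2)[OF that(1)] that(2) by (cases "t = 0") (auto simp: K'_def)
  have slice_L2: "in_L2 m (\<lambda>x. \<phi> (x, t))" if "0 \<le> t" for t
    by (rule in_L2_bounded[where C = K'])
      (use that K' \<phi>0(1) bounded_fields_slice[OF fields(1), of t] in \<open>auto simp: finite_measure_axioms in_L2_def le_less\<close>)
  have N_nn: "0 \<le> N t" for t
    by (simp add: N_def slice_norm_nonneg)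
  have N_bd: "N t \<le> sqrt (LINT x|m. K'\<^sup>2)" if "0 \<le> t" for t
    unfolding N_def slice_norm_def
  proof (intro real_sqrt_le_mono integral_mono)
    show "integrable m (\<lambda>x. (norm (\<phi> (x, t)))\<^sup>2)"
      using slice_L2[OF that] by (simp add: in_L2_def)
    show "(norm (\<phi> (x, t)))\<^sup>2 \<le> K'\<^sup>2" if "x \<in> space m" for x
      using K'[OF that \<open>0 \<le> t\<close>] by (intro power_mono) auto
  qed simp
  define M where "M = Sup (N ` {0..})"
  have bdd: "bdd_above (N ` {0..})"
    using N_bd by (intro bdd_aboveI2[where M = "sqrt (LINT x|m. K'\<^sup>2)"]) auto
  have N_M: "N t \<le> M" if "0 \<le> t" for t
    unfolding M_def using that by (intro cSup_upper[OF _ bdd]) auto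
  have M_nn: "0 \<le> M"
    using N_nn[of 0] N_M[of 0] by simp
  define A where "A = (LINT t|half_line. slice_norm \<zeta> t)"
  define B where "B = (LINT z|cyl. (norm (q z))\<^sup>2) / (4 * b0)"
  have A_nn: "0 \<le> A"
    by (simp add: A_def slice_norm_nonneg)
  have B_nn: "0 \<le> B"
    using b0 by (simp add: B_def)
  have slice_ineq: "(LINT x|m. - (\<kappa> (x, t) * \<phi> (x, t))) \<le>
      M * slice_norm \<zeta> t + (LINT x|m. (norm (q (x, t)))\<^sup>2) / (4 * b0)" if t: "0 < t" for t
  proof -
    note sl = fields[THEN bounded_fields_slice, OF t] bounded_fields_slice[OF zf t]
    have i1: "integrable m (\<lambda>x. z1 (x, t) * \<phi> (x, t))" "integrable m (\<lambda>x. \<kappa> (x, t) * \<phi> (x, t))"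
      "integrable m (\<lambda>x. \<zeta> (x, t) * \<phi> (x, t))" "integrable m (\<lambda>x. z2 (x, t) \<bullet> g (x, t))"
      "integrable m (\<lambda>x. (norm (g (x, t)))\<^sup>2)" "integrable m (\<lambda>x. (norm (q (x, t)))\<^sup>2)"
      using in_L2_inner_integrable[OF sl(3) sl(1)] in_L2_inner_integrable[OF sl(2) sl(1)]
        in_L2_inner_integrable[OF sl(7) sl(1)] in_L2_inner_integrable[OF sl(5) sl(4)] sl(4,6)
      by (simp_all add: in_L2_def)
    \<comment> \<open>Adding the vanishing pairing turns -\<kappa> into \<zeta> and z2 into q - b g;
      coercivity then absorbs q . g at the price of |q|^2 / (4 b0).\<close>
    have "(LINT x|m. - (\<kappa> (x, t) * \<phi> (x, t))) =
        (LINT x|m. - (\<kappa> (x, t) * \<phi> (x, t)) + (z1 (x, t) * \<phi> (x, t) + z2 (x, t) \<bullet> g (x, t)))"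
      using orth[OF t] i1 by simp
    also have "\<dots> \<le> (LINT x|m. \<zeta> (x, t) * \<phi> (x, t) + (norm (q (x, t)))\<^sup>2 / (4 * b0))"
    proof (rule integral_mono)
      fix x
      have "z2 (x, t) \<bullet> g (x, t) = q (x, t) \<bullet> g (x, t) - b (g (x, t)) \<bullet> g (x, t)"
        by (simp add: q inner_add_left)
      also have "\<dots> \<le> (norm (q (x, t)))\<^sup>2 / (4 * b0)"
        using young_inner[OF b0, of "q (x, t)" "g (x, t)"] coercive[of "g (x, t)"] by linarith
      finally show "- (\<kappa> (x, t) * \<phi> (x, t)) + (z1 (x, t) * \<phi> (x, t) + z2 (x, t) \<bullet> g (x, t)) \<le>
          \<zeta> (x, t) * \<phi> (x, t) + (norm (q (x, t)))\<^sup>2 / (4 * b0)"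
        by (simp add: \<zeta> algebra_simps)
    qed (use i1 in auto)
    also have "\<dots> = (LINT x|m. \<zeta> (x, t) \<bullet> \<phi> (x, t)) + (LINT x|m. (norm (q (x, t)))\<^sup>2) / (4 * b0)"
      using i1 by simp
    also have "(LINT x|m. \<zeta> (x, t) \<bullet> \<phi> (x, t)) \<le> slice_norm \<zeta> t * N t"
      using L2_Cauchy_Schwarz[OF sl(7) sl(1)] by (simp add: slice_norm_def N_def)
    also have "slice_norm \<zeta> t * N t \<le> M * slice_norm \<zeta> t"
      using N_M[of t] t slice_norm_nonneg[of \<zeta> t] by (subst mult.commute) (intro mult_right_mono, auto)
    finally show ?thesis by simp
  qed
  have q2: "integrable cyl (\<lambda>z. (norm (q z))\<^sup>2)"
    by (rule bounded_fields_integrable[OF bounded_fields_norm_sq[OF fields(6)]])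
  have main: "(N s)\<^sup>2 / 2 \<le> M * A + B" if s: "0 \<le> s" for s
  proof -
    \<comment> \<open>Cutting at \<open>s\<close> gives the estimate at every time s >= 0, as needed
      for the supremum M, and not only at the initial time.\<close>
    define h where "h z = of_bool (s < snd z) * (\<kappa> z * \<phi> z)" for z
    have hB: "h \<in> bounded_fields"
    proof -
      have "(\<lambda>z. of_bool (s < snd z) *\<^sub>R (\<kappa> z \<bullet> \<phi> z)) \<in> bounded_fields"
        by (rule bounded_fields_indicator[OF bounded_fields_mult[OF fields(2,1)]]) measurable
      then show ?thesis by (simp add: h_def[abs_def])
    qed
    have hi: "integrable cyl h"
      by (rule bounded_fields_integrable[OF hB])
    have "(N s)\<^sup>2 / 2 = (LINT x|m. (\<phi> (x, s))\<^sup>2 / 2)"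
      by (simp add: N_def slice_norm_sq)
    also have "\<dots> = (LINT x|m. - (LINT t|half_line. h (x, t)))"
    proof (rule Bochner_Integration.integral_cong[OF refl])
      fix x assume x: "x \<in> space m"
      show "(\<phi> (x, s))\<^sup>2 / 2 = - (LINT t|half_line. h (x, t))"
      proof -
        have "((\<lambda>t. (\<phi> (x, t))\<^sup>2 / 2) has_real_derivative \<kappa> (x, t) * \<phi> (x, t)) (at t)" for t
          using DERIV_cdivide[OF DERIV_power[OF deriv[OF x, of t], of 2], of 2] by (simp add: mult.commute)
        moreover have "continuous_on UNIV (\<lambda>t. \<kappa> (x, t) * \<phi> (x, t))"
          using deriv[OF x] by (intro continuous_intros cont[OF x]) (meson DERIV_continuous_on has_field_derivative_at_within)
        ultimately show ?thesis
          using half_line_integral_derivative[of "\<lambda>t. (\<phi> (x, t))\<^sup>2 / 2" _ T s] C(3) s by (simp add: h_def)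
      qed
    qed
    also have "\<dots> = - (LINT z|cyl. h z)"
      using integral_fst[of "\<lambda>x t. h (x, t)"] hi by simp
    also have "\<dots> = (LINT t|half_line. - (LINT x|m. h (x, t)))"
      using Fubini_slices(1)[OF hi] by simp
    also have "\<dots> \<le> (LINT t|half_line. M * slice_norm \<zeta> t + (LINT x|m. (norm (q (x, t)))\<^sup>2) / (4 * b0))"
    proof (rule integral_mono)
      show "integrable half_line (\<lambda>t. - (LINT x|m. h (x, t)))"
        using Fubini_slices(3)[OF hi] by simp
      show "integrable half_line (\<lambda>t. M * slice_norm \<zeta> t + (LINT x|m. (norm (q (x, t)))\<^sup>2) / (4 * b0))"
        using Fubini_slices(3)[OF q2] slice_norm_integrable[OF zf] by simp
      fix t assume "t \<in> space half_line"
      then have t: "0 < t" by (simp add: space_restrict_space)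
      show "- (LINT x|m. h (x, t)) \<le> M * slice_norm \<zeta> t + (LINT x|m. (norm (q (x, t)))\<^sup>2) / (4 * b0)"
      proof (cases "s < t")
        case True
        then show ?thesis using slice_ineq[OF t] by (simp add: h_def)
      next
        case False
        then show ?thesis using M_nn b0 slice_norm_nonneg[of \<zeta> t] by (simp add: h_def)
      qed
    qed
    also have "\<dots> = M * A + B"
      using Fubini_slices(3)[OF q2] Fubini_slices(1)[OF q2] slice_norm_integrable[OF zf]
      by (simp add: A_def B_def)
    finally show ?thesis .
  qed
  have "M \<le> sqrt (2 * (M * A + B))"
    unfolding M_def
  proof (rule cSup_least)
    fix y assume "y \<in> N ` {0..}"
    then obtain s where s: "0 \<le> s" "y = N s" by auto
    have "sqrt ((N s)\<^sup>2) \<le> sqrt (2 * (M * A + B))"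
      using main[OF s(1)] by (intro real_sqrt_le_mono) simp
    then show "y \<le> sqrt (2 * (Sup (N ` {0..}) * A + B))"
      using N_nn s by (simp add: M_def)
  qed auto
  then have "M\<^sup>2 \<le> 2 * (M * A + B)"
    using M_nn A_nn B_nn by (metis real_le_rsqrt real_sqrt_ge_0_iff real_sqrt_le_iff real_sqrt_pow2_iff power_mono order_trans)
  then have "M \<le> 2 * A + sqrt (2 * B)"
    using A_nn B_nn by (intro quadratic_inequality_bound) auto
  \<comment> \<open>\<open>B\<close> carries the factor 1 / (4 b0) from Young's inequality, whence
    sqrt (1 / (2 b0)).\<close>
  also have "2 * B = 1 / (2 * b0) * (LINT z|cyl. (norm (q z))\<^sup>2)"
    by (simp add: B_def)
  finally have M: "M \<le> 2 * A + sqrt (1 / (2 * b0)) * sqrt (LINT z|cyl. (norm (q z))\<^sup>2)"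
    by (simp only: real_sqrt_mult)
  have "(LINT x|m. u0 x * \<phi> (x, 0)) \<le> sqrt (LINT x|m. (u0 x)\<^sup>2) * N 0"
    using L2_Cauchy_Schwarz[OF u0 slice_L2[of 0]] by (simp add: N_def slice_norm_def)
  also have "\<dots> \<le> sqrt (LINT x|m. (u0 x)\<^sup>2) * (2 * A + sqrt (1 / (2 * b0)) * sqrt (LINT z|cyl. (norm (q z))\<^sup>2))"
    using N_M[of 0] M by (intro mult_left_mono) auto
  finally show ?thesis
    by (simp add: A_def algebra_simps)
qed

end


section \<open>Integration by parts\<close>

text \<open>Difference quotients integrate to zero by translation
  invariance. This tolerates a merely Lipschitz weight.\<close>

lemma integral_directional_derivative_zero:
  fixes F F' :: "'a::euclidean_space \<Rightarrow> real"
  assumes [measurable]: "F \<in> borel_measurable borel" "F' \<in> borel_measurable borel"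
    and bound: "\<And>s. \<bar>F s\<bar> \<le> K" and supp: "\<And>s. norm s > R \<Longrightarrow> F s = 0"
    and lip: "\<And>s e. 0 < e \<Longrightarrow> e \<le> 1 \<Longrightarrow> \<bar>F (s + e *\<^sub>R r) - F s\<bar> \<le> C * e"
    and deriv: "AE s in lborel. ((\<lambda>e. F (s + e *\<^sub>R r)) has_real_derivative F' s) (at 0)"
  shows "(LINT s|lborel. F' s) = 0"
proof -
  define e where "e n = 1 / real (Suc n)" for n
  have e: "0 < e n" "e n \<le> 1" for n by (auto simp: e_def)
  have F_int: "integrable lborel F"
    by (rule integrableI_bounded_set[where A = "cball 0 R" and B = K])
      (use bound supp emeasure_bounded_finite[OF bounded_cball] in auto)
  define Q where "Q n s = (F (s + e n *\<^sub>R r) - F s) / e n" for n s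
  have shift: "has_bochner_integral lborel (\<lambda>s. F (s + c)) (LINT s|lborel. F s)" for c
  proof -
    have "integrable (distr lborel borel ((+) c)) F"
      unfolding lborel_distr_plus by (rule F_int)
    then have "integrable lborel (\<lambda>s. F (c + s))"
      by (subst (asm) integrable_distr_eq) auto
    moreover have "(LINT s|lborel. F (c + s)) = (LINT s|distr lborel borel ((+) c). F s)"
      by (subst integral_distr) auto
    ultimately have "has_bochner_integral lborel (\<lambda>s. F (c + s)) (LINT s|lborel. F s)"
      by (simp add: has_bochner_integral_iff lborel_distr_plus)
    then show ?thesis by (simp add: add.commute)
  qed
  have Q0: "(LINT s|lborel. Q n s) = 0" for n
    using shift[of "e n *\<^sub>R r"] F_int by (simp add: Q_def has_bochner_integral_iff)
  \<comment> \<open>Since e n <= 1, the difference quotients vanish farther than norm r from the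
    ball of radius R; inside they are dominated by the Lipschitz constant.\<close>
  have "(\<lambda>n. LINT s|lborel. Q n s) \<longlonglongrightarrow> (LINT s|lborel. F' s)"
  proof (rule integral_dominated_convergence[where w = "\<lambda>s. C * indicator (cball 0 (R + norm r)) s"])
    show "integrable lborel (\<lambda>s. C * indicator (cball 0 (R + norm r)) s)"
      by (intro integrable_mult_right integrable_real_indicator)
        (use emeasure_bounded_finite[OF bounded_cball] in auto)
    show "AE s in lborel. (\<lambda>n. Q n s) \<longlonglongrightarrow> F' s"
      using deriv
    proof eventually_elim
      case (elim s)
      then have "((\<lambda>h. (F (s + h *\<^sub>R r) - F s) / h) \<longlongrightarrow> F' s) (at 0)"
        by (simp add: DERIV_def)
      moreover have "filterlim e (at 0) sequentially"
        unfolding filterlim_at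
        using LIMSEQ_inverse_real_of_nat e
        by (auto simp: e_def[abs_def] inverse_eq_divide intro!: always_eventually)
      ultimately show ?case
        unfolding Q_def by (rule filterlim_compose)
    qed
    show "AE s in lborel. norm (Q n s) \<le> C * indicator (cball 0 (R + norm r)) s" for n
    proof (rule AE_I2)
      fix s
      show "norm (Q n s) \<le> C * indicator (cball 0 (R + norm r)) s"
      proof (cases "norm s \<le> R + norm r")
        case True
        then show ?thesis
          using lip[OF e, of s n] e[of n] by (simp add: Q_def field_simps)
      next
        case False
        have "norm (e n *\<^sub>R r) \<le> norm r"
          using e[of n] by (simp add: mult_left_le_one_le)
        then have "norm (s + e n *\<^sub>R r) > R"
          using False norm_triangle_ineq4[of "s + e n *\<^sub>R r" "e n *\<^sub>R r"] by simp
        moreover have "norm s > R"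
          using False norm_ge_zero[of r] by linarith
        ultimately show ?thesis
          using supp False by (simp add: Q_def)
      qed
    qed
  qed (auto simp: Q_def[abs_def])
  then have "(\<lambda>n::nat. 0) \<longlonglongrightarrow> (LINT s|lborel. F' s)"
    by (simp add: Q0)
  then show ?thesis
    using LIMSEQ_unique tendsto_const by blast
qed

text \<open>The preceding lemma is applied to \<open>W * G\<close>. The rough factor
  \<open>W\<close> will be the Gibbs weight, differentiable along \<open>r\<close> only almost
  everywhere. Its increment is multiplied by G s, so its Lipschitz bound matters only within R; the
  increment of \<open>G\<close> is multiplied by W at the shifted point, which may lie at distance R
  + 2 norm r.\<close>

lemma integral_weighted_directional_derivative_zero:
  fixes G G' W W' :: "'a::euclidean_space \<Rightarrow> real"
  assumes G: "\<And>s. ((\<lambda>e. G (s + e *\<^sub>R r)) has_real_derivative G' s) (at 0)"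
    and cont: "continuous_on UNIV G" "continuous_on UNIV G'" and supp: "\<And>s. norm s > R \<Longrightarrow> G s = 0"
    and W [measurable]: "W \<in> borel_measurable borel" "W' \<in> borel_measurable borel"
    and W_bd: "\<And>s. norm s \<le> R + 2 * norm r \<Longrightarrow> \<bar>W s\<bar> \<le> B"
    and W_lip: "\<And>s e. norm s \<le> R \<Longrightarrow> 0 < e \<Longrightarrow> e \<le> 1 \<Longrightarrow> \<bar>W (s + e *\<^sub>R r) - W s\<bar> \<le> L * e"
    and W_deriv: "AE s in lborel. ((\<lambda>e. W (s + e *\<^sub>R r)) has_real_derivative W' s) (at 0)"
  shows "(LINT s|lborel. W' s * G s + W s * G' s) = 0"
proof -
  have G'_supp: "G' s = 0" if "norm s > R" for s
  proof -
    have "open ((\<lambda>e. s + e *\<^sub>R r) -` (- cball 0 R))"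
      by (intro open_vimage continuous_intros) auto
    then have "((\<lambda>_. 0) has_real_derivative G' s) (at 0)"
      by (rule has_field_derivative_transform_within_open[OF G]) (use that supp in auto)
    then show ?thesis
      using DERIV_unique DERIV_const by blast
  qed
  obtain K where K: "\<And>s. \<bar>G s\<bar> \<le> K"
  proof -
    have "bounded (G ` cball 0 R)"
      by (intro compact_imp_bounded compact_continuous_image) (auto intro: continuous_on_subset cont)
    then obtain K where "\<forall>s\<in>cball 0 R. \<bar>G s\<bar> \<le> K"
      by (auto simp: bounded_iff)
    then have "\<bar>G s\<bar> \<le> max 0 K" for s
      using supp[of s] by (cases "norm s \<le> R") (auto simp: le_max_iff_disj)
    then show ?thesis by (rule that)
  qed
  obtain K' where K': "\<And>s. \<bar>G' s\<bar> \<le> K'"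
  proof -
    have "bounded (G' ` cball 0 R)"
      by (intro compact_imp_bounded compact_continuous_image) (auto intro: continuous_on_subset cont)
    then obtain K where "\<forall>s\<in>cball 0 R. \<bar>G' s\<bar> \<le> K"
      by (auto simp: bounded_iff)
    then have "\<bar>G' s\<bar> \<le> max 0 K" for s
      using G'_supp[of s] by (cases "norm s \<le> R") (auto simp: le_max_iff_disj)
    then show ?thesis by (rule that)
  qed
  have K0: "0 \<le> K" "0 \<le> K'"
    using K[of 0] K'[of 0] by auto
  have G_lip: "\<bar>G (s + e *\<^sub>R r) - G s\<bar> \<le> K' * e" if e0: "0 < e" for s e
  proof -
    have der: "((\<lambda>e. G (s + e *\<^sub>R r)) has_real_derivative G' (s + c *\<^sub>R r)) (at c)" for c
    proof -
      have "((\<lambda>e. G ((s + c *\<^sub>R r) + (e - c) *\<^sub>R r)) has_real_derivative G' (s + c *\<^sub>R r) * 1) (at c)"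
        by (rule DERIV_chain2[where f = "\<lambda>e. G ((s + c *\<^sub>R r) + e *\<^sub>R r)" and g = "\<lambda>e. e - c"])
          (auto intro!: derivative_eq_intros G)
      then show ?thesis by (simp add: algebra_simps)
    qed
    obtain c where "G (s + e *\<^sub>R r) - G (s + 0 *\<^sub>R r) = (e - 0) * G' (s + c *\<^sub>R r)"
      using MVT2[OF e0, of "\<lambda>e. G (s + e *\<^sub>R r)" "\<lambda>c. G' (s + c *\<^sub>R r)"] der by blast
    then show ?thesis
      using K'[of "s + c *\<^sub>R r"] e0 by (simp add: abs_mult mult.commute mult_left_mono)
  qed
  have [measurable]: "G \<in> borel_measurable borel" "G' \<in> borel_measurable borel"
    using cont by (simp_all add: borel_measurable_continuous_onI)
  show ?thesis
  proof (rule integral_directional_derivative_zero[where F = "\<lambda>s. W s * G s" and r = r and R = R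
        and K = "\<bar>B\<bar> * K" and C = "\<bar>B\<bar> * K' + \<bar>L\<bar> * K"])
    show "\<bar>W s * G s\<bar> \<le> \<bar>B\<bar> * K" for s
    proof (cases "norm s \<le> R")
      case True
      then have "\<bar>W s\<bar> \<le> \<bar>B\<bar>"
        using W_bd[of s] norm_ge_zero[of r] by linarith
      then show ?thesis
        using K[of s] by (auto simp: abs_mult intro!: mult_mono)
    qed (use supp K0 in auto)
    fix s e assume e: "0 < e" "e \<le> (1::real)"
    have er: "norm (e *\<^sub>R r) \<le> norm r"
      using e by (simp add: mult_left_le_one_le)
    have nse: "norm (s + e *\<^sub>R r) \<le> norm s + norm r"
      using er norm_triangle_ineq[of s "e *\<^sub>R r"] by linarith
    have eq: "W (s + e *\<^sub>R r) * G (s + e *\<^sub>R r) - W s * G s =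
        W (s + e *\<^sub>R r) * (G (s + e *\<^sub>R r) - G s) + (W (s + e *\<^sub>R r) - W s) * G s"
      by (simp add: algebra_simps)
    have 1: "\<bar>W (s + e *\<^sub>R r) * (G (s + e *\<^sub>R r) - G s)\<bar> \<le> \<bar>B\<bar> * K' * e"
    proof (cases "norm s \<le> R + norm r")
      case True
      then have "\<bar>W (s + e *\<^sub>R r)\<bar> \<le> \<bar>B\<bar>"
        using W_bd[of "s + e *\<^sub>R r"] nse by linarith
      then show ?thesis
        using G_lip[OF e(1), of s] unfolding abs_mult mult.assoc by (intro mult_mono) auto
    next
      case False
      have "norm (s + e *\<^sub>R r) > R"
        using False er norm_triangle_ineq4[of "s + e *\<^sub>R r" "e *\<^sub>R r"] by simp
      moreover have "norm s > R"
        using False norm_ge_zero[of r] by linarith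
      ultimately show ?thesis
        using supp e K0 by simp
    qed
    have 2: "\<bar>(W (s + e *\<^sub>R r) - W s) * G s\<bar> \<le> \<bar>L\<bar> * K * e"
    proof (cases "norm s \<le> R")
      case True
      have "L * e \<le> \<bar>L\<bar> * e" using e by (intro mult_right_mono) auto
      then have "\<bar>W (s + e *\<^sub>R r) - W s\<bar> \<le> \<bar>L\<bar> * e"
        using W_lip[OF True e] by linarith
      then have "\<bar>W (s + e *\<^sub>R r) - W s\<bar> * \<bar>G s\<bar> \<le> (\<bar>L\<bar> * e) * K"
        using K[of s] e by (intro mult_mono) auto
      then show ?thesis by (simp add: abs_mult mult.commute mult.left_commute)
    qed (use supp K0 e in auto)
    show "\<bar>W (s + e *\<^sub>R r) * G (s + e *\<^sub>R r) - W s * G s\<bar> \<le> (\<bar>B\<bar> * K' + \<bar>L\<bar> * K) * e"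
      unfolding eq distrib_right using 1 2 by linarith
  next
    show "AE s in lborel. ((\<lambda>e. W (s + e *\<^sub>R r) * G (s + e *\<^sub>R r)) has_real_derivative W' s * G s + W s * G' s) (at 0)"
      using W_deriv
    proof eventually_elim
      case (elim s)
      show ?case
        using DERIV_mult[OF elim G[of s]] by (simp add: mult.commute add.commute)
    qed
  qed (use supp in auto)
qed


section \<open>Functions of class C^1 and their directional derivatives\<close>

lemma continuous_bounded_on:
  fixes f :: "'a::euclidean_space \<Rightarrow> 'b::real_normed_vector"
  assumes "continuous_on UNIV f" "bounded S"
  shows "\<exists>C. \<forall>z\<in>S. norm (f z) \<le> C"
proof -
  have "compact (f ` closure S)"
    using assms by (intro compact_continuous_image) (auto intro: continuous_on_subset)
  then obtain C where "\<forall>y\<in>f ` closure S. norm y \<le> C"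
    using compact_imp_bounded bounded_iff by blast
  then have "\<forall>z\<in>S. norm (f z) \<le> C"
    using closure_subset[of S] by blast
  then show ?thesis by blast
qed

lemma Ck1_iff:
  "Ck 1 f \<longleftrightarrow> (\<forall>z. f differentiable (at z)) \<and> (\<forall>v. continuous_on UNIV (\<lambda>z. frechet_derivative f (at z) v))"
  by simp

lemma Ck1_has_derivative: "Ck 1 f \<Longrightarrow> (f has_derivative frechet_derivative f (at z)) (at z)"
  unfolding Ck1_iff using frechet_derivative_works by blast

lemma Ck1_continuous: "Ck 1 f \<Longrightarrow> continuous_on UNIV f"
  unfolding Ck1_iff
  by (intro differentiable_imp_continuous_on) (auto simp: differentiable_on_def intro: differentiable_at_withinI)

lemma Ck1_continuous_derivative: "Ck 1 f \<Longrightarrow> continuous_on UNIV (\<lambda>z. frechet_derivative f (at z) v)"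
  unfolding Ck1_iff by blast

lemma Ck1I:
  assumes "\<And>z. (f has_derivative f' z) (at z)" "\<And>v. continuous_on UNIV (\<lambda>z. f' z v)"
  shows "Ck 1 f"
proof -
  have "frechet_derivative f (at z) = f' z" for z
    by (rule frechet_derivative_at[OF assms(1), symmetric])
  moreover have "f differentiable (at z)" for z
    by (rule differentiableI[OF assms(1)])
  ultimately show ?thesis
    unfolding Ck1_iff by (simp add: assms(2))
qed

lemma has_derivative_directional:
  fixes f :: "'a::real_normed_vector \<Rightarrow> real"
  assumes "(f has_derivative f') (at z)"
  shows "((\<lambda>e. f (z + e *\<^sub>R v)) has_real_derivative f' v) (at 0)"
proof -
  have "((\<lambda>e. f (z + e *\<^sub>R v)) has_derivative (\<lambda>e. f' (e *\<^sub>R v))) (at 0)"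
    by (rule has_derivative_compose[where f = "\<lambda>e. z + e *\<^sub>R v" and g = f])
      (use assms in \<open>auto intro!: derivative_eq_intros\<close>)
  moreover have "f' (e *\<^sub>R v) = e * f' v" for e
    using has_derivative_bounded_linear[OF assms]
    by (simp add: bounded_linear_def linear_simps)
  ultimately show ?thesis
    by (simp add: has_field_derivative_def mult_commute_abs)
qed

section \<open>Tangential gradients\<close>

text \<open>The orthogonal projection onto \<open>mis_plane\<close>, written with the matrix of
  \<open>tgrad\<close> so that folding it in \<open>tgrad\<close> is immediate.\<close>

definition proj_plane :: "real^3 \<Rightarrow> real^3" where
  "proj_plane u = (mat 1 - (1/3) *\<^sub>R (\<chi> i j. 1)) *v u"

lemma proj_plane_component: "proj_plane u $ k = u $ k - (u $ 1 + u $ 2 + u $ 3) / 3"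
  by (simp add: proj_plane_def matrix_vector_mult_def mat_def sum_3 exhaust_3[of k] forall_3)
    (use exhaust_3[of k] in \<open>auto simp: field_simps\<close>)

lemma proj_plane_in_plane: "proj_plane u \<in> mis_plane"
  by (simp add: mis_plane_def proj_plane_component field_simps)

lemma proj_plane_inner: "proj_plane g \<bullet> u = g \<bullet> proj_plane u"
  by (simp add: inner_vec_def sum_3 proj_plane_component field_simps)

lemma continuous_proj_plane [continuous_intros]:
  "continuous_on S f \<Longrightarrow> continuous_on S (\<lambda>z. proj_plane (f z))"
  unfolding proj_plane_def by (rule bounded_linear.continuous_on[OF matrix_vector_mul_bounded_linear])

lemma grad_inner:
  assumes "(f has_derivative f') (at z)"
  shows "grad f z \<bullet> u = f' u"
proof -
  have lin: "linear f'"
    using has_derivative_bounded_linear[OF assms] bounded_linear.linear by blast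
  have "f' u = f' (\<Sum>k\<in>UNIV. u $ k *\<^sub>R axis k 1)"
    by (simp add: basis_expansion scalar_mult_eq_scaleR[symmetric])
  also have "\<dots> = (\<Sum>k\<in>UNIV. u $ k * f' (axis k 1))"
    using lin by (simp add: linear_sum linear_cmul)
  finally show ?thesis
    by (simp add: grad_def inner_vec_def frechet_derivative_at[OF assms, symmetric] mult.commute)
qed

lemma tgrad_inner:
  assumes "(f has_derivative f') (at z)"
  shows "tgrad f z \<bullet> u = f' (proj_plane u)"
  unfolding tgrad_def proj_plane_def[symmetric] proj_plane_inner by (rule grad_inner[OF assms])

type_synonym state = "(real^3) \<times> (real^2)"
type_synonym event = "(real^3) \<times> (real^2) \<times> real"

definition state_grad :: "(event \<Rightarrow> real) \<Rightarrow> event \<Rightarrow> state"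
  where "state_grad f z = (case z of (\<theta>, a, t) \<Rightarrow>
    (tgrad (\<lambda>\<theta>'. f (\<theta>', a, t)) \<theta>, grad (\<lambda>a'. f (\<theta>, a', t)) a))"

definition direction :: "state \<Rightarrow> event"
  where "direction i = (proj_plane (fst i), snd i, 0)"

lemma partial_derivatives:
  assumes "(f has_derivative f') (at (\<theta>, a, t))"
  shows "((\<lambda>\<theta>'. f (\<theta>', a, t)) has_derivative (\<lambda>h. f' (h, 0, 0))) (at \<theta>)"
    and "((\<lambda>a'. f (\<theta>, a', t)) has_derivative (\<lambda>h. f' (0, h, 0))) (at a)"
    and "((\<lambda>t'. f (\<theta>, a, t')) has_real_derivative f' (0, 0, 1)) (at t)"
proof -
  show "((\<lambda>\<theta>'. f (\<theta>', a, t)) has_derivative (\<lambda>h. f' (h, 0, 0))) (at \<theta>)"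
    by (rule has_derivative_compose[where f = "\<lambda>\<theta>'. (\<theta>', a, t)" and g = f])
      (use assms in \<open>auto intro!: derivative_eq_intros simp: zero_prod_def\<close>)
  show "((\<lambda>a'. f (\<theta>, a', t)) has_derivative (\<lambda>h. f' (0, h, 0))) (at a)"
    by (rule has_derivative_compose[where f = "\<lambda>a'. (\<theta>, a', t)" and g = f])
      (use assms in \<open>auto intro!: derivative_eq_intros simp: zero_prod_def\<close>)
  have "((\<lambda>e. f ((\<theta>, a, t) + e *\<^sub>R (0, 0, 1))) has_real_derivative f' (0, 0, 1)) (at 0)"
    by (rule has_derivative_directional[OF assms])
  then have "((\<lambda>t'. f (\<theta>, a, t + t')) has_real_derivative f' (0, 0, 1)) (at 0)"
    by simp
  then show "((\<lambda>t'. f (\<theta>, a, t')) has_real_derivative f' (0, 0, 1)) (at t)"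
    using DERIV_shift[of "\<lambda>t'. f (\<theta>, a, t')" "f' (0, 0, 1)" 0 t] by (simp add: add.commute)
qed

text \<open>The projection is self-adjoint, so it can be moved from the gradient to the direction.
  Components of the tangential gradient thus become derivatives along vectors that stay in the
  plane.\<close>

lemma state_grad_inner:
  assumes "(f has_derivative f') (at z)"
  shows "state_grad f z \<bullet> i = f' (direction i)"
proof -
  obtain \<theta> a t where z: "z = (\<theta>, a, t)" by (cases z)
  have lin: "linear f'"
    using has_derivative_bounded_linear[OF assms] bounded_linear.linear by blast
  have "f' (direction i) = f' ((proj_plane (fst i), 0, 0) + (0, snd i, 0))"
    by (simp add: direction_def)
  also have "\<dots> = f' (proj_plane (fst i), 0, 0) + f' (0, snd i, 0)"
    by (rule linear_add[OF lin])
  finally show ?thesis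
    using tgrad_inner[OF partial_derivatives(1), of f f' \<theta> a t "fst i"]
      grad_inner[OF partial_derivatives(2), of f f' \<theta> a t "snd i"] assms
    by (simp add: z state_grad_def inner_prod_def)
qed

lemma state_grad_continuous:
  assumes "Ck 1 f"
  shows "continuous_on UNIV (state_grad f)"
proof -
  have "continuous_on UNIV (\<lambda>z. \<Sum>i\<in>Basis. (state_grad f z \<bullet> i) *\<^sub>R i)"
    unfolding state_grad_inner[OF Ck1_has_derivative[OF assms]]
    by (intro continuous_intros Ck1_continuous_derivative assms)
  then show ?thesis by (simp add: euclidean_representation)
qed

section \<open>The state space\<close>

abbreviation angle_measure :: "(real^3) measure"
  where "angle_measure \<equiv> restrict_space plane_measure Omega"

abbreviation state_measure :: "(real^2) set \<Rightarrow> state measure"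
  where "state_measure D \<equiv> angle_measure \<Otimes>\<^sub>M restrict_space lborel D"

lemma linear_plane_param: "linear plane_param"
  by (rule linearI) (simp_all add: plane_param_def add_divide_distrib scaleR_add_left scaleR_add_right)

lemma continuous_plane_param: "continuous_on S plane_param"
  by (rule linear_continuous_on) (simp add: linear_plane_param linear_conv_bounded_linear[symmetric])

lemma measurable_plane_param [measurable]: "plane_param \<in> borel_measurable borel"
  by (rule borel_measurable_continuous_onI[OF continuous_plane_param])

lemma plane_param_in_plane [simp]: "plane_param s \<in> mis_plane"
  using range_plane_param by blast

lemma Omega_subset_plane: "Omega \<subseteq> mis_plane"
  by (auto simp: Omega_def)

lemma Omega_borel [measurable]: "Omega \<in> sets borel"
proof -
  have eq: "Omega = {\<theta>. \<theta> $ 1 + \<theta> $ 2 + \<theta> $ 3 = 0} \<inter> (\<Inter>k. {\<theta>. - (pi/4) < \<theta> $ k} \<inter> {\<theta>. \<theta> $ k < pi/4})"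
    by (auto simp: Omega_def mis_plane_def)
  have cl: "closed {\<theta>::real^3. \<theta> $ 1 + \<theta> $ 2 + \<theta> $ 3 = 0}"
    by (intro closed_Collect_eq continuous_intros)
  have op: "open (\<Inter>k. {\<theta>::real^3. - (pi/4) < \<theta> $ k} \<inter> {\<theta>. \<theta> $ k < pi/4})"
    by (intro open_INT ballI open_Int open_Collect_less continuous_intros finite)
  show ?thesis
    unfolding eq by (rule sets.Int[OF borel_closed[OF cl] borel_open[OF op]])
qed

lemma bounded_Omega: "bounded Omega"
proof -
  have "norm \<theta> \<le> (\<Sum>k\<in>(UNIV::3 set). pi/4)" if "\<theta> \<in> Omega" for \<theta>
  proof -
    have "norm \<theta> \<le> (\<Sum>k\<in>UNIV. \<bar>\<theta> $ k\<bar>)"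
      by (rule norm_le_l1_cart)
    also have "\<dots> \<le> (\<Sum>k\<in>(UNIV::3 set). pi/4)"
    proof (rule sum_mono)
      fix k
      have "- (pi/4) < \<theta> $ k \<and> \<theta> $ k < pi/4"
        using that by (simp add: Omega_def)
      then show "\<bar>\<theta> $ k\<bar> \<le> pi/4" by linarith
    qed
    finally show ?thesis .
  qed
  then show ?thesis unfolding bounded_iff by blast
qed

lemma finite_angle_measure: "finite_measure angle_measure"
proof (rule finite_measureI)
  have "bounded (plane_param -` Omega)"
    using bounded_Omega by (force simp: bounded_iff norm_plane_param)
  then have "emeasure lborel (plane_param -` Omega) < \<infinity>"
    by (rule emeasure_bounded_finite)
  then show "emeasure angle_measure (space angle_measure) \<noteq> \<infinity>"
    by (simp add: plane_measure_def emeasure_distr emeasure_restrict_space space_restrict_space)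
qed

lemma finite_domain_measure:
  fixes D :: "(real^2) set"
  assumes "open D" "bounded D"
  shows "finite_measure (restrict_space lborel D)"
proof (rule finite_measureI)
  show "emeasure (restrict_space lborel D) (space (restrict_space lborel D)) \<noteq> \<infinity>"
    using assms emeasure_bounded_finite[of D]
    by (simp add: emeasure_restrict_space space_restrict_space)
qed

lemma angle_measure_integral:
  fixes F :: "real^3 \<Rightarrow> real"
  assumes [measurable]: "F \<in> borel_measurable borel"
  shows "(LINT \<theta>|angle_measure. F \<theta>) = (LINT s|lborel. indicator Omega (plane_param s) * F (plane_param s))"
proof -
  have "(LINT \<theta>|angle_measure. F \<theta>) = (LINT \<theta>|plane_measure. indicator Omega \<theta> * F \<theta>)"
    by (subst integral_restrict_space) (auto simp: plane_measure_def)
  also have "\<dots> = (LINT s|lborel. indicator Omega (plane_param s) * F (plane_param s))"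
    unfolding plane_measure_def by (subst integral_distr) auto
  finally show ?thesis .
qed

lemma space_state_measure: "space (state_measure D) = Omega \<times> D"
proof -
  have "space angle_measure = Omega" "space (restrict_space lborel D) = D"
    by (simp_all add: space_restrict_space plane_measure_def)
  then show ?thesis by (simp only: space_pair_measure)
qed

lemma measurable_state_measure:
  assumes "F \<in> borel_measurable borel"
  shows "F \<in> borel_measurable (state_measure D)"
proof -
  have 1: "(\<lambda>\<theta>. \<theta>) \<in> borel_measurable angle_measure"
    by (rule measurable_restrict_space1) (simp add: plane_measure_def)
  have 2: "(\<lambda>a. a) \<in> borel_measurable (restrict_space lborel D)"
    by (rule measurable_restrict_space1) simp
  have "(\<lambda>z. (fst z, snd z)) \<in> state_measure D \<rightarrow>\<^sub>M borel \<Otimes>\<^sub>M borel"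
    by (rule measurable_Pair[OF measurable_compose[OF measurable_fst 1] measurable_compose[OF measurable_snd 2]])
  then have "(\<lambda>z. z) \<in> borel_measurable (state_measure D)"
    by (simp add: borel_prod)
  from measurable_compose[OF this assms] show ?thesis .
qed

text \<open>Vanishing is demanded only along one line. This suits test functions whose support is
  prescribed on the plane while their values off the plane are arbitrary.\<close>

lemma zero_derivative_off_support:
  fixes G :: "'a::real_normed_vector \<Rightarrow> real"
  assumes "((\<lambda>e. G (s + e *\<^sub>R v)) has_real_derivative G') (at 0)" "closed K" "s \<notin> K"
    and "\<And>e. s + e *\<^sub>R v \<notin> K \<Longrightarrow> G (s + e *\<^sub>R v) = 0"
  shows "G' = 0"
proof -
  have "open ((\<lambda>e. s + e *\<^sub>R v) -` (- K))"
    using assms(2) by (intro open_vimage continuous_intros) auto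
  then have "((\<lambda>_. 0) has_real_derivative G') (at 0)"
    by (rule has_field_derivative_transform_within_open[OF assms(1)]) (use assms in auto)
  then show ?thesis
    using DERIV_unique DERIV_const by blast
qed

lemma angle_integral_derivative_zero:
  fixes G G' :: "real^3 \<Rightarrow> real"
  assumes v: "v \<in> mis_plane"
    and G: "\<And>\<theta>. ((\<lambda>e. G (\<theta> + e *\<^sub>R v)) has_real_derivative G' \<theta>) (at 0)"
    and cont: "continuous_on UNIV G" "continuous_on UNIV G'"
    and K: "compact K" "K \<subseteq> Omega" and supp: "\<And>\<theta>. \<theta> \<in> mis_plane \<Longrightarrow> \<theta> \<notin> K \<Longrightarrow> G \<theta> = 0"
  shows "(LINT \<theta>|angle_measure. G' \<theta>) = 0"
proof -
  obtain r where r: "v = plane_param r"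
    using v range_plane_param by blast
  obtain R where R: "\<And>\<theta>. \<theta> \<in> K \<Longrightarrow> norm \<theta> \<le> R"
    using compact_imp_bounded[OF K(1)] by (auto simp: bounded_iff)
  have pp: "plane_param (s + e *\<^sub>R r) = plane_param s + e *\<^sub>R v" for s e
    by (simp add: linear_add[OF linear_plane_param] linear_cmul[OF linear_plane_param] r)
  have [measurable]: "G' \<in> borel_measurable borel"
    using cont(2) by (rule borel_measurable_continuous_onI)
  have off: "G' (plane_param s) = 0" if "plane_param s \<notin> Omega" for s
  proof (rule zero_derivative_off_support[OF G compact_imp_closed[OF K(1)]])
    show "plane_param s \<notin> K" using that K by blast
    show "G (plane_param s + e *\<^sub>R v) = 0" if "plane_param s + e *\<^sub>R v \<notin> K" for e
      using supp that unfolding pp[symmetric] by simp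
  qed
  have "(LINT s|lborel. 0 * G (plane_param s) + 1 * G' (plane_param s)) = 0"
  proof (rule integral_weighted_directional_derivative_zero[where r = r and R = R and B = 1 and L = 0])
    show "((\<lambda>e. G (plane_param (s + e *\<^sub>R r))) has_real_derivative G' (plane_param s)) (at 0)" for s
      unfolding pp by (rule G)
    show "continuous_on UNIV (\<lambda>s. G (plane_param s))" "continuous_on UNIV (\<lambda>s. G' (plane_param s))"
      by (auto intro!: continuous_on_compose2[OF cont(1)] continuous_on_compose2[OF cont(2)] continuous_plane_param)
    show "G (plane_param s) = 0" if "norm s > R" for s
      using R[of "plane_param s"] that by (intro supp) (auto simp: norm_plane_param)
  qed auto
  moreover have "(\<lambda>s. indicator Omega (plane_param s) * G' (plane_param s)) = (\<lambda>s. G' (plane_param s))"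
    using off by (auto simp: fun_eq_iff indicator_def)
  ultimately show ?thesis
    by (simp only: angle_measure_integral[OF \<open>G' \<in> borel_measurable borel\<close>] mult_zero_left mult_1 add_0)
qed

text \<open>In contrast to the angular variable the weight is kept as a separate factor, because in
  \<open>a\<close> it is only locally Lipschitz and differentiable almost everywhere.\<close>

lemma domain_integral_derivative_zero:
  fixes G G' W W' :: "real^2 \<Rightarrow> real"
  assumes D: "open D"
    and G: "\<And>s. ((\<lambda>e. G (s + e *\<^sub>R r)) has_real_derivative G' s) (at 0)"
    and cont: "continuous_on UNIV G" "continuous_on UNIV G'"
    and K: "compact K" "K \<subseteq> D" and supp: "\<And>s. s \<notin> K \<Longrightarrow> G s = 0"
    and W: "W \<in> borel_measurable borel" "W' \<in> borel_measurable borel"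
    and W_bd: "\<And>S. bounded S \<Longrightarrow> \<exists>B. \<forall>s\<in>S. \<bar>W s\<bar> \<le> B"
    and W_lip: "\<And>S. bounded S \<Longrightarrow> \<exists>L. \<forall>s\<in>S. \<forall>s'\<in>S. \<bar>W s - W s'\<bar> \<le> L * norm (s - s')"
    and W_deriv: "AE s in lborel. ((\<lambda>e. W (s + e *\<^sub>R r)) has_real_derivative W' s) (at 0)"
  shows "(LINT s|restrict_space lborel D. W' s * G s + W s * G' s) = 0"
proof -
  obtain R where R: "\<And>s. s \<in> K \<Longrightarrow> norm s \<le> R"
    using compact_imp_bounded[OF K(1)] by (auto simp: bounded_iff)
  obtain B where "\<forall>s\<in>cball 0 (R + 2 * norm r). \<bar>W s\<bar> \<le> B"
    using W_bd[OF bounded_cball] by blast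
  then have B: "\<And>s. norm s \<le> R + 2 * norm r \<Longrightarrow> \<bar>W s\<bar> \<le> B"
    by simp
  obtain L where "\<forall>s\<in>cball 0 (R + norm r). \<forall>s'\<in>cball 0 (R + norm r). \<bar>W s - W s'\<bar> \<le> L * norm (s - s')"
    using W_lip[OF bounded_cball] by blast
  then have L: "\<And>s s'. norm s \<le> R + norm r \<Longrightarrow> norm s' \<le> R + norm r \<Longrightarrow> \<bar>W s - W s'\<bar> \<le> L * norm (s - s')"
    by simp
  have off: "G' s = 0" if "s \<notin> D" for s
    by (rule zero_derivative_off_support[OF G compact_imp_closed[OF K(1)]])
      (use K that supp in auto)
  have "(LINT s|lborel. W' s * G s + W s * G' s) = 0"
  proof (rule integral_weighted_directional_derivative_zero[where r = r and R = R and B = B and L = "L * norm r"])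
    show "G s = 0" if "norm s > R" for s
      using supp R[of s] that by force
    fix s :: "real^2" and e :: real assume s: "norm s \<le> R" and e: "0 < e" "e \<le> 1"
    have "norm (e *\<^sub>R r) \<le> norm r"
      using e by (simp add: mult_left_le_one_le)
    then have "norm (s + e *\<^sub>R r) \<le> R + norm r" "norm s \<le> R + norm r"
      using s norm_triangle_ineq[of s "e *\<^sub>R r"] norm_ge_zero[of r] by linarith+
    then show "\<bar>W (s + e *\<^sub>R r) - W s\<bar> \<le> L * norm r * e"
      using L[of "s + e *\<^sub>R r" s] e by (simp add: mult.assoc mult.commute[of e])
  qed (fact G cont W B W_deriv)+
  moreover have "(\<lambda>s. indicator D s *\<^sub>R (W' s * G s + W s * G' s)) = (\<lambda>s. W' s * G s + W s * G' s)"
  proof -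
    have "G s = 0" if "s \<notin> D" for s
      using supp K that by blast
    then show ?thesis
      using off by (auto simp: fun_eq_iff indicator_def)
  qed
  moreover have "D \<inter> space lborel \<in> sets lborel"
    using D by auto
  ultimately show ?thesis
    by (simp only: integral_restrict_space)
qed


section \<open>The Gibbs weight and weighted integration by parts\<close>

lemma abs_exp_diff_le:
  fixes u v :: real
  assumes "exp u \<le> B" "exp v \<le> B"
  shows "\<bar>exp u - exp v\<bar> \<le> B * \<bar>u - v\<bar>"
proof -
  have *: "exp u - exp v \<le> B * \<bar>u - v\<bar>" if "exp u \<le> B" for u v :: real
  proof -
    have "exp u - exp v = exp u * (1 - exp (v - u))"
      by (simp add: right_diff_distrib flip: exp_add)
    also have "\<dots> \<le> exp u * \<bar>u - v\<bar>"
    proof (rule mult_left_mono)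
      show "1 - exp (v - u) \<le> \<bar>u - v\<bar>"
        using exp_ge_add_one_self[of "v - u"] by linarith
    qed simp
    also have "\<dots> \<le> B * \<bar>u - v\<bar>"
      using that by (intro mult_right_mono) auto
    finally show ?thesis .
  qed
  show ?thesis
    using *[OF assms(1), of v] *[OF assms(2), of u] by (simp add: abs_le_iff abs_minus_commute)
qed

locale potential =
  fixes \<sigma> \<sigma>' :: "real \<Rightarrow> real" and x :: "3 \<Rightarrow> real^2" and d :: real and D :: "(real^2) set"
  assumes sigma_deriv: "\<And>r. (\<sigma> has_real_derivative \<sigma>' r) (at r)"
    and sigma_cont: "continuous_on UNIV \<sigma>'"
    and d_pos: "0 < d" and D_open: "open D" and D_bounded: "bounded D"
begin

lemma sigma_continuous: "continuous_on S \<sigma>"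
  using sigma_deriv by (meson DERIV_continuous_on has_field_derivative_at_within)

text \<open>A representative of the energy gradient defined at every point: at a = x j the
  convention sgn 0 = 0 replaces the unspecified value of \<open>grad\<close>, so measurability and
  boundedness hold without an exceptional set.\<close>

definition Egrad :: "state \<Rightarrow> state" where
  "Egrad z = (tgrad (\<lambda>\<theta>'. energy \<sigma> x \<theta>' (snd z)) (fst z), \<Sum>j\<in>UNIV. \<sigma> (fst z $ j) *\<^sub>R sgn (snd z - x j))"

definition weight :: "state \<Rightarrow> real" where
  "weight z = exp (- energy \<sigma> x (fst z) (snd z) / d)"

lemma weight_pos: "0 < weight z"
  by (simp add: weight_def)

lemma energy_theta_derivative:
  "((\<lambda>\<theta>'. energy \<sigma> x \<theta>' a) has_derivative (\<lambda>h. \<Sum>j\<in>UNIV. \<sigma>' (\<theta> $ j) * h $ j * norm (a - x j))) (at \<theta>)"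
proof -
  have "((\<lambda>\<theta>'. \<sigma> (\<theta>' $ j)) has_derivative (\<lambda>h. \<sigma>' (\<theta> $ j) * h $ j)) (at \<theta>)" for j
  proof (rule has_derivative_compose[where f = "\<lambda>\<theta>'. \<theta>' $ j" and g = \<sigma> and f' = "\<lambda>h. h $ j"
        and g' = "(*) (\<sigma>' (\<theta> $ j))"])
    show "((\<lambda>\<theta>'. \<theta>' $ j) has_derivative (\<lambda>h. h $ j)) (at \<theta>)"
      by (rule bounded_linear_imp_has_derivative) (rule bounded_linear_vec_nth)
    show "(\<sigma> has_derivative (*) (\<sigma>' (\<theta> $ j))) (at (\<theta> $ j))"
      using sigma_deriv by (simp add: has_field_derivative_def)
  qed
  then show ?thesis
    unfolding energy_def by (intro has_derivative_sum has_derivative_mult_left)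
qed

lemma energy_a_derivative:
  assumes "a \<notin> range x"
  shows "(energy \<sigma> x \<theta> has_derivative (\<lambda>h. (\<Sum>j\<in>UNIV. \<sigma> (\<theta> $ j) *\<^sub>R sgn (a - x j)) \<bullet> h)) (at a)"
proof -
  have "((\<lambda>a. norm (a - x j)) has_derivative (\<lambda>h. sgn (a - x j) \<bullet> h)) (at a)" for j
  proof (rule has_derivative_compose[where f = "\<lambda>a. a - x j" and g = norm and f' = "\<lambda>h. h"
        and g' = "\<lambda>h. sgn (a - x j) \<bullet> h"])
    show "((\<lambda>a. a - x j) has_derivative (\<lambda>h. h)) (at a)"
      by (auto intro!: derivative_eq_intros)
    have "a - x j \<noteq> 0" using assms by auto
    then show "(norm has_derivative (\<lambda>h. sgn (a - x j) \<bullet> h)) (at (a - x j))"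
      using has_derivative_norm[of "a - x j"] by (simp add: inner_commute)
  qed
  then have "((\<lambda>a. \<Sum>j\<in>UNIV. \<sigma> (\<theta> $ j) * norm (a - x j)) has_derivative
      (\<lambda>h. \<Sum>j\<in>UNIV. \<sigma> (\<theta> $ j) * (sgn (a - x j) \<bullet> h))) (at a)"
    by (intro has_derivative_sum has_derivative_mult_right)
  then show ?thesis
    by (simp add: energy_def[abs_def] inner_sum_left)
qed

lemma Egrad_fst: "fst (Egrad (\<theta>, a)) = proj_plane (\<chi> k. \<sigma>' (\<theta> $ k) * norm (a - x k))"
proof -
  have "fst (Egrad (\<theta>, a)) \<bullet> u = proj_plane (\<chi> k. \<sigma>' (\<theta> $ k) * norm (a - x k)) \<bullet> u" for u
    unfolding Egrad_def fst_conv snd_conv tgrad_inner[OF energy_theta_derivative] proj_plane_inner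
    by (simp add: inner_vec_def mult.assoc mult.commute mult.left_commute)
  then show ?thesis
    using vector_eq_rdot by blast
qed

lemma Egrad_fst_continuous: "continuous_on UNIV (\<lambda>z. fst (Egrad z))"
proof -
  have "continuous_on UNIV (\<lambda>z. proj_plane (\<chi> k. \<sigma>' (fst z $ k) * norm (snd z - x k)))"
    by (intro continuous_intros continuous_on_vec_lambda continuous_on_compose2[OF sigma_cont]) auto
  moreover have "fst (Egrad z) = proj_plane (\<chi> k. \<sigma>' (fst z $ k) * norm (snd z - x k))" for z
    by (cases z) (simp add: Egrad_fst)
  ultimately show ?thesis by simp
qed

lemma energy_continuous: "continuous_on UNIV (\<lambda>z. energy \<sigma> x (fst z) (snd z))"
  unfolding energy_def
  by (intro continuous_intros continuous_on_compose2[OF sigma_continuous]) auto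

lemma weight_continuous: "continuous_on UNIV weight"
  unfolding weight_def[abs_def] using d_pos by (intro continuous_intros energy_continuous) auto

lemma Egrad_measurable [measurable]: "Egrad \<in> borel_measurable borel"
proof -
  have [measurable]: "\<sigma> \<in> borel_measurable borel"
    by (rule borel_measurable_continuous_onI[OF sigma_continuous])
  have "(\<lambda>z::state. fst (Egrad z)) \<in> borel_measurable borel"
    by (rule borel_measurable_continuous_onI[OF Egrad_fst_continuous])
  moreover have "(\<lambda>z::state. snd (Egrad z)) \<in> borel_measurable borel"
  proof -
    have [measurable]: "(\<lambda>z::state. fst z $ j) \<in> borel_measurable borel" "(\<lambda>z::state. snd z - x j) \<in> borel_measurable borel" for j
      by (auto intro!: borel_measurable_continuous_onI continuous_intros)
    have "(\<lambda>z::state. \<Sum>j\<in>UNIV. \<sigma> (fst z $ j) *\<^sub>R sgn (snd z - x j)) \<in> borel_measurable borel"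
      unfolding sgn_div_norm by measurable
    then show ?thesis by (simp add: Egrad_def[abs_def])
  qed
  ultimately have "(\<lambda>z. (fst (Egrad z), snd (Egrad z))) \<in> borel \<rightarrow>\<^sub>M borel \<Otimes>\<^sub>M borel"
    by (rule measurable_Pair)
  then show ?thesis by (simp add: borel_prod)
qed

lemma bounded_states: "bounded (Omega \<times> D)"
  using bounded_Omega D_bounded by (rule bounded_Times)

lemma Egrad_bounded: "\<exists>C. \<forall>z\<in>Omega \<times> D. norm (Egrad z) \<le> C"
proof -
  obtain C1 where C1: "\<forall>z\<in>Omega \<times> D. norm (fst (Egrad z)) \<le> C1"
    using continuous_bounded_on[OF Egrad_fst_continuous bounded_states] by blast
  have "continuous_on UNIV (\<lambda>z::state. \<Sum>j\<in>UNIV. \<bar>\<sigma> (fst z $ j)\<bar>)"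
    by (intro continuous_intros continuous_on_compose2[OF sigma_continuous]) auto
  then obtain C2 where C2: "\<forall>z\<in>Omega \<times> D. norm (\<Sum>j\<in>UNIV. \<bar>\<sigma> (fst z $ j)\<bar>) \<le> C2"
    using continuous_bounded_on bounded_states by blast
  have "norm (Egrad z) \<le> C1 + C2" if "z \<in> Omega \<times> D" for z
  proof -
    have "norm (snd (Egrad z)) \<le> (\<Sum>j\<in>UNIV. norm (\<sigma> (fst z $ j) *\<^sub>R sgn (snd z - x j)))"
      unfolding Egrad_def snd_conv by (rule norm_sum)
    also have "\<dots> \<le> (\<Sum>j\<in>UNIV. \<bar>\<sigma> (fst z $ j)\<bar>)"
      by (intro sum_mono) (simp add: norm_sgn)
    also have "\<dots> \<le> C2" using C2 that by auto
    finally show ?thesis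
      using C1 that norm_Pair_le[of "fst (Egrad z)" "snd (Egrad z)"] by fastforce
  qed
  then show ?thesis by blast
qed

lemma energy_a_lipschitz:
  "\<bar>energy \<sigma> x \<theta> a - energy \<sigma> x \<theta> a'\<bar> \<le> (\<Sum>j\<in>UNIV. \<bar>\<sigma> (\<theta> $ j)\<bar>) * norm (a - a')"
proof -
  have "\<bar>energy \<sigma> x \<theta> a - energy \<sigma> x \<theta> a'\<bar> = \<bar>\<Sum>j\<in>UNIV. \<sigma> (\<theta> $ j) * (norm (a - x j) - norm (a' - x j))\<bar>"
    by (simp add: energy_def right_diff_distrib sum_subtractf)
  also have "\<dots> \<le> (\<Sum>j\<in>UNIV. \<bar>\<sigma> (\<theta> $ j) * (norm (a - x j) - norm (a' - x j))\<bar>)"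
    by (rule sum_abs)
  also have "\<dots> \<le> (\<Sum>j\<in>UNIV. \<bar>\<sigma> (\<theta> $ j)\<bar> * norm (a - a'))"
    unfolding abs_mult
    by (intro sum_mono mult_left_mono) (use norm_triangle_ineq3[of "a - x j" "a' - x j" for j] in auto)
  finally show ?thesis by (simp add: sum_distrib_right)
qed

lemma weight_a_lipschitz:
  assumes "bounded S"
  shows "\<exists>L. \<forall>a\<in>S. \<forall>a'\<in>S. \<bar>weight (\<theta>, a) - weight (\<theta>, a')\<bar> \<le> L * norm (a - a')"
proof -
  have "continuous_on UNIV (\<lambda>a. weight (\<theta>, a))"
    by (intro continuous_on_compose2[OF weight_continuous] continuous_intros) auto
  then obtain B where B: "\<forall>a\<in>S. norm (weight (\<theta>, a)) \<le> B"
    using continuous_bounded_on assms by blast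
  define L where "L = (\<Sum>j\<in>UNIV. \<bar>\<sigma> (\<theta> $ j)\<bar>)"
  have "\<bar>weight (\<theta>, a) - weight (\<theta>, a')\<bar> \<le> (B * (L / d)) * norm (a - a')" if a: "a \<in> S" "a' \<in> S" for a a'
  proof -
    have B0: "0 \<le> B"
      using B a(1) norm_ge_zero order_trans by blast
    have "\<bar>weight (\<theta>, a) - weight (\<theta>, a')\<bar> \<le> B * \<bar>- energy \<sigma> x \<theta> a / d - (- energy \<sigma> x \<theta> a' / d)\<bar>"
      unfolding weight_def fst_conv snd_conv
      using B a by (intro abs_exp_diff_le) (auto simp: weight_def)
    also have "\<bar>- energy \<sigma> x \<theta> a / d - (- energy \<sigma> x \<theta> a' / d)\<bar> = \<bar>energy \<sigma> x \<theta> a - energy \<sigma> x \<theta> a'\<bar> / d"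
      using d_pos by (simp add: abs_minus_commute flip: diff_divide_distrib)
    also have "\<dots> \<le> L * norm (a - a') / d"
      using d_pos energy_a_lipschitz[of \<theta> a a'] by (intro divide_right_mono) (auto simp: L_def)
    finally show ?thesis
      using B0 by (simp add: mult_left_mono mult.assoc)
  qed
  then show ?thesis by blast
qed

text \<open>Multiplied by the weight, this is the derivative of \<open>weight * \<phi> * \<psi>\<close> in direction \<open>i\<close>.\<close>

definition flux_density :: "(event \<Rightarrow> real) \<Rightarrow> (event \<Rightarrow> real) \<Rightarrow> real \<Rightarrow> state \<Rightarrow> state \<Rightarrow> real" where
  "flux_density \<phi> \<psi> t i z = (let e = (fst z, snd z, t) in
     \<phi> e * (state_grad \<psi> e \<bullet> i - \<psi> e * (Egrad z \<bullet> i) / d) + \<psi> e * (state_grad \<phi> e \<bullet> i))"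

lemma flux_density_add: "flux_density \<phi> \<psi> t (i + j) z = flux_density \<phi> \<psi> t i z + flux_density \<phi> \<psi> t j z"
  by (simp add: flux_density_def Let_def inner_add_right algebra_simps add_divide_distrib)

lemma weighted_flux_integrable:
  assumes "Ck 1 \<phi>" "Ck 1 \<psi>"
  shows "integrable (state_measure D) (\<lambda>z. weight z * flux_density \<phi> \<psi> t i z)"
proof -
  interpret finite_measure "state_measure D"
    by (rule finite_measure_pair_measure[OF finite_domain_measure[OF D_open D_bounded] finite_angle_measure])
  have emb: "continuous_on UNIV (\<lambda>z::state. (fst z, snd z, t))"
    by (intro continuous_intros)
  have c: "continuous_on UNIV weight" "continuous_on UNIV (\<lambda>z::state. \<phi> (fst z, snd z, t))"
    "continuous_on UNIV (\<lambda>z::state. \<psi> (fst z, snd z, t))"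
    "continuous_on UNIV (\<lambda>z::state. state_grad \<phi> (fst z, snd z, t) \<bullet> i)"
    "continuous_on UNIV (\<lambda>z::state. state_grad \<psi> (fst z, snd z, t) \<bullet> i)"
    using assms[THEN Ck1_continuous] assms[THEN state_grad_continuous]
    by (auto intro!: weight_continuous continuous_on_compose2[OF _ emb] continuous_intros)
  have [measurable]: "weight \<in> borel_measurable borel" "(\<lambda>z::state. \<phi> (fst z, snd z, t)) \<in> borel_measurable borel"
    "(\<lambda>z::state. \<psi> (fst z, snd z, t)) \<in> borel_measurable borel"
    "(\<lambda>z::state. state_grad \<phi> (fst z, snd z, t) \<bullet> i) \<in> borel_measurable borel"
    "(\<lambda>z::state. state_grad \<psi> (fst z, snd z, t) \<bullet> i) \<in> borel_measurable borel"
    using c[THEN borel_measurable_continuous_onI] by auto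
  have m: "(\<lambda>z. weight z * flux_density \<phi> \<psi> t i z) \<in> borel_measurable borel"
    unfolding flux_density_def Let_def by measurable
  obtain C1 where C1: "\<forall>z\<in>Omega \<times> D. norm (weight z) \<le> C1"
    using continuous_bounded_on[OF c(1) bounded_states] by blast
  obtain C2 where C2: "\<forall>z\<in>Omega \<times> D. norm (\<phi> (fst z, snd z, t)) \<le> C2"
    using continuous_bounded_on[OF c(2) bounded_states] by blast
  obtain C3 where C3: "\<forall>z\<in>Omega \<times> D. norm (\<psi> (fst z, snd z, t)) \<le> C3"
    using continuous_bounded_on[OF c(3) bounded_states] by blast
  obtain C4 where C4: "\<forall>z\<in>Omega \<times> D. norm (state_grad \<phi> (fst z, snd z, t) \<bullet> i) \<le> C4"
    using continuous_bounded_on[OF c(4) bounded_states] by blast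
  obtain C5 where C5: "\<forall>z\<in>Omega \<times> D. norm (state_grad \<psi> (fst z, snd z, t) \<bullet> i) \<le> C5"
    using continuous_bounded_on[OF c(5) bounded_states] by blast
  obtain C6 where C6: "\<forall>z\<in>Omega \<times> D. norm (Egrad z) \<le> C6"
    using Egrad_bounded by blast
  note C = C1 C2 C3 C4 C5 C6
  have "norm (weight z * flux_density \<phi> \<psi> t i z) \<le> C1 * (C2 * (C5 + C3 * (C6 * norm i) / d) + C3 * C4)"
    if z: "z \<in> Omega \<times> D" for z
  proof -
    let ?e = "(fst z, snd z, t)"
    have n: "0 \<le> C1" "0 \<le> C2" "0 \<le> C3" "0 \<le> C5" "0 \<le> C6"
      using C[THEN bspec, OF z] norm_ge_zero order_trans by blast+
    have E: "\<bar>Egrad z \<bullet> i\<bar> \<le> C6 * norm i"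
    proof -
      have "norm (Egrad z) * norm i \<le> C6 * norm i"
        using C6 z by (intro mult_right_mono) auto
      then show ?thesis
        using Cauchy_Schwarz_ineq2[of "Egrad z" i] by linarith
    qed
    have "\<bar>state_grad \<psi> ?e \<bullet> i - \<psi> ?e * (Egrad z \<bullet> i) / d\<bar> \<le> \<bar>state_grad \<psi> ?e \<bullet> i\<bar> + \<bar>\<psi> ?e\<bar> * \<bar>Egrad z \<bullet> i\<bar> / d"
      using abs_triangle_ineq4[of "state_grad \<psi> ?e \<bullet> i" "\<psi> ?e * (Egrad z \<bullet> i) / d"] d_pos by (simp add: abs_mult)
    also have "\<dots> \<le> C5 + C3 * (C6 * norm i) / d"
      using C z E d_pos n by (intro add_mono divide_right_mono mult_mono) auto
    finally have 1: "\<bar>state_grad \<psi> ?e \<bullet> i - \<psi> ?e * (Egrad z \<bullet> i) / d\<bar> \<le> C5 + C3 * (C6 * norm i) / d" .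
    have "\<bar>flux_density \<phi> \<psi> t i z\<bar> \<le> \<bar>\<phi> ?e\<bar> * \<bar>state_grad \<psi> ?e \<bullet> i - \<psi> ?e * (Egrad z \<bullet> i) / d\<bar> + \<bar>\<psi> ?e\<bar> * \<bar>state_grad \<phi> ?e \<bullet> i\<bar>"
      unfolding flux_density_def Let_def abs_mult[symmetric] by (rule abs_triangle_ineq)
    also have "\<dots> \<le> C2 * (C5 + C3 * (C6 * norm i) / d) + C3 * C4"
      using C z 1 n by (intro add_mono mult_mono) auto
    finally have 2: "\<bar>flux_density \<phi> \<psi> t i z\<bar> \<le> C2 * (C5 + C3 * (C6 * norm i) / d) + C3 * C4" .
    have "\<bar>weight z\<bar> * \<bar>flux_density \<phi> \<psi> t i z\<bar> \<le> C1 * (C2 * (C5 + C3 * (C6 * norm i) / d) + C3 * C4)"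
      using C(1) z 2 n by (intro mult_mono) auto
    then show ?thesis by (simp add: abs_mult)
  qed
  then show ?thesis
    by (intro integrable_const_bound[where B = "C1 * (C2 * (C5 + C3 * (C6 * norm i) / d) + C3 * C4)"]
        measurable_state_measure m AE_I2) (simp add: space_state_measure)
qed

text \<open>In \<theta> the energy is of class C^1, so the whole product weight * \<phi> * \<psi> is
  differentiated classically. Its support comes from \<psi>; \<phi> may be arbitrary at the
  boundary.\<close>

lemma theta_integration_by_parts:
  assumes "Ck 1 \<phi>" "Ck 1 \<psi>" and K: "compact K" "K \<subseteq> Omega \<times> D \<times> {0<..}"
    and supp: "\<And>\<theta> a t. \<theta> \<in> mis_plane \<Longrightarrow> (\<theta>, a, t) \<notin> K \<Longrightarrow> \<psi> (\<theta>, a, t) = 0"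
  shows "(LINT \<theta>|angle_measure. weight (\<theta>, a) * flux_density \<phi> \<psi> t (u, 0) (\<theta>, a)) = 0"
proof (rule angle_integral_derivative_zero[where v = "proj_plane u" and K = "(\<lambda>\<theta>. (\<theta>, a, t)) -` K"
      and G = "\<lambda>\<theta>. weight (\<theta>, a) * (\<phi> (\<theta>, a, t) * \<psi> (\<theta>, a, t))"])
  have emb: "continuous_on UNIV (\<lambda>\<theta>::real^3. (\<theta>, a, t))" "continuous_on UNIV (\<lambda>\<theta>::real^3. (\<theta>, a))"
    by (intro continuous_intros)+
  have c: "continuous_on UNIV (\<lambda>\<theta>. weight (\<theta>, a))" "continuous_on UNIV (\<lambda>\<theta>. \<phi> (\<theta>, a, t))"
    "continuous_on UNIV (\<lambda>\<theta>. \<psi> (\<theta>, a, t))" "continuous_on UNIV (\<lambda>\<theta>. state_grad \<phi> (\<theta>, a, t))"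
    "continuous_on UNIV (\<lambda>\<theta>. state_grad \<psi> (\<theta>, a, t))" "continuous_on UNIV (\<lambda>\<theta>. fst (Egrad (\<theta>, a)))"
    using assms(1,2)[THEN Ck1_continuous] assms(1,2)[THEN state_grad_continuous] weight_continuous Egrad_fst_continuous
    by (auto intro!: continuous_on_compose2[OF _ emb(1)] continuous_on_compose2[OF _ emb(2)])
  show "proj_plane u \<in> mis_plane" by (rule proj_plane_in_plane)
  show "continuous_on UNIV (\<lambda>\<theta>. weight (\<theta>, a) * (\<phi> (\<theta>, a, t) * \<psi> (\<theta>, a, t)))"
    by (intro continuous_intros c)
  \<comment> \<open>In a direction (u, 0) only the angular component of \<open>Egrad\<close> enters,
    whose continuity is known.\<close>
  show "continuous_on UNIV (\<lambda>\<theta>. weight (\<theta>, a) * flux_density \<phi> \<psi> t (u, 0) (\<theta>, a))"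
    unfolding flux_density_def Let_def fst_conv snd_conv inner_prod_def[of "Egrad z" for z] inner_zero_right add_0_right
    using d_pos by (intro continuous_intros c) auto
  have "bounded ((\<lambda>\<theta>. (\<theta>, a, t)) -` K)"
    using K(2) by (intro bounded_subset[OF bounded_Omega]) auto
  then show "compact ((\<lambda>\<theta>. (\<theta>, a, t)) -` K)"
    using closed_vimage[OF compact_imp_closed[OF K(1)] emb(1)] by (simp add: compact_eq_bounded_closed)
  show "(\<lambda>\<theta>. (\<theta>, a, t)) -` K \<subseteq> Omega"
    using K(2) by auto
  show "weight (\<theta>, a) * (\<phi> (\<theta>, a, t) * \<psi> (\<theta>, a, t)) = 0"
    if "\<theta> \<in> mis_plane" "\<theta> \<notin> (\<lambda>\<theta>. (\<theta>, a, t)) -` K" for \<theta>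
    using supp that by auto
  fix \<theta>
  note dE = has_derivative_directional[OF energy_theta_derivative, where v = "proj_plane u"]
  note d\<phi> = has_derivative_directional[OF partial_derivatives(1)[OF Ck1_has_derivative[OF assms(1), of "(\<theta>, a, t)"]], of "proj_plane u"]
  note d\<psi> = has_derivative_directional[OF partial_derivatives(1)[OF Ck1_has_derivative[OF assms(2), of "(\<theta>, a, t)"]], of "proj_plane u"]
  have E: "Egrad (\<theta>, a) \<bullet> (u, 0) = (\<Sum>j\<in>UNIV. \<sigma>' (\<theta> $ j) * proj_plane u $ j * norm (a - x j))"
    unfolding inner_prod_def Egrad_def fst_conv snd_conv tgrad_inner[OF energy_theta_derivative] by simp
  have g: "state_grad f (\<theta>, a, t) \<bullet> (u, 0) = frechet_derivative f (at (\<theta>, a, t)) (proj_plane u, 0, 0)" if "Ck 1 f" for f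
    using state_grad_inner[OF Ck1_has_derivative[OF that]] by (simp add: direction_def)
  show "((\<lambda>e. weight (\<theta> + e *\<^sub>R proj_plane u, a) * (\<phi> (\<theta> + e *\<^sub>R proj_plane u, a, t) * \<psi> (\<theta> + e *\<^sub>R proj_plane u, a, t)))
      has_real_derivative weight (\<theta>, a) * flux_density \<phi> \<psi> t (u, 0) (\<theta>, a)) (at 0)"
    unfolding weight_def flux_density_def Let_def fst_conv snd_conv E g[OF assms(1)] g[OF assms(2)]
    by (rule DERIV_cong[OF DERIV_mult[OF DERIV_fun_exp[OF DERIV_cdivide[OF DERIV_minus[OF dE]]]
          DERIV_mult[OF d\<phi> d\<psi>]]])
      (use d_pos in \<open>simp add: field_simps\<close>)
qed

text \<open>The energy has cone-shaped kinks at the points x j. They form a finite and hence null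
  set, and the weight is Lipschitz across them, so no singular term arises.\<close>

lemma a_integration_by_parts:
  assumes "Ck 1 \<phi>" "Ck 1 \<psi>" and K: "compact K" "K \<subseteq> Omega \<times> D \<times> {0<..}"
    and supp: "\<And>\<theta> a t. \<theta> \<in> mis_plane \<Longrightarrow> (\<theta>, a, t) \<notin> K \<Longrightarrow> \<psi> (\<theta>, a, t) = 0"
    and \<theta>: "\<theta> \<in> mis_plane"
  shows "(LINT a|restrict_space lborel D. weight (\<theta>, a) * flux_density \<phi> \<psi> t (0, v) (\<theta>, a)) = 0"
proof -
  define G where "G a = \<phi> (\<theta>, a, t) * \<psi> (\<theta>, a, t)" for a
  define G' where "G' a = \<phi> (\<theta>, a, t) * (state_grad \<psi> (\<theta>, a, t) \<bullet> (0, v)) + \<psi> (\<theta>, a, t) * (state_grad \<phi> (\<theta>, a, t) \<bullet> (0, v))" for a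
  define W' where "W' a = - ((Egrad (\<theta>, a) \<bullet> (0, v)) / d) * weight (\<theta>, a)" for a
  have emb: "continuous_on UNIV (\<lambda>a::real^2. (\<theta>, a, t))" "continuous_on UNIV (\<lambda>a::real^2. (\<theta>, a))"
    by (intro continuous_intros)+
  have c: "continuous_on UNIV (\<lambda>a. weight (\<theta>, a))" "continuous_on UNIV (\<lambda>a. \<phi> (\<theta>, a, t))"
    "continuous_on UNIV (\<lambda>a. \<psi> (\<theta>, a, t))" "continuous_on UNIV (\<lambda>a. state_grad \<phi> (\<theta>, a, t))"
    "continuous_on UNIV (\<lambda>a. state_grad \<psi> (\<theta>, a, t))"
    using assms(1,2)[THEN Ck1_continuous] assms(1,2)[THEN state_grad_continuous] weight_continuous
    by (auto intro!: continuous_on_compose2[OF _ emb(1)] continuous_on_compose2[OF _ emb(2)])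
  have g: "state_grad f (\<theta>, a, t) \<bullet> (0, v) = frechet_derivative f (at (\<theta>, a, t)) (0, v, 0)" if "Ck 1 f" for f a
    using state_grad_inner[OF Ck1_has_derivative[OF that]]
    by (simp add: direction_def proj_plane_def)
  have "(LINT a|restrict_space lborel D. W' a * G a + weight (\<theta>, a) * G' a) = 0"
  proof (rule domain_integral_derivative_zero[OF D_open, where r = v and K = "(\<lambda>a. (\<theta>, a, t)) -` K"])
    show "((\<lambda>e. G (a + e *\<^sub>R v)) has_real_derivative G' a) (at 0)" for a
    proof -
      note d\<phi> = has_derivative_directional[OF partial_derivatives(2)[OF Ck1_has_derivative[OF assms(1), of "(\<theta>, a, t)"]], of v]
      note d\<psi> = has_derivative_directional[OF partial_derivatives(2)[OF Ck1_has_derivative[OF assms(2), of "(\<theta>, a, t)"]], of v]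
      show ?thesis
        unfolding G_def G'_def g[OF assms(1)] g[OF assms(2)]
        by (rule derivative_eq_intros d\<phi> d\<psi> refl)+ (simp add: mult.commute add.commute)
    qed
    show "continuous_on UNIV G" "continuous_on UNIV G'"
      unfolding G_def[abs_def] G'_def[abs_def] by (intro continuous_intros c)+
    have "bounded ((\<lambda>a. (\<theta>, a, t)) -` K)"
      using K(2) by (intro bounded_subset[OF D_bounded]) auto
    then show "compact ((\<lambda>a. (\<theta>, a, t)) -` K)"
      using closed_vimage[OF compact_imp_closed[OF K(1)] emb(1)] by (simp add: compact_eq_bounded_closed)
    show "(\<lambda>a. (\<theta>, a, t)) -` K \<subseteq> D"
      using K(2) by auto
    show "G a = 0" if "a \<notin> (\<lambda>a. (\<theta>, a, t)) -` K" for a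
      using supp[OF \<theta>] that by (auto simp: G_def)
    show wm: "(\<lambda>a. weight (\<theta>, a)) \<in> borel_measurable borel"
      by (rule borel_measurable_continuous_onI[OF c(1)])
    have "(\<lambda>a. Egrad (\<theta>, a)) \<in> borel_measurable borel"
      by (rule measurable_compose[OF borel_measurable_continuous_onI[OF emb(2)] Egrad_measurable])
    then show "W' \<in> borel_measurable borel"
      unfolding W'_def[abs_def] using wm by measurable
    show "\<exists>B. \<forall>a\<in>S. \<bar>weight (\<theta>, a)\<bar> \<le> B" if "bounded S" for S
      using continuous_bounded_on[OF c(1) that] by simp
    show "\<exists>L. \<forall>a\<in>S. \<forall>a'\<in>S. \<bar>weight (\<theta>, a) - weight (\<theta>, a')\<bar> \<le> L * norm (a - a')" if "bounded S" for S
      by (rule weight_a_lipschitz[OF that])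
    have "AE a in lborel. a \<notin> range x"
      by (rule AE_not_in[OF finite_imp_null_set_lborel]) simp
    then show "AE a in lborel. ((\<lambda>e. weight (\<theta>, a + e *\<^sub>R v)) has_real_derivative W' a) (at 0)"
    proof eventually_elim
      case (elim a)
      note dE = has_derivative_directional[OF energy_a_derivative[OF elim], where v = v]
      show ?case
        unfolding weight_def fst_conv snd_conv
        by (rule DERIV_cong[OF DERIV_fun_exp[OF DERIV_cdivide[OF DERIV_minus[OF dE]]]])
          (use d_pos in \<open>simp add: W'_def weight_def inner_prod_def Egrad_def field_simps\<close>)
    qed
  qed
  moreover have "W' a * G a + weight (\<theta>, a) * G' a = weight (\<theta>, a) * flux_density \<phi> \<psi> t (0, v) (\<theta>, a)" for a
    using d_pos by (simp add: W'_def G_def G'_def flux_density_def Let_def field_simps)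
  ultimately show ?thesis by simp
qed

text \<open>The density is additive in the direction, which is split into its angular and its
  spatial part; by Fubini each part is integrated over its own variable first.\<close>

lemma weighted_integration_by_parts:
  assumes "Ck 1 \<phi>" "Ck 1 \<psi>" and K: "compact K" "K \<subseteq> Omega \<times> D \<times> {0<..}"
    and supp: "\<And>\<theta> a t. \<theta> \<in> mis_plane \<Longrightarrow> (\<theta>, a, t) \<notin> K \<Longrightarrow> \<psi> (\<theta>, a, t) = 0"
  shows "(LINT z|state_measure D. weight z * flux_density \<phi> \<psi> t i z) = 0"
proof -
  interpret A: finite_measure angle_measure by (rule finite_angle_measure)
  interpret B: finite_measure "restrict_space lborel D" by (rule finite_domain_measure[OF D_open D_bounded])
  interpret pair_sigma_finite angle_measure "restrict_space lborel D" ..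
  obtain u v where i: "i = (u, 0) + (0, v)"
    by (cases i) auto
  note int = weighted_flux_integrable[OF assms(1,2), of t]
  have "(LINT z|state_measure D. weight z * flux_density \<phi> \<psi> t (u, 0) z) =
      (LINT a|restrict_space lborel D. LINT \<theta>|angle_measure. weight (\<theta>, a) * flux_density \<phi> \<psi> t (u, 0) (\<theta>, a))"
    using integral_snd[of "\<lambda>\<theta> a. weight (\<theta>, a) * flux_density \<phi> \<psi> t (u, 0) (\<theta>, a)"] int[of "(u, 0)"] by (simp add: case_prod_beta')
  also have "\<dots> = 0"
    using theta_integration_by_parts[OF assms] by simp
  finally have 1: "(LINT z|state_measure D. weight z * flux_density \<phi> \<psi> t (u, 0) z) = 0" .
  have "(LINT z|state_measure D. weight z * flux_density \<phi> \<psi> t (0, v) z) =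
      (LINT \<theta>|angle_measure. LINT a|restrict_space lborel D. weight (\<theta>, a) * flux_density \<phi> \<psi> t (0, v) (\<theta>, a))"
    using integral_fst[of "\<lambda>\<theta> a. weight (\<theta>, a) * flux_density \<phi> \<psi> t (0, v) (\<theta>, a)"] int[of "(0, v)"] by (simp add: case_prod_beta')
  also have "\<dots> = (LINT \<theta>|angle_measure. 0)"
    using a_integration_by_parts[OF assms] Omega_subset_plane
    by (intro Bochner_Integration.integral_cong) (auto simp: space_restrict_space)
  finally have 2: "(LINT z|state_measure D. weight z * flux_density \<phi> \<psi> t (0, v) z) = 0" by simp
  show ?thesis
    unfolding i flux_density_add distrib_left using 1 2 int by simp
qed

end


section \<open>Existence for the weak formulation tested with compactly supported functions of time\<close>

lemma Ck1_lincomb: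
  fixes f g :: "'a::euclidean_space \<Rightarrow> real"
  assumes "Ck 1 f" "Ck 1 g"
  shows "Ck 1 (\<lambda>z. f z + c * g z)"
    and "frechet_derivative (\<lambda>z. f z + c * g z) (at z) v =
      frechet_derivative f (at z) v + c * frechet_derivative g (at z) v"
proof -
  have d: "((\<lambda>z. f z + c * g z) has_derivative
      (\<lambda>v. frechet_derivative f (at z) v + c * frechet_derivative g (at z) v)) (at z)" for z
    by (intro has_derivative_add has_derivative_mult_right Ck1_has_derivative assms)
  show "Ck 1 (\<lambda>z. f z + c * g z)"
    by (rule Ck1I[OF d]) (intro continuous_intros Ck1_continuous_derivative assms)
  show "frechet_derivative (\<lambda>z. f z + c * g z) (at z) v =
      frechet_derivative f (at z) v + c * frechet_derivative g (at z) v"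
    by (simp add: frechet_derivative_at[OF d, symmetric])
qed

lemma Ck1_zero: "Ck 1 (\<lambda>z::'a::euclidean_space. 0::real)"
  by (rule Ck1I[where f' = "\<lambda>z v. 0"]) auto

lemma state_grad_lincomb:
  assumes "Ck 1 f" "Ck 1 g"
  shows "state_grad (\<lambda>e. f e + c * g e) e = state_grad f e + c *\<^sub>R state_grad g e"
proof (rule euclidean_eqI)
  fix i :: state
  show "state_grad (\<lambda>e. f e + c * g e) e \<bullet> i = (state_grad f e + c *\<^sub>R state_grad g e) \<bullet> i"
    unfolding state_grad_inner[OF Ck1_has_derivative[OF Ck1_lincomb(1)[OF assms]]] Ck1_lincomb(2)[OF assms]
      inner_add_left inner_scaleR_left state_grad_inner[OF Ck1_has_derivative[OF assms(1)]]
      state_grad_inner[OF Ck1_has_derivative[OF assms(2)]] ..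
qed

lemma state_grad_zero: "state_grad (\<lambda>e. 0) e = 0"
  using state_grad_lincomb[OF Ck1_zero Ck1_zero, of "-1" e] by simp

text \<open>Vanishing on the plane suffices because \<open>direction i\<close> is tangent to
  it.\<close>

lemma state_grad_off_support:
  assumes "Ck 1 \<psi>" "closed K" "(\<theta>, a, t) \<notin> K" "\<theta> \<in> mis_plane"
    and supp: "\<And>\<theta> a t. \<theta> \<in> mis_plane \<Longrightarrow> (\<theta>, a, t) \<notin> K \<Longrightarrow> \<psi> (\<theta>, a, t) = 0"
  shows "state_grad \<psi> (\<theta>, a, t) = 0"
proof (rule euclidean_eqI)
  fix i :: state
  have pl: "\<theta> + c *\<^sub>R proj_plane u \<in> mis_plane" for c u
  proof -
    have "(\<theta> + c *\<^sub>R proj_plane u) $ 1 + (\<theta> + c *\<^sub>R proj_plane u) $ 2 + (\<theta> + c *\<^sub>R proj_plane u) $ 3 =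
        (\<theta> $ 1 + \<theta> $ 2 + \<theta> $ 3) + c * (proj_plane u $ 1 + proj_plane u $ 2 + proj_plane u $ 3)"
      by (simp add: algebra_simps)
    then show ?thesis
      using assms(4) proj_plane_in_plane[of u] by (simp add: mis_plane_def)
  qed
  have "frechet_derivative \<psi> (at (\<theta>, a, t)) (direction i) = 0"
  proof (rule zero_derivative_off_support[OF has_derivative_directional[OF Ck1_has_derivative[OF assms(1)]] assms(2,3)])
    fix c assume "(\<theta>, a, t) + c *\<^sub>R direction i \<notin> K"
    then show "\<psi> ((\<theta>, a, t) + c *\<^sub>R direction i) = 0"
      using supp[OF pl] by (simp add: direction_def)
  qed
  then show "state_grad \<psi> (\<theta>, a, t) \<bullet> i = 0 \<bullet> i"
    unfolding state_grad_inner[OF Ck1_has_derivative[OF assms(1)]] by simp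
qed

lemma subspaceI_lincomb:
  assumes "0 \<in> S" "\<And>u v c. u \<in> S \<Longrightarrow> v \<in> S \<Longrightarrow> u + c *\<^sub>R v \<in> S"
  shows "subspace S"
  unfolding subspace_def
proof (intro conjI ballI allI)
  show "u + v \<in> S" if "u \<in> S" "v \<in> S" for u v
    using assms(2)[OF that, of 1] by simp
  show "c *\<^sub>R u \<in> S" if "u \<in> S" for c u
    using assms(2)[OF assms(1) that, of c] by simp
qed fact

text \<open>The absence of conditions on the boundary encodes the no-flux condition, and the absence
  of conditions at time 0 lets the initial datum appear. Only C^1 is asked because these tests will
  be multiplied by functions of time that are merely C^1.\<close>

definition final_tests :: "(event \<Rightarrow> real) set" where
  "final_tests = {\<phi>. Ck 1 \<phi> \<and> (\<exists>T. \<forall>\<theta> a t. t > T \<longrightarrow> \<phi> (\<theta>, a, t) = 0)}"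

text \<open>The C^1 counterpart of \<open>compact_test\<close>, with the support again prescribed on
  the plane only.\<close>

definition interior_tests :: "(real^2) set \<Rightarrow> (event \<Rightarrow> real) set" where
  "interior_tests D = {\<psi>. Ck 1 \<psi> \<and> (\<exists>K. compact K \<and> K \<subseteq> Omega \<times> D \<times> {0<..} \<and>
     (\<forall>\<theta> a t. \<theta> \<in> mis_plane \<and> (\<theta>, a, t) \<notin> K \<longrightarrow> \<psi> (\<theta>, a, t) = 0))}"

lemma final_tests_lincomb:
  assumes "f \<in> final_tests" "g \<in> final_tests"
  shows "(\<lambda>e. f e + c * g e) \<in> final_tests"
proof -
  obtain T R where "\<forall>\<theta> a t. t > T \<longrightarrow> f (\<theta>, a, t) = 0" "\<forall>\<theta> a t. t > R \<longrightarrow> g (\<theta>, a, t) = 0"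
    using assms by (auto simp: final_tests_def)
  then have "\<forall>\<theta> a t. t > max T R \<longrightarrow> f (\<theta>, a, t) + c * g (\<theta>, a, t) = 0"
    by simp
  then show ?thesis
    using assms Ck1_lincomb(1)[of f g c] unfolding final_tests_def by blast
qed

lemma interior_tests_lincomb:
  assumes "f \<in> interior_tests D" "g \<in> interior_tests D"
  shows "(\<lambda>e. f e + c * g e) \<in> interior_tests D"
proof -
  obtain K where K: "compact K" "K \<subseteq> Omega \<times> D \<times> {0<..}"
    "\<forall>\<theta> a t. \<theta> \<in> mis_plane \<and> (\<theta>, a, t) \<notin> K \<longrightarrow> f (\<theta>, a, t) = 0"
    using assms(1) unfolding interior_tests_def by blast
  obtain L where L: "compact L" "L \<subseteq> Omega \<times> D \<times> {0<..}"
    "\<forall>\<theta> a t. \<theta> \<in> mis_plane \<and> (\<theta>, a, t) \<notin> L \<longrightarrow> g (\<theta>, a, t) = 0"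
    using assms(2) unfolding interior_tests_def by blast
  have "compact (K \<union> L)" "K \<union> L \<subseteq> Omega \<times> D \<times> {0<..}"
    "\<forall>\<theta> a t. \<theta> \<in> mis_plane \<and> (\<theta>, a, t) \<notin> K \<union> L \<longrightarrow> f (\<theta>, a, t) + c * g (\<theta>, a, t) = 0"
    using K L by (simp_all add: compact_Un)
  then show ?thesis
    using assms Ck1_lincomb(1)[of f g c] unfolding interior_tests_def by blast
qed

lemma zero_tests: "(\<lambda>e. 0) \<in> final_tests" "(\<lambda>e. 0) \<in> interior_tests D"
  using Ck1_zero by (auto simp: final_tests_def interior_tests_def intro!: exI[of _ "{}"])

text \<open>The restriction to \<open>Omega\<close> cannot be dropped: off the plane such a test may
  be nonzero at arbitrarily late times. The factor \<open>cut\<close> introduced later removes this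
  discrepancy.\<close>

lemma interior_tests_vanish:
  assumes "\<psi> \<in> interior_tests D"
  shows "\<exists>T. \<forall>\<theta> a t. \<theta> \<in> Omega \<and> t > T \<longrightarrow> \<psi> (\<theta>, a, t) = 0 \<and> state_grad \<psi> (\<theta>, a, t) = 0"
proof -
  have C: "Ck 1 \<psi>" using assms by (simp add: interior_tests_def)
  obtain K where K: "compact K" "K \<subseteq> Omega \<times> D \<times> {0<..}"
    and supp: "\<And>\<theta> a t. \<theta> \<in> mis_plane \<Longrightarrow> (\<theta>, a, t) \<notin> K \<Longrightarrow> \<psi> (\<theta>, a, t) = 0"
    using assms unfolding interior_tests_def by blast
  obtain T where T: "\<forall>e\<in>K. norm e \<le> T"
    using compact_imp_bounded[OF K(1)] by (auto simp: bounded_iff)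
  have out: "(\<theta>, a, t) \<notin> K" if "t > T" for \<theta> a and t :: real
  proof
    assume "(\<theta>, a, t) \<in> K"
    then have "norm (\<theta>, a, t) \<le> T" using T by blast
    moreover have "\<bar>t\<bar> \<le> norm (\<theta>, a, t)"
      using norm_snd_le[of t a] norm_snd_le[of "(a, t)" \<theta>] by (simp only: real_norm_def)
    ultimately show False using that by linarith
  qed
  show ?thesis
  proof (intro exI[of _ T] allI impI conjI)
    fix \<theta> a and t :: real assume *: "\<theta> \<in> Omega \<and> t > T"
    then have \<theta>: "\<theta> \<in> mis_plane" and o: "(\<theta>, a, t) \<notin> K"
      using Omega_subset_plane out by auto
    show "\<psi> (\<theta>, a, t) = 0" by (rule supp[OF \<theta> o])
    show "state_grad \<psi> (\<theta>, a, t) = 0"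
      by (rule state_grad_off_support[OF C compact_imp_closed[OF K(1)] o \<theta> supp])
  qed
qed

section \<open>The Gibbs measure and the fields attached to test functions\<close>

context potential
begin

definition gibbs :: "state measure" where
  "gibbs = density (state_measure D) (\<lambda>z. ennreal (weight z))"

lemma sets_gibbs [measurable_cong]: "sets gibbs = sets (state_measure D)"
  by (simp add: gibbs_def)

lemma space_gibbs: "space gibbs = Omega \<times> D"
  by (simp add: gibbs_def space_state_measure)

lemma finite_state_measure: "finite_measure (state_measure D)"
  by (rule finite_measure_pair_measure[OF finite_domain_measure[OF D_open D_bounded] finite_angle_measure])

lemma weight_measurable: "weight \<in> borel_measurable (state_measure D)"
  by (intro measurable_state_measure borel_measurable_continuous_onI weight_continuous)

text \<open>Two-sided bounds are what allows square integrability to pass between the Gibbs measure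
  and the unweighted one.\<close>

lemma weight_bounds: "\<exists>W c. 0 < c \<and> (\<forall>z\<in>Omega \<times> D. c \<le> weight z \<and> weight z \<le> W)"
proof -
  obtain W where W: "\<forall>z\<in>Omega \<times> D. norm (weight z) \<le> W"
    using continuous_bounded_on[OF weight_continuous bounded_states] by blast
  have "continuous_on UNIV (\<lambda>z. inverse (weight z))"
    using weight_pos by (intro continuous_intros weight_continuous) (metis less_irrefl)
  then obtain C where C: "\<forall>z\<in>Omega \<times> D. norm (inverse (weight z)) \<le> C"
    using continuous_bounded_on bounded_states by blast
  \<comment> \<open>The maximum with 1 keeps the lower bound positive whatever C is.\<close>
  have "inverse (max 1 C) \<le> weight z" if "z \<in> Omega \<times> D" for z
  proof -
    have "\<bar>inverse (weight z)\<bar> \<le> C"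
      using C[THEN bspec, OF that] unfolding real_norm_def .
    then have "inverse (weight z) \<le> max 1 C"
      by linarith
    then have "inverse (max 1 C) \<le> inverse (inverse (weight z))"
      using weight_pos[of z] by (intro le_imp_inverse_le) auto
    then show ?thesis by simp
  qed
  moreover have "weight z \<le> W" if "z \<in> Omega \<times> D" for z
    using W[THEN bspec, OF that] unfolding real_norm_def by linarith
  ultimately show ?thesis
    by (intro exI[of _ W] exI[of _ "inverse (max 1 C)"]) auto
qed

lemma gibbs_integral:
  fixes h :: "state \<Rightarrow> real"
  assumes "h \<in> borel_measurable (state_measure D)"
  shows "integrable gibbs h \<longleftrightarrow> integrable (state_measure D) (\<lambda>z. weight z * h z)"
    and "(LINT z|gibbs. h z) = (LINT z|state_measure D. weight z * h z)"
proof -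
  have "AE z in state_measure D. 0 \<le> weight z"
    using weight_pos by (simp add: less_imp_le)
  note * = assms weight_measurable this
  show "integrable gibbs h \<longleftrightarrow> integrable (state_measure D) (\<lambda>z. weight z * h z)"
    using integrable_density[OF *] by (simp add: gibbs_def)
  show "(LINT z|gibbs. h z) = (LINT z|state_measure D. weight z * h z)"
    using integral_density[OF *] by (simp add: gibbs_def)
qed

lemma finite_gibbs: "finite_measure gibbs"
proof -
  interpret S: finite_measure "state_measure D" by (rule finite_state_measure)
  obtain W where W: "\<forall>z\<in>Omega \<times> D. weight z \<le> W"
    using weight_bounds by blast
  have "integrable (state_measure D) (\<lambda>z. weight z * 1)"
    using W weight_pos weight_measurable
    by (intro S.integrable_const_bound[where B = W]) (auto simp: space_state_measure less_imp_le intro!: AE_I2)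
  then have "integrable gibbs (\<lambda>_. 1 :: real)"
    by (subst gibbs_integral) auto
  then show ?thesis
    by (intro finite_measureI) (auto simp: integrable_iff_bounded)
qed

end

sublocale potential \<subseteq> gibbs: time_cylinder gibbs
  by (simp add: time_cylinder_def finite_gibbs)

context potential
begin

text \<open>Test functions take a nested triple, whereas the time cylinder pairs a state with a
  time.\<close>

definition event :: "state \<times> real \<Rightarrow> event" where
  "event z = (fst (fst z), snd (fst z), snd z)"

text \<open>Test functions are only controlled over \<open>Omega \<times> D\<close>, while bounded fields must vanish for large
  times everywhere.\<close>

definition cut :: "state \<times> real \<Rightarrow> real" where
  "cut z = of_bool (fst z \<in> Omega \<times> D)"

abbreviation bounded_fields :: "(state \<times> real \<Rightarrow> 'b::euclidean_space) set"
  where "bounded_fields \<equiv> gibbs.bounded_fields"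

lemma half_line_id_borel: "(\<lambda>z. snd z) \<in> borel_measurable (state_measure D \<Otimes>\<^sub>M half_line)"
  by (rule measurable_compose[OF measurable_snd measurable_half_line_id])

lemma state_fst_measurable:
  "F \<in> borel_measurable borel \<Longrightarrow> (\<lambda>z. F (fst z)) \<in> borel_measurable (state_measure D \<Otimes>\<^sub>M half_line)"
  by (rule measurable_compose[OF measurable_fst measurable_state_measure])

lemma sets_gibbs_cyl [measurable_cong]: "sets gibbs.cyl = sets (state_measure D \<Otimes>\<^sub>M half_line)"
  by (rule sets_pair_measure_cong[OF sets_gibbs refl])

lemma cut_event_measurable:
  fixes h :: "event \<Rightarrow> 'b::euclidean_space"
  assumes "continuous_on UNIV h"
  shows "(\<lambda>z. h (event z)) \<in> borel_measurable (state_measure D \<Otimes>\<^sub>M half_line)"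
    and "(\<lambda>z. cut z *\<^sub>R h (event z)) \<in> borel_measurable (state_measure D \<Otimes>\<^sub>M half_line)"
proof -
  have 1: "(\<lambda>z::state \<times> real. fst z) \<in> borel_measurable (state_measure D \<Otimes>\<^sub>M half_line)"
    by (rule state_fst_measurable) simp
  have "(\<lambda>z::state \<times> real. (fst z, snd z)) \<in> state_measure D \<Otimes>\<^sub>M half_line \<rightarrow>\<^sub>M borel \<Otimes>\<^sub>M borel"
    by (rule measurable_Pair[OF 1 half_line_id_borel])
  then have 2: "(\<lambda>z::state \<times> real. z) \<in> borel_measurable (state_measure D \<Otimes>\<^sub>M half_line)"
    by (simp add: borel_prod)
  have "continuous_on UNIV (\<lambda>z. h (event z))"
    unfolding event_def by (intro continuous_on_compose2[OF assms] continuous_intros) auto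
  from measurable_compose[OF 2 borel_measurable_continuous_onI[OF this]]
  show m: "(\<lambda>z. h (event z)) \<in> borel_measurable (state_measure D \<Otimes>\<^sub>M half_line)" .
  have "cut z *\<^sub>R h (event z) = h (event z)" if "z \<in> space (state_measure D \<Otimes>\<^sub>M half_line)" for z
    using that by (auto simp: cut_def space_pair_measure[of "state_measure D"] space_state_measure)
  then show "(\<lambda>z. cut z *\<^sub>R h (event z)) \<in> borel_measurable (state_measure D \<Otimes>\<^sub>M half_line)"
    using m by (subst measurable_cong) auto
qed

lemma cut_event_bounded_fields:
  fixes h :: "event \<Rightarrow> 'b::euclidean_space"
  assumes "continuous_on UNIV h" "\<And>\<theta> a t. \<theta> \<in> Omega \<Longrightarrow> t > T \<Longrightarrow> h (\<theta>, a, t) = 0"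
  shows "(\<lambda>z. cut z *\<^sub>R h (event z)) \<in> bounded_fields"
proof -
  have "bounded (Omega \<times> D \<times> {0..T})"
    by (intro bounded_Times bounded_Omega D_bounded bounded_closed_interval)
  then obtain C where C: "\<forall>e\<in>Omega \<times> D \<times> {0..T}. norm (h e) \<le> C"
    using continuous_bounded_on[OF assms(1)] by blast
  show ?thesis
  proof (rule gibbs.bounded_fieldsI[where C = "max 0 C" and T = T])
    show "(\<lambda>z. cut z *\<^sub>R h (event z)) \<in> borel_measurable gibbs.cyl"
      using cut_event_measurable(2)[OF assms(1)] by (simp add: measurable_cong_sets[OF sets_gibbs_cyl refl])
    fix x t assume "x \<in> space gibbs" "0 < (t::real)"
    then show "norm (cut (x, t) *\<^sub>R h (event (x, t))) \<le> max 0 C"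
      using C assms(2)[of "fst x" t "snd x"]
      by (cases "t > T") (auto simp: space_gibbs cut_def event_def le_max_iff_disj)
  next
    fix x and t :: real assume "t > T"
    then show "cut (x, t) *\<^sub>R h (event (x, t)) = 0"
      using assms(2) by (cases x) (auto simp: cut_def event_def)
  qed
qed

lemma bounded_fields_mult_state:
  fixes h :: "state \<times> real \<Rightarrow> real" and E :: "state \<Rightarrow> real"
  assumes h: "h \<in> bounded_fields" and E: "E \<in> borel_measurable borel" "\<forall>z\<in>Omega \<times> D. \<bar>E z\<bar> \<le> C"
  shows "(\<lambda>z. h z * E (fst z)) \<in> bounded_fields"
proof -
  obtain B T where B: "0 \<le> B" "\<And>x t. x \<in> space gibbs \<Longrightarrow> 0 < t \<Longrightarrow> norm (h (x, t)) \<le> B" "\<And>x t. t > T \<Longrightarrow> h (x, t) = 0"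
    using gibbs.bounded_fields_bounds[OF h] by blast
  show ?thesis
  proof (rule gibbs.bounded_fieldsI[where C = "B * C" and T = T])
    have "h \<in> borel_measurable gibbs.cyl"
      by (rule gibbs.bounded_fields_measurable[OF h])
    moreover have "(\<lambda>z. E (fst z)) \<in> borel_measurable gibbs.cyl"
      using state_fst_measurable[OF E(1)] by (simp add: measurable_cong_sets[OF sets_gibbs_cyl refl])
    ultimately show "(\<lambda>z. h z * E (fst z)) \<in> borel_measurable gibbs.cyl"
      by (rule borel_measurable_times)
    show "norm (h (x, t) * E (fst (x, t))) \<le> B * C" if "x \<in> space gibbs" "0 < t" for x t
      using B(2)[OF that] B(1) E(2) that(1) unfolding norm_mult by (intro mult_mono) (auto simp: space_gibbs)
  qed (use B in auto)
qed

definition test_value :: "(event \<Rightarrow> real) \<Rightarrow> state \<times> real \<Rightarrow> real" where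
  "test_value \<phi> z = cut z * \<phi> (event z)"

definition test_rate :: "(event \<Rightarrow> real) \<Rightarrow> state \<times> real \<Rightarrow> real" where
  "test_rate \<phi> z = cut z * frechet_derivative \<phi> (at (event z)) (0, 0, 1)"

definition test_grad :: "(event \<Rightarrow> real) \<Rightarrow> state \<times> real \<Rightarrow> state" where
  "test_grad \<phi> z = cut z *\<^sub>R state_grad \<phi> (event z)"

text \<open>Orthogonality to the pairs \<open>(constraint_div \<Psi>, constraint_flux \<Psi>)\<close> says that the flux component of
  the solution is \<open>\<nabla>f + (f / d) \<nabla>E\<close> in the sense of distributions.\<close>

definition constraint_div :: "(state \<Rightarrow> event \<Rightarrow> real) \<Rightarrow> state \<times> real \<Rightarrow> real" where
  "constraint_div \<Psi> z = (\<Sum>i\<in>Basis. test_grad (\<Psi> i) z \<bullet> i - test_value (\<Psi> i) z * ((Egrad (fst z) \<bullet> i) / d))"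

definition constraint_flux :: "(state \<Rightarrow> event \<Rightarrow> real) \<Rightarrow> state \<times> real \<Rightarrow> state" where
  "constraint_flux \<Psi> z = (\<Sum>i\<in>Basis. test_value (\<Psi> i) z *\<^sub>R i)"

lemma final_tests_fields:
  assumes "\<phi> \<in> final_tests"
  shows "test_value \<phi> \<in> bounded_fields" "test_rate \<phi> \<in> bounded_fields" "test_grad \<phi> \<in> bounded_fields"
proof -
  have C: "Ck 1 \<phi>" using assms by (simp add: final_tests_def)
  obtain T where T: "\<And>\<theta> a t. t > T \<Longrightarrow> \<phi> (\<theta>, a, t) = 0"
    using assms by (auto simp: final_tests_def)
  have D0: "frechet_derivative \<phi> (at (\<theta>, a, t)) v = 0" if "t > T" for \<theta> a t v
  proof (rule zero_derivative_off_support[OF has_derivative_directional[OF Ck1_has_derivative[OF C]], where K = "UNIV \<times> UNIV \<times> {..T}"])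
    show "closed ((UNIV :: (real^3) set) \<times> (UNIV :: (real^2) set) \<times> {..T})"
      by (intro closed_Times closed_UNIV closed_atMost)
    show "(\<theta>, a, t) \<notin> UNIV \<times> UNIV \<times> {..T}" using that by auto
    show "\<phi> ((\<theta>, a, t) + e *\<^sub>R v) = 0" if "(\<theta>, a, t) + e *\<^sub>R v \<notin> UNIV \<times> UNIV \<times> {..T}" for e
      using that T by (cases "(\<theta>, a, t) + e *\<^sub>R v") auto
  qed
  have g0: "state_grad \<phi> (\<theta>, a, t) = 0" if "t > T" for \<theta> a t
    by (rule euclidean_eqI) (simp add: state_grad_inner[OF Ck1_has_derivative[OF C]] D0[OF that])
  show "test_value \<phi> \<in> bounded_fields"
    using cut_event_bounded_fields[OF Ck1_continuous[OF C], of T] T by (simp add: test_value_def[abs_def])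
  show "test_rate \<phi> \<in> bounded_fields"
    using cut_event_bounded_fields[OF Ck1_continuous_derivative[OF C], of T "(0, 0, 1)"] D0
    by (simp add: test_rate_def[abs_def])
  show "test_grad \<phi> \<in> bounded_fields"
    using cut_event_bounded_fields[OF state_grad_continuous[OF C], of T] g0 by (simp add: test_grad_def[abs_def])
qed

lemma interior_tests_fields:
  assumes "\<psi> \<in> interior_tests D"
  shows "test_value \<psi> \<in> bounded_fields" "test_grad \<psi> \<in> bounded_fields"
proof -
  have C: "Ck 1 \<psi>" using assms by (simp add: interior_tests_def)
  obtain T where T: "\<And>\<theta> a t. \<theta> \<in> Omega \<Longrightarrow> t > T \<Longrightarrow> \<psi> (\<theta>, a, t) = 0 \<and> state_grad \<psi> (\<theta>, a, t) = 0"
    using interior_tests_vanish[OF assms] by blast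
  show "test_value \<psi> \<in> bounded_fields"
    using cut_event_bounded_fields[OF Ck1_continuous[OF C], of T] T by (simp add: test_value_def[abs_def])
  show "test_grad \<psi> \<in> bounded_fields"
    using cut_event_bounded_fields[OF state_grad_continuous[OF C], of T] T by (simp add: test_grad_def[abs_def])
qed

lemma bounded_fields_sum:
  assumes "\<And>i. i \<in> I \<Longrightarrow> s i \<in> bounded_fields"
  shows "(\<lambda>z. \<Sum>i\<in>I. s i z) \<in> bounded_fields"
proof -
  have "sum s I \<in> bounded_fields"
    using assms by (rule subspace_sum[OF gibbs.subspace_bounded_fields])
  moreover have "sum s I = (\<lambda>z. \<Sum>i\<in>I. s i z)"
    by (induction I rule: infinite_finite_induct) (auto simp: fun_eq_iff)
  ultimately show ?thesis by simp
qed

lemma bounded_fields_bounded_linear: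
  assumes "s \<in> bounded_fields" "bounded_linear L"
  shows "(\<lambda>z. L (s z)) \<in> bounded_fields"
proof -
  obtain C T where C: "0 \<le> C" "\<And>x t. x \<in> space gibbs \<Longrightarrow> 0 < t \<Longrightarrow> norm (s (x, t)) \<le> C" "\<And>x t. t > T \<Longrightarrow> s (x, t) = 0"
    using gibbs.bounded_fields_bounds[OF assms(1)] by blast
  obtain K where K: "0 < K" "\<And>v. norm (L v) \<le> norm v * K"
    using bounded_linear.pos_bounded[OF assms(2)] by blast
  show ?thesis
  proof (rule gibbs.bounded_fieldsI[where C = "C * K" and T = T])
    show "(\<lambda>z. L (s z)) \<in> borel_measurable gibbs.cyl"
      using gibbs.bounded_fields_measurable[OF assms(1)]
      by (rule measurable_compose) (intro borel_measurable_continuous_onI linear_continuous_on assms(2))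
    show "norm (L (s (x, t))) \<le> C * K" if "x \<in> space gibbs" "0 < t" for x t
      using K(2)[of "s (x, t)"] mult_right_mono[OF C(2)[OF that], of K] K(1) by linarith
    show "L (s (x, t)) = 0" if "t > T" for x t
      using C(3)[OF that] assms(2) by (simp add: linear_simps)
  qed
qed

lemma constraint_fields:
  assumes "\<And>i. i \<in> Basis \<Longrightarrow> \<Psi> i \<in> interior_tests D"
  shows "constraint_div \<Psi> \<in> bounded_fields" "constraint_flux \<Psi> \<in> bounded_fields"
proof -
  obtain C where C: "\<forall>z\<in>Omega \<times> D. norm (Egrad z) \<le> C"
    using Egrad_bounded by blast
  have E: "(\<lambda>z. (Egrad z \<bullet> i) / d) \<in> borel_measurable borel" "\<forall>z\<in>Omega \<times> D. \<bar>(Egrad z \<bullet> i) / d\<bar> \<le> C / d"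
    if "i \<in> Basis" for i
  proof -
    show "(\<lambda>z. (Egrad z \<bullet> i) / d) \<in> borel_measurable borel" by measurable
    show "\<forall>z\<in>Omega \<times> D. \<bar>(Egrad z \<bullet> i) / d\<bar> \<le> C / d"
    proof
      fix z assume "z \<in> Omega \<times> D"
      then have "\<bar>Egrad z \<bullet> i\<bar> \<le> C"
        using C Basis_le_norm[OF that, of "Egrad z"] order_trans by blast
      then show "\<bar>(Egrad z \<bullet> i) / d\<bar> \<le> C / d"
        using d_pos by (simp add: abs_divide divide_right_mono)
    qed
  qed
  have "(\<lambda>z. test_grad (\<Psi> i) z \<bullet> i - test_value (\<Psi> i) z * ((Egrad (fst z) \<bullet> i) / d)) \<in> bounded_fields"
    if i: "i \<in> Basis" for i
  proof -
    have 1: "(\<lambda>z. test_grad (\<Psi> i) z \<bullet> i) \<in> bounded_fields"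
      using interior_tests_fields(2)[OF assms[OF i]] by (rule bounded_fields_bounded_linear) (rule bounded_linear_inner_left)
    have 2: "(\<lambda>z. test_value (\<Psi> i) z * ((Egrad (fst z) \<bullet> i) / d)) \<in> bounded_fields"
      by (rule bounded_fields_mult_state[OF interior_tests_fields(1)[OF assms[OF i]] E[OF i]])
    show ?thesis
      using subspace_diff[OF gibbs.subspace_bounded_fields 1 2] by (simp add: fun_diff_def)
  qed
  then show "constraint_div \<Psi> \<in> bounded_fields"
    unfolding constraint_div_def[abs_def] by (rule bounded_fields_sum)
  have "(\<lambda>z. test_value (\<Psi> i) z *\<^sub>R i) \<in> bounded_fields" if i: "i \<in> Basis" for i
    using interior_tests_fields(1)[OF assms[OF i]] by (rule bounded_fields_bounded_linear) (rule bounded_linear_scaleR_left)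
  then show "constraint_flux \<Psi> \<in> bounded_fields"
    unfolding constraint_flux_def[abs_def] by (rule bounded_fields_sum)
qed

text \<open>After multiplication by the weight the integrand is a sum of directional derivatives of
  weight * \<phi> * \<Psi> i. No boundary term appears because each \<Psi> i has compact support, so
  \<phi> may be any C^1 function. This is the hypothesis \<open>orth\<close> of
  \<open>energy_estimate\<close>.\<close>

lemma constraint_orthogonal:
  assumes "Ck 1 \<phi>" and \<Psi>: "\<And>i. i \<in> Basis \<Longrightarrow> \<Psi> i \<in> interior_tests D"
  shows "(LINT x|gibbs. constraint_div \<Psi> (x, t) * test_value \<phi> (x, t) + constraint_flux \<Psi> (x, t) \<bullet> test_grad \<phi> (x, t)) = 0"
proof -
  have C: "Ck 1 (\<Psi> i)" if "i \<in> Basis" for i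
    using \<Psi>[OF that] by (simp add: interior_tests_def)
  have i: "integrable (state_measure D) (\<lambda>z. weight z * flux_density \<phi> (\<Psi> i) t i z)" if "i \<in> Basis" for i
    by (rule weighted_flux_integrable[OF assms(1) C[OF that]])
  \<comment> \<open>The weighted density is measurable because it is integrable; dividing by the
    positive weight recovers the density itself.\<close>
  have fm: "(\<lambda>z. flux_density \<phi> (\<Psi> i) t i z) \<in> borel_measurable (state_measure D)" if "i \<in> Basis" for i
  proof -
    have "(\<lambda>z. inverse (weight z) * (weight z * flux_density \<phi> (\<Psi> i) t i z)) \<in> borel_measurable (state_measure D)"
      by (rule borel_measurable_times[OF borel_measurable_inverse[OF weight_measurable]
            borel_measurable_integrable[OF i[OF that]]])
    moreover have "inverse (weight z) * (weight z * flux_density \<phi> (\<Psi> i) t i z) = flux_density \<phi> (\<Psi> i) t i z" for z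
      using weight_pos[of z] by simp
    ultimately show ?thesis by simp
  qed
  have "(LINT x|gibbs. constraint_div \<Psi> (x, t) * test_value \<phi> (x, t) + constraint_flux \<Psi> (x, t) \<bullet> test_grad \<phi> (x, t)) =
      (LINT x|gibbs. (\<Sum>i\<in>Basis. flux_density \<phi> (\<Psi> i) t i x))"
  proof (rule Bochner_Integration.integral_cong[OF refl])
    fix x assume "x \<in> space gibbs"
    then have c: "cut (x, t) = 1"
      by (simp add: space_gibbs cut_def)
    show "constraint_div \<Psi> (x, t) * test_value \<phi> (x, t) + constraint_flux \<Psi> (x, t) \<bullet> test_grad \<phi> (x, t) =
        (\<Sum>i\<in>Basis. flux_density \<phi> (\<Psi> i) t i x)"
      unfolding constraint_div_def constraint_flux_def inner_sum_left sum_distrib_right sum.distrib[symmetric]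
      by (intro sum.cong refl)
        (simp add: flux_density_def test_value_def test_grad_def c event_def Let_def algebra_simps inner_commute)
  qed
  also have "\<dots> = (LINT x|state_measure D. (\<Sum>i\<in>Basis. weight x * flux_density \<phi> (\<Psi> i) t i x))"
    using fm by (subst gibbs_integral) (auto simp: sum_distrib_left)
  also have "\<dots> = (\<Sum>i\<in>Basis. (LINT x|state_measure D. weight x * flux_density \<phi> (\<Psi> i) t i x))"
    by (rule Bochner_Integration.integral_sum) (rule i)
  also have "\<dots> = 0"
  proof (rule sum.neutral, rule ballI)
    fix i :: state assume i: "i \<in> Basis"
    obtain K where "compact K" "K \<subseteq> Omega \<times> D \<times> {0<..}"
      "\<forall>\<theta> a t. \<theta> \<in> mis_plane \<and> (\<theta>, a, t) \<notin> K \<longrightarrow> \<Psi> i (\<theta>, a, t) = 0"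
      using \<Psi>[OF i] unfolding interior_tests_def by blast
    then show "(LINT x|state_measure D. weight x * flux_density \<phi> (\<Psi> i) t i x) = 0"
      by (intro weighted_integration_by_parts[OF assms(1) C[OF i], of K]) auto
  qed
  finally show ?thesis .
qed

end


section \<open>Solution of the dual problem and return to the unweighted measure\<close>

context potential
begin

abbreviation evolution_measure :: "(state \<times> real) measure"
  where "evolution_measure \<equiv> state_measure D \<Otimes>\<^sub>M half_line"

lemma gibbs_cyl_density: "gibbs.cyl = density evolution_measure (\<lambda>z. ennreal (weight (fst z)))"
proof -
  have "density (state_measure D) (\<lambda>z. ennreal (weight z)) \<Otimes>\<^sub>M density half_line (\<lambda>_. 1) =
      density evolution_measure (\<lambda>(x, y). ennreal (weight x) * 1)"
  proof (rule pair_measure_density)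
    show "sigma_finite_measure half_line" "sigma_finite_measure (density half_line (\<lambda>_. 1))"
      by (simp_all add: density_1 sigma_finite_half_line)
  qed (use weight_measurable in auto)
  then show ?thesis
    by (simp add: gibbs_def density_1 case_prod_beta')
qed

lemma gibbs_cyl_integral:
  fixes h :: "state \<times> real \<Rightarrow> real"
  assumes "h \<in> borel_measurable evolution_measure"
  shows "integrable gibbs.cyl h \<longleftrightarrow> integrable evolution_measure (\<lambda>z. weight (fst z) * h z)"
    and "(LINT z|gibbs.cyl. h z) = (LINT z|evolution_measure. weight (fst z) * h z)"
proof -
  have "AE z in evolution_measure. 0 \<le> weight (fst z)"
    using weight_pos by (simp add: less_imp_le)
  note * = assms measurable_compose[OF measurable_fst weight_measurable] this
  show "integrable gibbs.cyl h \<longleftrightarrow> integrable evolution_measure (\<lambda>z. weight (fst z) * h z)"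
    using integrable_density[OF *] by (simp add: gibbs_cyl_density)
  show "(LINT z|gibbs.cyl. h z) = (LINT z|evolution_measure. weight (fst z) * h z)"
    using integral_density[OF *] by (simp add: gibbs_cyl_density)
qed

lemma space_evolution: "space evolution_measure = (Omega \<times> D) \<times> {0<..}"
  by (simp add: space_pair_measure[of "state_measure D"] space_state_measure space_restrict_space)

definition scale_flux :: "real \<Rightarrow> real \<Rightarrow> state \<Rightarrow> state" where
  "scale_flux b1 b2 v = (b1 *\<^sub>R fst v, b2 *\<^sub>R snd v)"

lemma scale_flux_linear: "bounded_linear (scale_flux b1 b2)"
  unfolding scale_flux_def[abs_def]
  by (intro bounded_linear_Pair bounded_linear_scaleR_right[THEN bounded_linear_compose] bounded_linear_fst bounded_linear_snd)

lemma scale_flux_coercive: "min b1 b2 * (norm v)\<^sup>2 \<le> scale_flux b1 b2 v \<bullet> v"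
proof -
  have "min b1 b2 * (norm (fst v))\<^sup>2 \<le> b1 * (norm (fst v))\<^sup>2" "min b1 b2 * (norm (snd v))\<^sup>2 \<le> b2 * (norm (snd v))\<^sup>2"
    by (intro mult_right_mono; simp)+
  then show ?thesis
    by (simp add: scale_flux_def inner_prod_def power2_norm_eq_inner distrib_left)
qed

text \<open>One field collects both requirements on the unknown pair: \<Psi> = 0 leaves the weak
  equation, \<phi> = 0 leaves the relation between the density and its flux.\<close>

definition test_field :: "real \<Rightarrow> real \<Rightarrow> (event \<Rightarrow> real) \<Rightarrow> (state \<Rightarrow> event \<Rightarrow> real) \<Rightarrow> state \<times> real \<Rightarrow> real \<times> state" where
  "test_field b1 b2 \<phi> \<Psi> z = (- test_rate \<phi> z + constraint_div \<Psi> z, scale_flux b1 b2 (test_grad \<phi> z) + constraint_flux \<Psi> z)"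

lemma test_value_lincomb: "test_value (\<lambda>e. f e + c * g e) z = test_value f z + c * test_value g z"
  by (simp add: test_value_def algebra_simps)

lemma test_rate_lincomb:
  "Ck 1 f \<Longrightarrow> Ck 1 g \<Longrightarrow> test_rate (\<lambda>e. f e + c * g e) z = test_rate f z + c * test_rate g z"
  by (simp add: test_rate_def Ck1_lincomb(2) algebra_simps del: Ck.simps)

lemma test_grad_lincomb:
  "Ck 1 f \<Longrightarrow> Ck 1 g \<Longrightarrow> test_grad (\<lambda>e. f e + c * g e) z = test_grad f z + c *\<^sub>R test_grad g z"
  by (simp add: test_grad_def state_grad_lincomb scaleR_add_right mult.commute del: Ck.simps)

lemma test_field_lincomb:
  assumes "Ck 1 f" "Ck 1 g" "\<And>i. i \<in> Basis \<Longrightarrow> Ck 1 (F i)" "\<And>i. i \<in> Basis \<Longrightarrow> Ck 1 (G i)"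
  shows "test_field b1 b2 (\<lambda>e. f e + c * g e) (\<lambda>i e. F i e + c * G i e) =
    test_field b1 b2 f F + c *\<^sub>R test_field b1 b2 g G"
proof
  fix z
  interpret L: bounded_linear "scale_flux b1 b2" by (rule scale_flux_linear)
  have 1: "constraint_div (\<lambda>i e. F i e + c * G i e) z = constraint_div F z + c * constraint_div G z"
    unfolding constraint_div_def sum_distrib_left sum.distrib[symmetric]
    using assms(3,4) by (intro sum.cong refl)
      (simp add: test_grad_lincomb test_value_lincomb inner_add_left algebra_simps del: Ck.simps)
  have 2: "constraint_flux (\<lambda>i e. F i e + c * G i e) z = constraint_flux F z + c *\<^sub>R constraint_flux G z"
    unfolding constraint_flux_def scaleR_sum_right sum.distrib[symmetric]
    by (intro sum.cong refl) (simp add: test_value_lincomb scaleR_add_left)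
  show "test_field b1 b2 (\<lambda>e. f e + c * g e) (\<lambda>i e. F i e + c * G i e) z =
      (test_field b1 b2 f F + c *\<^sub>R test_field b1 b2 g G) z"
    unfolding test_field_def 1 2 test_rate_lincomb[OF assms(1,2)] test_grad_lincomb[OF assms(1,2)]
    by (simp add: L.add L.scaleR algebra_simps)
qed

lemma zero_tests_fields:
  "test_field b1 b2 (\<lambda>e. 0) (\<lambda>i e. 0) = 0" "test_value (\<lambda>e. 0) z = 0"
  using test_field_lincomb[of "\<lambda>e. 0" "\<lambda>e. 0" "\<lambda>i e. 0" "\<lambda>i e. 0" b1 b2 "-1"] Ck1_zero
  by (simp_all add: test_value_def del: Ck.simps)

text \<open>The duality is carried out over the Gibbs measure, where the unknown is u = f / weight
  together with its gradient. Multiplying the representing function by the weight makes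
  \<open>fst V\<close> the density f and \<open>snd V\<close> the flux \<nabla>f + (f / d)
  \<nabla>E.\<close>

lemma weak_evolution_exists:
  fixes f0 :: "state \<Rightarrow> real"
  assumes b: "0 < b1" "0 < b2" and f0: "in_L2 (state_measure D) f0"
  obtains V C where "V \<in> borel_measurable evolution_measure"
    and "\<And>T. in_L2 evolution_measure (\<lambda>z. of_bool (snd z \<le> T) *\<^sub>R V z)"
    and "AE t in half_line. in_L2 (state_measure D) (\<lambda>x. fst (V (x, t))) \<and>
      (LINT x|state_measure D. (fst (V (x, t)))\<^sup>2) \<le> C"
    and "\<And>\<phi>. \<phi> \<in> final_tests \<Longrightarrow>
      (LINT z|evolution_measure. scale_flux b1 b2 (state_grad \<phi> (event z)) \<bullet> snd (V z)
         - fst (V z) * frechet_derivative \<phi> (at (event z)) (0, 0, 1)) =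
      (LINT x|state_measure D. f0 x * \<phi> (fst x, snd x, 0))"
    and "\<And>\<psi> i. \<psi> \<in> interior_tests D \<Longrightarrow> i \<in> Basis \<Longrightarrow>
      (LINT z|evolution_measure. fst (V z) * (state_grad \<psi> (event z) \<bullet> i - \<psi> (event z) * ((Egrad (fst z) \<bullet> i) / d))
         + \<psi> (event z) * (snd (V z) \<bullet> i)) = 0"
proof -
  obtain W0 c where W0: "0 < c" "\<forall>z\<in>Omega \<times> D. c \<le> weight z \<and> weight z \<le> W0"
    using weight_bounds by blast
  define W where "W = max 0 W0"
  have W: "0 < c" "\<And>z. z \<in> Omega \<times> D \<Longrightarrow> c \<le> weight z" "\<And>z. z \<in> Omega \<times> D \<Longrightarrow> weight z \<le> W" "0 \<le> W"
    using W0 by (auto simp: W_def le_max_iff_disj)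
  \<comment> \<open>The initial value in the variable f / weight; the lower bound of the weight
    keeps it in L2 of the Gibbs measure.\<close>
  define u0 where "u0 x = f0 x / weight x" for x
  have f0m [measurable]: "f0 \<in> borel_measurable (state_measure D)"
    using f0 by (simp add: in_L2_def)
  note [measurable] = weight_measurable
  have u0m [measurable]: "u0 \<in> borel_measurable (state_measure D)"
    unfolding u0_def[abs_def] by measurable
  have u0: "in_L2 gibbs u0"
    unfolding in_L2_def
  proof
    show "u0 \<in> borel_measurable gibbs"
      using u0m by (simp add: measurable_cong_sets[OF sets_gibbs refl])
    have "integrable (state_measure D) (\<lambda>x. weight x * (norm (u0 x))\<^sup>2)"
    proof (rule Bochner_Integration.integrable_bound)
      show "integrable (state_measure D) (\<lambda>x. (f0 x)\<^sup>2 / c)"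
        using f0 by (simp add: in_L2_def)
      show "AE x in state_measure D. norm (weight x * (norm (u0 x))\<^sup>2) \<le> norm ((f0 x)\<^sup>2 / c)"
      proof (rule AE_I2)
        fix x assume "x \<in> space (state_measure D)"
        then have x: "c \<le> weight x"
          using W(2) by (simp add: space_state_measure)
        have "weight x * (norm (u0 x))\<^sup>2 = (f0 x)\<^sup>2 / weight x"
          using weight_pos[of x] by (simp add: u0_def power_divide power2_eq_square)
        also have "\<dots> \<le> (f0 x)\<^sup>2 / c"
          using x W(1) by (intro divide_left_mono) auto
        finally show "norm (weight x * (norm (u0 x))\<^sup>2) \<le> norm ((f0 x)\<^sup>2 / c)"
          using weight_pos[of x] W(1) by simp
      qed
    qed measurable
    then show "integrable gibbs (\<lambda>x. (norm (u0 x))\<^sup>2)"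
      by (subst gibbs_integral) auto
  qed
  define K where "K = sqrt (LINT x|gibbs. (u0 x)\<^sup>2)"
  define l where "l \<phi> = (LINT x|gibbs. u0 x * test_value \<phi> (x, 0))" for \<phi>
  have initial: "(\<lambda>x. test_value \<phi> (x, 0)) \<in> borel_measurable gibbs \<and>
      (\<exists>B. \<forall>x\<in>space gibbs. \<bar>test_value \<phi> (x, 0)\<bar> \<le> B)" if "Ck 1 \<phi>" for \<phi>
  proof -
    have "continuous_on UNIV (\<lambda>x::state. \<phi> (fst x, snd x, 0))"
      by (intro continuous_on_compose2[OF Ck1_continuous[OF that]] continuous_intros) auto
    note * = measurable_state_measure[OF borel_measurable_continuous_onI[OF this], of D]
      continuous_bounded_on[OF this bounded_states]
    have eq: "test_value \<phi> (x, 0) = \<phi> (fst x, snd x, 0)" if "x \<in> Omega \<times> D" for x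
      using that by (simp add: test_value_def cut_def event_def)
    have "(\<lambda>x. test_value \<phi> (x, 0)) \<in> borel_measurable (state_measure D)"
      using *(1) by (subst measurable_cong[OF eq]) (auto simp: space_state_measure)
    then show ?thesis
      using *(2) eq by (auto simp: measurable_cong_sets[OF sets_gibbs refl] space_gibbs)
  qed
  have initial_L2: "in_L2 gibbs (\<lambda>x. test_value \<phi> (x, 0))" if C: "Ck 1 \<phi>" for \<phi>
  proof -
    obtain B where "\<forall>x\<in>space gibbs. \<bar>test_value \<phi> (x, 0)\<bar> \<le> B"
      using initial[OF C] by blast
    then show ?thesis
      using initial[OF C] by (intro in_L2_bounded[where C = B] finite_gibbs) auto
  qed
  have l_lincomb: "l (\<lambda>e. f e + c * g e) = l f + c * l g" if "Ck 1 f" "Ck 1 g" for f g c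
    using in_L2_inner_integrable[OF u0 initial_L2[OF that(1)]] in_L2_inner_integrable[OF u0 initial_L2[OF that(2)]]
    by (simp add: l_def test_value_lincomb distrib_left mult.left_commute)
  \<comment> \<open>A set of pairs rather than a function of the field: different (\<phi>, \<Psi>)
    may produce the same field, and it is not checked directly that they give the same value
    \<open>l\<close>.\<close>
  define G where "G = {(test_field b1 b2 \<phi> \<Psi>, l \<phi>) | \<phi> \<Psi>. \<phi> \<in> final_tests \<and> (\<forall>i\<in>Basis. \<Psi> i \<in> interior_tests D)}"
  have G: "subspace G"
  proof (rule subspaceI_lincomb)
    have "l (\<lambda>e. 0) = 0"
      by (simp add: l_def zero_tests_fields)
    then show "0 \<in> G"
      unfolding G_def zero_prod_def using zero_tests zero_tests_fields(1)[of b1 b2] by fastforce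
    fix u v c assume "u \<in> G" "v \<in> G"
    then obtain f F g H where u: "u = (test_field b1 b2 f F, l f)" "f \<in> final_tests" "\<forall>i\<in>Basis. F i \<in> interior_tests D"
      and v: "v = (test_field b1 b2 g H, l g)" "g \<in> final_tests" "\<forall>i\<in>Basis. H i \<in> interior_tests D"
      unfolding G_def by blast
    have "u + c *\<^sub>R v = (test_field b1 b2 (\<lambda>e. f e + c * g e) (\<lambda>i e. F i e + c * H i e), l (\<lambda>e. f e + c * g e))"
    proof (subst test_field_lincomb)
      show "u + c *\<^sub>R v = (test_field b1 b2 f F + c *\<^sub>R test_field b1 b2 g H, l (\<lambda>e. f e + c * g e))"
        using u v l_lincomb[of f g c] by (simp add: final_tests_def del: Ck.simps)
    qed (use u v in \<open>auto simp: final_tests_def interior_tests_def simp del: Ck.simps\<close>)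
    moreover have "(\<lambda>e. f e + c * g e) \<in> final_tests"
      using u v by (intro final_tests_lincomb)
    moreover have "\<forall>i\<in>Basis. (\<lambda>e. F i e + c * H i e) \<in> interior_tests D"
      using u v by (intro ballI interior_tests_lincomb) auto
    ultimately show "u + c *\<^sub>R v \<in> G"
      unfolding G_def by blast
  qed
  have estimate: "test_field b1 b2 \<phi> \<Psi> \<in> bounded_fields \<and> l \<phi> \<le>
      2 * K * (LINT t|half_line. gibbs.slice_norm (\<lambda>z. fst (test_field b1 b2 \<phi> \<Psi> z)) t) +
      K * sqrt (1 / (2 * min b1 b2)) * sqrt (LINT z|gibbs.cyl. (norm (snd (test_field b1 b2 \<phi> \<Psi> z)))\<^sup>2)"
    if \<phi>: "\<phi> \<in> final_tests" and \<Psi>: "\<forall>i\<in>Basis. \<Psi> i \<in> interior_tests D" for \<phi> \<Psi>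
  proof
    have C: "Ck 1 \<phi>" using \<phi> by (simp add: final_tests_def)
    note \<phi>f = final_tests_fields[OF \<phi>]
    have \<Psi>f: "constraint_div \<Psi> \<in> bounded_fields" "constraint_flux \<Psi> \<in> bounded_fields"
      using constraint_fields \<Psi> by blast+
    have p1: "(\<lambda>z. - test_rate \<phi> z + constraint_div \<Psi> z) \<in> bounded_fields"
      using subspace_diff[OF gibbs.subspace_bounded_fields \<Psi>f(1) \<phi>f(2)] by (simp add: fun_diff_def)
    have p2: "(\<lambda>z. scale_flux b1 b2 (test_grad \<phi> z) + constraint_flux \<Psi> z) \<in> bounded_fields"
      using subspace_add[OF gibbs.subspace_bounded_fields
          bounded_fields_bounded_linear[OF \<phi>f(3) scale_flux_linear] \<Psi>f(2)] by (simp add: plus_fun_def)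
    have "(\<lambda>z. (- test_rate \<phi> z + constraint_div \<Psi> z, 0) + (0, scale_flux b1 b2 (test_grad \<phi> z) + constraint_flux \<Psi> z)) \<in> bounded_fields"
      using subspace_add[OF gibbs.subspace_bounded_fields
          bounded_fields_bounded_linear[OF p1, of "\<lambda>v. (v, 0::state)"]
          bounded_fields_bounded_linear[OF p2, of "\<lambda>v. (0::real, v)"]]
      by (simp add: plus_fun_def bounded_linear_Pair bounded_linear_ident bounded_linear_zero)
    then show "test_field b1 b2 \<phi> \<Psi> \<in> bounded_fields"
      by (simp add: test_field_def[abs_def])
    obtain B where B: "\<And>x. x \<in> space gibbs \<Longrightarrow> \<bar>test_value \<phi> (x, 0)\<bar> \<le> B"
      using initial[OF C] by blast
    have "l \<phi> \<le> 2 * sqrt (LINT x|gibbs. (u0 x)\<^sup>2) * (LINT t|half_line. gibbs.slice_norm (\<lambda>z. - test_rate \<phi> z + constraint_div \<Psi> z) t) +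
        sqrt (LINT x|gibbs. (u0 x)\<^sup>2) * sqrt (1 / (2 * min b1 b2)) *
        sqrt (LINT z|gibbs.cyl. (norm (scale_flux b1 b2 (test_grad \<phi> z) + constraint_flux \<Psi> z))\<^sup>2)"
      unfolding l_def
    proof (rule gibbs.energy_estimate[where \<kappa> = "test_rate \<phi>" and ?z1.0 = "constraint_div \<Psi>" and ?z2.0 = "constraint_flux \<Psi>"
          and g = "test_grad \<phi>" and b = "scale_flux b1 b2" and K = B])
      show "((\<lambda>t. test_value \<phi> (x, t)) has_real_derivative test_rate \<phi> (x, t)) (at t)" for x t
        using DERIV_cmult[OF partial_derivatives(3)[OF Ck1_has_derivative[OF C, of "(fst x, snd x, t)"]], of "cut (x, t)"]
        by (simp add: test_value_def test_rate_def event_def cut_def)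
      show "continuous_on UNIV (\<lambda>t. test_rate \<phi> (x, t))" for x
        unfolding test_rate_def event_def cut_def fst_conv snd_conv
        by (intro continuous_intros continuous_on_compose2[OF Ck1_continuous_derivative[OF C]]) auto
      show "(LINT x|gibbs. constraint_div \<Psi> (x, t) * test_value \<phi> (x, t) + constraint_flux \<Psi> (x, t) \<bullet> test_grad \<phi> (x, t)) = 0" for t
        using \<Psi> by (intro constraint_orthogonal C) auto
      show "(\<lambda>x. test_value \<phi> (x, 0)) \<in> borel_measurable gibbs"
        using initial[OF C] by blast
    qed (use \<phi>f \<Psi>f p2 B b u0 scale_flux_coercive in auto)
    then show "l \<phi> \<le>
      2 * K * (LINT t|half_line. gibbs.slice_norm (\<lambda>z. fst (test_field b1 b2 \<phi> \<Psi> z)) t) +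
      K * sqrt (1 / (2 * min b1 b2)) * sqrt (LINT z|gibbs.cyl. (norm (snd (test_field b1 b2 \<phi> \<Psi> z)))\<^sup>2)"
      by (simp add: test_field_def K_def)
  qed
  have K0: "0 \<le> K"
    by (simp add: K_def)
  \<comment> \<open>Of the two coefficients in the energy estimate only 2 K, in front of the L1(L2)
    term, reappears in the bound at almost every time.\<close>
  obtain U where U: "U \<in> borel_measurable gibbs.cyl"
    and U_loc: "\<And>T. in_L2 gibbs.cyl (\<lambda>z. of_bool (snd z \<le> T) *\<^sub>R U z)"
    and U_slice: "AE t in half_line. in_L2 gibbs (\<lambda>x. fst (U (x, t))) \<and> (LINT x|gibbs. (fst (U (x, t)))\<^sup>2) \<le> (2 * K)\<^sup>2"
    and U_eq: "\<And>s y. (s, y) \<in> G \<Longrightarrow> (LINT z|gibbs.cyl. U z \<bullet> s z) = y"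
  proof (rule gibbs.mixed_norm_representation[OF G, of "2 * K" "K * sqrt (1 / (2 * min b1 b2))"])
    show "fst ` G \<subseteq> bounded_fields"
      using estimate unfolding G_def by fastforce
    show "0 \<le> 2 * K" "0 \<le> K * sqrt (1 / (2 * min b1 b2))"
      using K0 b by auto
    show "y \<le> 2 * K * (LINT t|half_line. gibbs.slice_norm (\<lambda>z. fst (s z)) t) +
        K * sqrt (1 / (2 * min b1 b2)) * sqrt (LINT z|gibbs.cyl. (norm (snd (s z)))\<^sup>2)"
      if "(s, y) \<in> G" for s y
      using that estimate unfolding G_def by blast
  qed blast
  define V where "V z = weight (fst z) *\<^sub>R U z" for z
  have Um [measurable]: "U \<in> borel_measurable evolution_measure"
    using U by (simp add: measurable_cong_sets[OF sets_gibbs_cyl refl])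
  have wm [measurable]: "(\<lambda>z. weight (fst z)) \<in> borel_measurable evolution_measure"
    by (rule measurable_compose[OF measurable_fst weight_measurable])
  have Vm [measurable]: "V \<in> borel_measurable evolution_measure"
    unfolding V_def[abs_def] by measurable
  have pairing: "(LINT z|evolution_measure. V z \<bullet> s z) = y" if "(s, y) \<in> G" for s y
  proof -
    have "s \<in> bounded_fields"
      using that estimate unfolding G_def by blast
    then have [measurable]: "s \<in> borel_measurable evolution_measure"
      using gibbs.bounded_fields_measurable by (simp add: measurable_cong_sets[OF sets_gibbs_cyl refl])
    show ?thesis
      using U_eq[OF that] by (subst (asm) gibbs_cyl_integral) (auto simp: V_def)
  qed
  have Wz: "weight (fst z) \<le> W" if "z \<in> space evolution_measure" for z
    using W(3) that by (auto simp: space_evolution)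
  show ?thesis
  \<comment> \<open>With u the first component of U, (weight * u)^2 <= W * (weight * u^2), and the
    Gibbs integral of u^2 is at most (2 K)^2.\<close>
  proof (rule that[OF Vm, of "W * (2 * K)\<^sup>2"])
    fix T
    have m: "(\<lambda>z. of_bool (snd z \<le> T) *\<^sub>R V z) \<in> borel_measurable evolution_measure"
    proof -
      note [measurable] = half_line_id_borel
      have "(\<lambda>z. if snd z \<le> T then V z else 0) \<in> borel_measurable evolution_measure" by measurable
      then show ?thesis by (rule back_subst[where P = "\<lambda>f. f \<in> _"]) auto
    qed
    show "in_L2 evolution_measure (\<lambda>z. of_bool (snd z \<le> T) *\<^sub>R V z)"
      unfolding in_L2_def
    proof (intro conjI m)
      have i: "integrable evolution_measure (\<lambda>z. W * (weight (fst z) * (norm (of_bool (snd z \<le> T) *\<^sub>R U z))\<^sup>2))"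
      proof (rule integrable_mult_right)
        have L: "integrable gibbs.cyl (\<lambda>z. (norm (of_bool (snd z \<le> T) *\<^sub>R U z))\<^sup>2)"
          and "(\<lambda>z. of_bool (snd z \<le> T) *\<^sub>R U z) \<in> borel_measurable evolution_measure"
          using U_loc[of T] unfolding in_L2_def measurable_cong_sets[OF sets_gibbs_cyl refl] by blast+
        then have "(\<lambda>z. (norm (of_bool (snd z \<le> T) *\<^sub>R U z))\<^sup>2) \<in> borel_measurable evolution_measure"
          by (intro borel_measurable_power) (rule measurable_compose[OF _ borel_measurable_norm])
        with L show "integrable evolution_measure (\<lambda>z. weight (fst z) * (norm (of_bool (snd z \<le> T) *\<^sub>R U z))\<^sup>2)"
          using gibbs_cyl_integral(1) by blast
      qed
      show "integrable evolution_measure (\<lambda>z. (norm (of_bool (snd z \<le> T) *\<^sub>R V z))\<^sup>2)"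
      proof (rule Bochner_Integration.integrable_bound[OF i])
        show "AE z in evolution_measure. norm ((norm (of_bool (snd z \<le> T) *\<^sub>R V z))\<^sup>2) \<le>
            norm (W * (weight (fst z) * (norm (of_bool (snd z \<le> T) *\<^sub>R U z))\<^sup>2))"
        proof (rule AE_I2)
          fix z assume z: "z \<in> space evolution_measure"
          have "weight (fst z) * (weight (fst z) * (norm (U z))\<^sup>2) \<le> W * (weight (fst z) * (norm (U z))\<^sup>2)"
            using Wz[OF z] weight_pos[of "fst z"] by (intro mult_right_mono) auto
          then show "norm ((norm (of_bool (snd z \<le> T) *\<^sub>R V z))\<^sup>2) \<le>
            norm (W * (weight (fst z) * (norm (of_bool (snd z \<le> T) *\<^sub>R U z))\<^sup>2))"
            using weight_pos[of "fst z"] Wz[OF z]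
            by (cases "snd z \<le> T") (simp_all add: V_def power_mult_distrib power2_eq_square abs_mult mult_ac)
        qed
      qed (use m in measurable)
    qed
  next
    have "AE t in half_line. t \<in> space half_line" by (rule AE_space)
    with U_slice show "AE t in half_line. in_L2 (state_measure D) (\<lambda>x. fst (V (x, t))) \<and>
      (LINT x|state_measure D. (fst (V (x, t)))\<^sup>2) \<le> W * (2 * K)\<^sup>2"
    proof eventually_elim
      case (elim t)
      then have t: "0 < t" and L: "in_L2 gibbs (\<lambda>x. fst (U (x, t)))" "(LINT x|gibbs. (fst (U (x, t)))\<^sup>2) \<le> (2 * K)\<^sup>2"
        by (auto simp: space_restrict_space)
      have Utm [measurable]: "(\<lambda>x. fst (U (x, t))) \<in> borel_measurable (state_measure D)"
        using L(1) by (simp add: in_L2_def measurable_cong_sets[OF sets_gibbs refl])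
      have i: "integrable (state_measure D) (\<lambda>x. weight x * (fst (U (x, t)))\<^sup>2)"
        using L(1) gibbs_integral(1)[of "\<lambda>x. (fst (U (x, t)))\<^sup>2"] by (simp add: in_L2_def)
      have le: "(fst (V (x, t)))\<^sup>2 \<le> W * (weight x * (fst (U (x, t)))\<^sup>2)" if "x \<in> space (state_measure D)" for x
      proof -
        have "weight x * (weight x * (fst (U (x, t)))\<^sup>2) \<le> W * (weight x * (fst (U (x, t)))\<^sup>2)"
          using W(3)[of x] that weight_pos[of x] by (intro mult_right_mono) (auto simp: space_state_measure)
        then show ?thesis
          by (simp add: V_def power_mult_distrib power2_eq_square mult.assoc mult.left_commute)
      qed
      have i2: "integrable (state_measure D) (\<lambda>x. (fst (V (x, t)))\<^sup>2)"
      proof (rule Bochner_Integration.integrable_bound)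
        show "integrable (state_measure D) (\<lambda>x. W * (weight x * (fst (U (x, t)))\<^sup>2))"
          using i by simp
        show "(\<lambda>x. (fst (V (x, t)))\<^sup>2) \<in> borel_measurable (state_measure D)"
          unfolding V_def fst_scaleR fst_conv by measurable
        show "AE x in state_measure D. norm ((fst (V (x, t)))\<^sup>2) \<le> norm (W * (weight x * (fst (U (x, t)))\<^sup>2))"
          using le by (intro AE_I2) fastforce
      qed
      have "(LINT x|state_measure D. (fst (V (x, t)))\<^sup>2) \<le> (LINT x|state_measure D. W * (weight x * (fst (U (x, t)))\<^sup>2))"
        using i i2 le by (intro integral_mono) auto
      also have "\<dots> = W * (LINT x|gibbs. (fst (U (x, t)))\<^sup>2)"
        using gibbs_integral(2)[of "\<lambda>x. (fst (U (x, t)))\<^sup>2"] by simp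
      also have "\<dots> \<le> W * (2 * K)\<^sup>2"
        using L(2) W(4) by (rule mult_left_mono)
      finally show ?case
        using i2 by (auto simp: in_L2_def V_def)
    qed
  next
    fix \<phi> assume \<phi>: "\<phi> \<in> final_tests"
    then have C: "Ck 1 \<phi>" by (simp add: final_tests_def)
    have "(test_field b1 b2 \<phi> (\<lambda>i e. 0), l \<phi>) \<in> G"
      using \<phi> zero_tests(2) unfolding G_def by blast
    then have "(LINT z|evolution_measure. V z \<bullet> test_field b1 b2 \<phi> (\<lambda>i e. 0) z) = l \<phi>"
      by (rule pairing)
    moreover have "(LINT z|evolution_measure. V z \<bullet> test_field b1 b2 \<phi> (\<lambda>i e. 0) z) =
        (LINT z|evolution_measure. scale_flux b1 b2 (state_grad \<phi> (event z)) \<bullet> snd (V z)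
         - fst (V z) * frechet_derivative \<phi> (at (event z)) (0, 0, 1))"
    proof (rule Bochner_Integration.integral_cong[OF refl])
      fix z assume "z \<in> space evolution_measure"
      then have "cut z = 1" by (auto simp: space_evolution cut_def)
      then show "V z \<bullet> test_field b1 b2 \<phi> (\<lambda>i e. 0) z =
          scale_flux b1 b2 (state_grad \<phi> (event z)) \<bullet> snd (V z) - fst (V z) * frechet_derivative \<phi> (at (event z)) (0, 0, 1)"
        by (simp add: test_field_def inner_prod_def[of "V z"] test_rate_def test_grad_def constraint_div_def
            constraint_flux_def test_value_def state_grad_zero inner_commute)
    qed
    moreover have "l \<phi> = (LINT x|state_measure D. f0 x * \<phi> (fst x, snd x, 0))"
    proof -
      have "(\<lambda>x. u0 x * test_value \<phi> (x, 0)) \<in> borel_measurable (state_measure D)"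
        using initial[OF C] u0m by (intro borel_measurable_times) (simp_all add: measurable_cong_sets[OF sets_gibbs refl])
      from gibbs_integral(2)[OF this]
      have "l \<phi> = (LINT x|state_measure D. weight x * (u0 x * test_value \<phi> (x, 0)))"
        by (simp add: l_def)
      also have "\<dots> = (LINT x|state_measure D. f0 x * \<phi> (fst x, snd x, 0))"
        by (rule Bochner_Integration.integral_cong[OF refl])
          (use less_imp_neq[OF weight_pos, symmetric] in
            \<open>auto simp: u0_def test_value_def cut_def event_def space_state_measure\<close>)
      finally show ?thesis .
    qed
    ultimately show "(LINT z|evolution_measure. scale_flux b1 b2 (state_grad \<phi> (event z)) \<bullet> snd (V z)
         - fst (V z) * frechet_derivative \<phi> (at (event z)) (0, 0, 1)) =
      (LINT x|state_measure D. f0 x * \<phi> (fst x, snd x, 0))"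
      by simp
  next
    fix \<psi> and i :: state assume \<psi>: "\<psi> \<in> interior_tests D" and i: "i \<in> Basis"
    \<comment> \<open>A family with a single nonzero member isolates the i-th component of the
      relation between f and the flux.\<close>
    define \<Psi> where "\<Psi> = (\<lambda>j e. if j = i then \<psi> e else 0)"
    have "\<Psi> j \<in> interior_tests D" for j
      using \<psi> zero_tests(2) by (cases "j = i") (auto simp: \<Psi>_def)
    then have "(test_field b1 b2 (\<lambda>e. 0) \<Psi>, l (\<lambda>e. 0)) \<in> G"
      using zero_tests(1) unfolding G_def by blast
    then have "(LINT z|evolution_measure. V z \<bullet> test_field b1 b2 (\<lambda>e. 0) \<Psi> z) = l (\<lambda>e. 0)"
      by (rule pairing)
    also have "\<dots> = 0"
      by (simp add: l_def zero_tests_fields)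
    finally have "(LINT z|evolution_measure. V z \<bullet> test_field b1 b2 (\<lambda>e. 0) \<Psi> z) = 0" .
    moreover have "(LINT z|evolution_measure. V z \<bullet> test_field b1 b2 (\<lambda>e. 0) \<Psi> z) =
        (LINT z|evolution_measure. fst (V z) * (state_grad \<psi> (event z) \<bullet> i - \<psi> (event z) * ((Egrad (fst z) \<bullet> i) / d))
         + \<psi> (event z) * (snd (V z) \<bullet> i))"
    proof (rule Bochner_Integration.integral_cong[OF refl])
      fix z assume "z \<in> space evolution_measure"
      then have c: "cut z = 1" by (auto simp: space_evolution cut_def)
      have \<Psi>z: "\<Psi> j = (if j = i then \<psi> else (\<lambda>e. 0))" for j
        by (auto simp: \<Psi>_def)
      have 1: "constraint_div \<Psi> z = state_grad \<psi> (event z) \<bullet> i - \<psi> (event z) * ((Egrad (fst z) \<bullet> i) / d)"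
      proof -
        have "constraint_div \<Psi> z = (\<Sum>j\<in>Basis. if j = i then state_grad \<psi> (event z) \<bullet> i - \<psi> (event z) * ((Egrad (fst z) \<bullet> i) / d) else 0)"
          unfolding constraint_div_def \<Psi>z test_grad_def test_value_def c
          by (intro sum.cong refl) (auto simp: state_grad_zero)
        then show ?thesis using i by (simp add: sum.delta)
      qed
      have 2: "constraint_flux \<Psi> z = \<psi> (event z) *\<^sub>R i"
      proof -
        have "constraint_flux \<Psi> z = (\<Sum>j\<in>Basis. if j = i then \<psi> (event z) *\<^sub>R i else 0)"
          unfolding constraint_flux_def \<Psi>z test_value_def c
          by (intro sum.cong refl) auto
        then show ?thesis using i by (simp add: sum.delta)
      qed
      have 3: "test_rate (\<lambda>e. 0) z = 0" "test_grad (\<lambda>e. 0) z = 0"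
        by (simp_all add: test_rate_def test_grad_def state_grad_zero)
      have "scale_flux b1 b2 0 = 0" by (simp add: scale_flux_def zero_prod_def)
      then show "V z \<bullet> test_field b1 b2 (\<lambda>e. 0) \<Psi> z =
          fst (V z) * (state_grad \<psi> (event z) \<bullet> i - \<psi> (event z) * ((Egrad (fst z) \<bullet> i) / d)) + \<psi> (event z) * (snd (V z) \<bullet> i)"
        unfolding test_field_def 1 2 3 by (simp add: inner_prod_def[of "V z"])
    qed
    ultimately show "(LINT z|evolution_measure. fst (V z) * (state_grad \<psi> (event z) \<bullet> i - \<psi> (event z) * ((Egrad (fst z) \<bullet> i) / d))
         + \<psi> (event z) * (snd (V z) \<bullet> i)) = 0"
      by simp
  qed
qed

end


section \<open>The du Bois-Reymond lemma in time\<close>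

text \<open>The positive and the negative part of h are densities of two measures that agree, and
  are finite, on all half-lines. So the measures coincide, and densities are unique almost
  everywhere.\<close>

lemma AE_zero_if_interval_integrals_zero:
  fixes h :: "real \<Rightarrow> real"
  assumes int: "integrable lborel h" and zero: "\<And>a. (LINT t|lborel. indicator {a<..} t * h t) = 0"
  shows "AE t in lborel. h t = 0"
proof -
  have [measurable]: "h \<in> borel_measurable borel"
    using int by auto
  have ip: "integrable lborel (\<lambda>t. indicator {a<..} t * max 0 (h t))" "integrable lborel (\<lambda>t. indicator {a<..} t * max 0 (- h t))" for a
    by (rule Bochner_Integration.integrable_bound[OF int]; auto simp: indicator_def)+
  have nn: "(\<integral>\<^sup>+t. ennreal (max 0 (g t)) * indicator A t \<partial>lborel) = ennreal (LINT t|lborel. indicator A t * max 0 (g t))"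
    if "integrable lborel (\<lambda>t. indicator A t * max 0 (g t))" for g :: "real \<Rightarrow> real" and A
  proof -
    have "(\<integral>\<^sup>+t. ennreal (max 0 (g t)) * indicator A t \<partial>lborel) = (\<integral>\<^sup>+t. ennreal (indicator A t * max 0 (g t)) \<partial>lborel)"
      by (intro nn_integral_cong) (auto simp: indicator_def)
    also have "\<dots> = ennreal (LINT t|lborel. indicator A t * max 0 (g t))"
      by (rule nn_integral_eq_integral[OF that]) auto
    finally show ?thesis .
  qed
  note eq = nn[OF ip(1)] nn[OF ip(2)]
  have "density lborel (\<lambda>t. ennreal (max 0 (h t))) = density lborel (\<lambda>t. ennreal (max 0 (- h t)))"
  proof (rule measure_eqI_lessThan)
    fix a
    have "(LINT t|lborel. indicator {a<..} t * max 0 (h t)) - (LINT t|lborel. indicator {a<..} t * max 0 (- h t)) =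
        (LINT t|lborel. indicator {a<..} t * max 0 (h t) - indicator {a<..} t * max 0 (- h t))"
      by (rule Bochner_Integration.integral_diff[OF ip, symmetric])
    also have "\<dots> = (LINT t|lborel. indicator {a<..} t * h t)"
      by (intro Bochner_Integration.integral_cong) (auto simp: indicator_def)
    finally have "(LINT t|lborel. indicator {a<..} t * max 0 (h t)) = (LINT t|lborel. indicator {a<..} t * max 0 (- h t))"
      using zero[of a] by simp
    then show "emeasure (density lborel (\<lambda>t. ennreal (max 0 (h t)))) {a<..} = emeasure (density lborel (\<lambda>t. ennreal (max 0 (- h t)))) {a<..}"
      by (simp add: emeasure_density eq)
    show "emeasure (density lborel (\<lambda>t. ennreal (max 0 (h t)))) {a<..} < \<infinity>"
      by (simp add: emeasure_density eq)
  qed auto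
  then have "AE t in lborel. ennreal (max 0 (h t)) = ennreal (max 0 (- h t))"
    by (intro sigma_finite_measure.density_unique[OF lborel.sigma_finite_measure_axioms]) auto
  then show ?thesis
    by eventually_elim (auto simp: max_def split: if_splits)
qed

lemma continuous_antiderivative:
  fixes k :: "real \<Rightarrow> real"
  assumes k: "continuous_on UNIV k" and z: "\<And>t. t \<le> 0 \<Longrightarrow> k t = 0"
  shows "\<exists>F. \<forall>t. (F has_real_derivative k t) (at t)"
proof (intro exI allI)
  fix t
  \<comment> \<open>The base point -1 leaves room to the left of 0, so the derivative at 0 is
    two-sided; to the left of 0 the integral is zero.\<close>
  show "((\<lambda>t. integral {-1..t} k) has_real_derivative k t) (at t)"
  proof (cases "t < 0")
    case True
    have "((\<lambda>_. 0) has_real_derivative k t) (at t)"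
      using True z by simp
    then show ?thesis
    proof (rule has_field_derivative_transform_within_open[of _ _ _ "{..<0}"])
      fix s :: real assume "s \<in> {..<0}"
      then have "integral {-1..s} k = integral {-1..s} (\<lambda>_. 0)"
        by (intro Henstock_Kurzweil_Integration.integral_cong z) auto
      then show "0 = integral {-1..s} k" by simp
    qed (use True in auto)
  next
    case False
    have "((\<lambda>t. integral {-1..t} k) has_real_derivative k t) (at t within {-1..t+1})"
      by (rule integral_has_real_derivative) (use False k in \<open>auto intro: continuous_on_subset\<close>)
    then show ?thesis
      by (subst (asm) at_within_interior) (use False in auto)
  qed
qed

lemma measurable_half_line: "h \<in> borel_measurable borel \<Longrightarrow> h \<in> borel_measurable half_line"
  by (rule measurable_restrict_space1) simp

lemma integrable_half_line_cutoff:
  fixes G k :: "real \<Rightarrow> real"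
  assumes G: "integrable half_line (\<lambda>t. of_bool (t \<le> T) * G t)" and k: "k \<in> borel_measurable half_line"
    and bd: "\<And>t. \<bar>k t\<bar> \<le> B" and z: "\<And>t. t > T \<Longrightarrow> k t = 0"
  shows "integrable half_line (\<lambda>t. k t * G t)"
proof -
  have eq: "k t * G t = k t * (of_bool (t \<le> T) * G t)" for t
    using z[of t] by (cases "t > T") auto
  have "integrable half_line (\<lambda>t. B * (of_bool (t \<le> T) * G t))"
    using G by simp
  then show ?thesis
    unfolding eq
  proof (rule Bochner_Integration.integrable_bound)
    show "(\<lambda>t. k t * (of_bool (t \<le> T) * G t)) \<in> borel_measurable half_line"
      using k borel_measurable_integrable[OF G] by (rule borel_measurable_times)
    have "\<bar>k t\<bar> \<le> \<bar>B\<bar>" for t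
      using bd[of t] by linarith
    then show "AE t in half_line. norm (k t * (of_bool (t \<le> T) * G t)) \<le> norm (B * (of_bool (t \<le> T) * G t))"
      by (intro AE_I2) (auto simp: abs_mult intro!: mult_right_mono)
  qed
qed

lemma of_bool_le_borel: "(\<lambda>t. of_bool (t \<le> T) :: real) \<in> borel_measurable half_line"
  "(\<lambda>t. of_bool (t < T) :: real) \<in> borel_measurable half_line"
proof -
  have "(\<lambda>t. indicator {..T} t :: real) \<in> borel_measurable borel" "(\<lambda>t. indicator {..<T} t :: real) \<in> borel_measurable borel"
    by simp_all
  then show "(\<lambda>t. of_bool (t \<le> T) :: real) \<in> borel_measurable half_line" "(\<lambda>t. of_bool (t < T) :: real) \<in> borel_measurable half_line"
    by (auto intro!: measurable_half_line simp: indicator_def of_bool_def)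
qed

text \<open>The test condition says in weak form that G has derivative K and initial value c. For a
  continuous k with bounded support in the half-line, the choice \<xi>(t) = integral of k over (t,
  \<infinity>) and Fubini on the triangle t < s convert the condition into orthogonality of k to H =
  G - c - J, where J is the antiderivative of K vanishing at 0.\<close>

lemma du_bois_reymond:
  fixes G K :: "real \<Rightarrow> real"
  assumes G: "\<And>T. integrable half_line (\<lambda>t. of_bool (t \<le> T) * G t)"
    and K: "\<And>T. integrable half_line (\<lambda>t. of_bool (t \<le> T) * K t)"
    and meas: "G \<in> borel_measurable half_line" "K \<in> borel_measurable half_line"
    and test: "\<And>\<xi> \<xi>' T. (\<And>t. (\<xi> has_real_derivative \<xi>' t) (at t)) \<Longrightarrow> continuous_on UNIV \<xi>' \<Longrightarrow>
      (\<And>t. t > T \<Longrightarrow> \<xi> t = 0) \<Longrightarrow>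
      (LINT t|half_line. \<xi> t * K t) + (LINT t|half_line. \<xi>' t * G t) = - (c * \<xi> 0)"
  shows "AE T in half_line. G T = c + (LINT t|half_line. of_bool (t < T) * K t)"
proof -
  interpret H: sigma_finite_measure half_line by (rule sigma_finite_half_line)
  interpret HH: pair_sigma_finite half_line half_line ..
  note [measurable] = meas
  define J where "J s = (LINT t|half_line. of_bool (t < s) * K t)" for s
  have prod_meas: "(\<lambda>z. of_bool (fst z < snd z) :: real) \<in> borel_measurable (half_line \<Otimes>\<^sub>M half_line)"
  proof -
    have "(\<lambda>z. fst z) \<in> borel_measurable (half_line \<Otimes>\<^sub>M half_line)" "(\<lambda>z. snd z) \<in> borel_measurable (half_line \<Otimes>\<^sub>M half_line)"
      by (rule measurable_compose[OF measurable_fst measurable_half_line_id] measurable_compose[OF measurable_snd measurable_half_line_id])+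
    then have "{z \<in> space (half_line \<Otimes>\<^sub>M half_line). fst z < snd z} \<in> sets (half_line \<Otimes>\<^sub>M half_line)"
      by (rule borel_measurable_less)
    then have "(\<lambda>z. if fst z < snd z then 1 else 0 :: real) \<in> borel_measurable (half_line \<Otimes>\<^sub>M half_line)"
      by (intro measurable_If) auto
    then show ?thesis by (simp add: of_bool_def)
  qed
  have J_meas [measurable]: "J \<in> borel_measurable half_line"
  proof -
    have "(\<lambda>z. of_bool (fst z < snd z) * K (fst z)) \<in> borel_measurable (half_line \<Otimes>\<^sub>M half_line)"
      by (rule borel_measurable_times[OF prod_meas measurable_compose[OF measurable_fst meas(2)]])
    from measurable_pair_swap[OF this]
    have "(\<lambda>(s, t). of_bool (t < s) * K t) \<in> borel_measurable (half_line \<Otimes>\<^sub>M half_line)"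
      by simp
    then show ?thesis
      unfolding J_def[abs_def] by (rule H.borel_measurable_lebesgue_integral)
  qed
  have K_cut: "integrable half_line (\<lambda>t. of_bool (t < s) * K t)" for s
    by (rule integrable_half_line_cutoff[OF K[of s], where B = 1]) (auto intro: of_bool_le_borel)
  have J_bd: "\<bar>J s\<bar> \<le> (LINT t|half_line. \<bar>of_bool (t \<le> N) * K t\<bar>)" if "s \<le> N" for s N
  proof -
    have "\<bar>J s\<bar> \<le> (LINT t|half_line. \<bar>of_bool (t < s) * K t\<bar>)"
      unfolding J_def using integral_norm_bound[of half_line] by force
    also have "\<dots> \<le> (LINT t|half_line. \<bar>of_bool (t \<le> N) * K t\<bar>)"
      using that K_cut[of s] K[of N] by (intro integral_mono) auto
    finally show ?thesis .
  qed
  define H where "H s = G s - c - J s" for s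
  have H_int: "integrable half_line (\<lambda>s. of_bool (s \<le> N) * H s)" for N
  proof -
    have "integrable half_line (\<lambda>s. of_bool (s \<le> N) * (c + J s))"
    proof (rule integrable_half_line_bounded[where C = "\<bar>c\<bar> + (LINT t|half_line. \<bar>of_bool (t \<le> N) * K t\<bar>)" and T = N])
      show "(\<lambda>s. of_bool (s \<le> N) * (c + J s)) \<in> borel_measurable half_line"
        by (intro borel_measurable_times borel_measurable_add J_meas of_bool_le_borel) auto
      show "norm (of_bool (s \<le> N) * (c + J s)) \<le> \<bar>c\<bar> + (LINT t|half_line. \<bar>of_bool (t \<le> N) * K t\<bar>)" for s
        using J_bd[of s N] by (cases "s \<le> N") (auto intro: order_trans[OF abs_triangle_ineq])
    qed auto
    then have "integrable half_line (\<lambda>s. of_bool (s \<le> N) * G s - of_bool (s \<le> N) * (c + J s))"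
      by (intro Bochner_Integration.integrable_diff G)
    then show ?thesis by (simp add: H_def algebra_simps)
  qed
  have A: "(LINT s|half_line. k s * H s) = 0"
    if k: "continuous_on UNIV k" "\<And>s. s \<le> 0 \<Longrightarrow> k s = 0" "\<And>s. s > N \<Longrightarrow> k s = 0" "\<And>s. \<bar>k s\<bar> \<le> B" for k N B
  proof -
    obtain F where F: "\<And>t. (F has_real_derivative k t) (at t)"
      using continuous_antiderivative[OF k(1,2)] by blast
    \<comment> \<open>The constant is the value of F beyond the support of k, so that \<xi> vanishes
      for late times and has derivative -k.\<close>
    define \<xi> where "\<xi> t = F (max 0 N + 1) - F t" for t
    have \<xi>: "(\<xi> has_real_derivative - k t) (at t)" for t
      unfolding \<xi>_def[abs_def] by (rule derivative_eq_intros F refl)+ simp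
    have \<xi>0: "\<xi> t = 0" if tN: "t > max 0 N + 1" for t
    proof -
      obtain z where z: "z > max 0 N + 1" "F t - F (max 0 N + 1) = (t - (max 0 N + 1)) * k z"
        using MVT2[OF tN, of F k] F by blast
      then have "k z = 0" by (intro k(3)) auto
      then show ?thesis using z by (simp add: \<xi>_def)
    qed
    have \<xi>_eq: "(LINT s|half_line. of_bool (t < s) * k s) = \<xi> t" if "0 \<le> t" for t
      using half_line_integral_derivative[OF \<xi> _ \<xi>0 that] k(1) by (simp add: continuous_on_minus)
    have km [measurable]: "k \<in> borel_measurable half_line"
      by (rule measurable_half_line[OF borel_measurable_continuous_onI[OF k(1)]])
    have B0: "0 \<le> B" using k(4)[of 0] by linarith
    have kint: "integrable half_line (\<lambda>s. k s)"
      by (rule integrable_half_line_bounded[where C = B and T = N]) (use k(3,4) in auto)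
    have kG: "integrable half_line (\<lambda>s. k s * G s)"
      by (rule integrable_half_line_cutoff[OF G km k(4) k(3)])
    have kJ: "integrable half_line (\<lambda>s. k s * J s)"
    proof (rule integrable_half_line_bounded[where C = "B * (LINT t|half_line. \<bar>of_bool (t \<le> N) * K t\<bar>)" and T = N])
      show "norm (k s * J s) \<le> B * (LINT t|half_line. \<bar>of_bool (t \<le> N) * K t\<bar>)" for s
        using k(3)[of s] k(4)[of s] J_bd[of s N] B0
        by (cases "s \<le> N") (auto simp: abs_mult intro!: mult_mono)
    qed (use k(3) in auto)
    define h where "h t s = of_bool (t < s) * k s * K t" for t s
    have hm: "case_prod h \<in> borel_measurable (half_line \<Otimes>\<^sub>M half_line)"
    proof -
      have "(\<lambda>z. of_bool (fst z < snd z) * k (snd z) * K (fst z)) \<in> borel_measurable (half_line \<Otimes>\<^sub>M half_line)"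
        by (intro borel_measurable_times prod_meas measurable_compose[OF measurable_fst meas(2)] measurable_compose[OF measurable_snd km])
      then show ?thesis by (simp add: h_def case_prod_beta')
    qed
    have h_slice: "integrable half_line (\<lambda>s. h t s)" for t
    proof (rule integrable_half_line_bounded[where C = "B * \<bar>K t\<bar>" and T = N])
      have "(\<lambda>s. of_bool (t < s) :: real) \<in> borel_measurable borel"
        using borel_measurable_indicator[of "{t<..}" borel] by (simp add: indicator_def of_bool_def)
      then show "h t \<in> borel_measurable half_line"
        unfolding h_def by (intro borel_measurable_times km measurable_half_line) auto
      show "norm (h t s) \<le> B * \<bar>K t\<bar>" for s
        using k(4)[of s] B0 by (auto simp: h_def abs_mult intro: mult_right_mono)
    qed (use k(3) in \<open>auto simp: h_def\<close>)
    have hi: "integrable (half_line \<Otimes>\<^sub>M half_line) (case_prod h)"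
    proof (rule HH.Fubini_integrable[OF hm])
      have kabs: "integrable half_line (\<lambda>s. \<bar>k s\<bar>)" using kint by simp
      have "integrable half_line (\<lambda>t. (LINT s|half_line. \<bar>k s\<bar>) * \<bar>of_bool (t \<le> N) * K t\<bar>)"
        using K[of N] by simp
      then show "integrable half_line (\<lambda>t. LINT s|half_line. norm (case_prod h (t, s)))"
      proof (rule Bochner_Integration.integrable_bound)
        have "(\<lambda>z. norm (case_prod h z)) \<in> borel_measurable (half_line \<Otimes>\<^sub>M half_line)"
          by (rule measurable_compose[OF hm borel_measurable_norm])
        then show "(\<lambda>t. LINT s|half_line. norm (case_prod h (t, s))) \<in> borel_measurable half_line"
          using H.borel_measurable_lebesgue_integral[of "\<lambda>t s. norm (h t s)" half_line] by (simp add: case_prod_beta')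
        show "AE t in half_line. norm (LINT s|half_line. norm (case_prod h (t, s))) \<le>
            norm ((LINT s|half_line. \<bar>k s\<bar>) * \<bar>of_bool (t \<le> N) * K t\<bar>)"
        proof (rule AE_I2)
          fix t
          have "(LINT s|half_line. norm (case_prod h (t, s))) \<le> (LINT s|half_line. \<bar>k s\<bar> * \<bar>of_bool (t \<le> N) * K t\<bar>)"
          proof (rule integral_mono)
            show "integrable half_line (\<lambda>s. norm (case_prod h (t, s)))"
              using h_slice[of t] by simp
            show "integrable half_line (\<lambda>s. \<bar>k s\<bar> * \<bar>of_bool (t \<le> N) * K t\<bar>)"
              using kabs by simp
            \<comment> \<open>h is nonzero only for t < s <= N, so K is needed only up to time
              N.\<close>
            show "norm (case_prod h (t, s)) \<le> \<bar>k s\<bar> * \<bar>of_bool (t \<le> N) * K t\<bar>" for s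
              using k(3)[of s] by (cases "s > N") (auto simp: h_def abs_mult)
          qed
          also have "\<dots> = (LINT s|half_line. \<bar>k s\<bar>) * \<bar>of_bool (t \<le> N) * K t\<bar>" by simp
          finally show "norm (LINT s|half_line. norm (case_prod h (t, s))) \<le>
              norm ((LINT s|half_line. \<bar>k s\<bar>) * \<bar>of_bool (t \<le> N) * K t\<bar>)"
            by (simp add: abs_mult)
        qed
      qed
      show "AE t in half_line. integrable half_line (\<lambda>s. case_prod h (t, s))"
        using h_slice by simp
    qed
    have "(LINT t|half_line. \<xi> t * K t) = (LINT t|half_line. LINT s|half_line. h t s)"
    proof (rule Bochner_Integration.integral_cong[OF refl])
      fix t assume "t \<in> space half_line"
      then have "0 \<le> t" by (simp add: space_restrict_space)
      from \<xi>_eq[OF this] show "\<xi> t * K t = (LINT s|half_line. h t s)"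
        by (simp add: h_def)
    qed
    also have "\<dots> = (LINT s|half_line. LINT t|half_line. h t s)"
      by (rule HH.Fubini_integral[OF hi, symmetric])
    also have "\<dots> = (LINT s|half_line. k s * J s)"
    proof (rule Bochner_Integration.integral_cong[OF refl])
      fix s
      have "(LINT t|half_line. h t s) = (LINT t|half_line. k s * (of_bool (t < s) * K t))"
        by (simp add: h_def mult.assoc mult.left_commute)
      then show "(LINT t|half_line. h t s) = k s * J s"
        by (simp add: J_def)
    qed
    finally have 1: "(LINT t|half_line. \<xi> t * K t) = (LINT s|half_line. k s * J s)" .
    have 2: "\<xi> 0 = (LINT s|half_line. k s)"
      unfolding \<xi>_eq[OF order_refl, symmetric]
      by (intro Bochner_Integration.integral_cong) (auto simp: space_restrict_space)
    have "(LINT t|half_line. \<xi> t * K t) + (LINT t|half_line. - k t * G t) = - (c * \<xi> 0)"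
      by (rule test[OF \<xi> _ \<xi>0]) (intro continuous_on_minus k(1))
    then have "(LINT s|half_line. k s * J s) - (LINT s|half_line. k s * G s) + c * (LINT s|half_line. k s) = 0"
      unfolding 1 2 by simp
    moreover have "(LINT s|half_line. k s * H s) = (LINT s|half_line. k s * G s) - c * (LINT s|half_line. k s) - (LINT s|half_line. k s * J s)"
      using kG kJ kint by (simp add: H_def right_diff_distrib mult.commute[of _ c])
    ultimately show ?thesis by simp
  qed
  have B: "(LINT s|half_line. of_bool (a < s \<and> s < b) * H s) = 0" if "0 \<le> a" for a b
  proof -
    \<comment> \<open>Continuous trapezoids converging pointwise to the indicator of (a, b), since
      so far only continuous k have been tested; they are dominated by the indicator of s <=
      b.\<close>
    define k where "k n s = max 0 (min 1 (real n * min (s - a) (b - s)))" for n s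
    have "(\<lambda>n. LINT s|half_line. k n s * H s) \<longlonglongrightarrow> (LINT s|half_line. of_bool (a < s \<and> s < b) * H s)"
    proof (rule integral_dominated_convergence[where w = "\<lambda>s. \<bar>of_bool (s \<le> b) * H s\<bar>"])
      have Hm: "H \<in> borel_measurable half_line"
        unfolding H_def[abs_def] by measurable
      have "(\<lambda>s. indicator {a<..<b} s :: real) \<in> borel_measurable borel" by simp
      then have "(\<lambda>s. of_bool (a < s \<and> s < b) :: real) \<in> borel_measurable half_line"
        by (auto intro!: measurable_half_line simp: indicator_def of_bool_def)
      then show "(\<lambda>s. of_bool (a < s \<and> s < b) * H s) \<in> borel_measurable half_line"
        using Hm by (rule borel_measurable_times)
      have "continuous_on UNIV (k n)" for n
        unfolding k_def by (intro continuous_intros)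
      then show "(\<lambda>s. k n s * H s) \<in> borel_measurable half_line" for n
        by (rule borel_measurable_times[OF measurable_half_line[OF borel_measurable_continuous_onI] Hm])
      show "integrable half_line (\<lambda>s. \<bar>of_bool (s \<le> b) * H s\<bar>)"
        using H_int[of b] by simp
      show "AE s in half_line. (\<lambda>n. k n s * H s) \<longlonglongrightarrow> of_bool (a < s \<and> s < b) * H s"
      proof (intro AE_I2 tendsto_mult tendsto_const tendsto_eventually)
        fix s
        show "eventually (\<lambda>n. k n s = of_bool (a < s \<and> s < b)) sequentially"
        proof (cases "a < s \<and> s < b")
          case True
          define e where "e = min (s - a) (b - s)"
          have "0 < e" using True by (simp add: e_def)
          then obtain n0 where n0: "1 < real n0 * e"
            using reals_Archimedean3 by blast
          have "k n s = 1" if "n \<ge> n0" for n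
          proof -
            have "real n0 * e \<le> real n * e"
              using that \<open>0 < e\<close> by (intro mult_right_mono) auto
            then show ?thesis using n0 by (simp add: k_def flip: e_def)
          qed
          then show ?thesis using True by (auto simp: eventually_sequentially)
        next
          case False
          then have "real n * min (s - a) (b - s) \<le> 0" for n
            by (intro mult_nonneg_nonpos) auto
          then have "k n s = 0" for n
            unfolding k_def by (metis max.absorb1 min.coboundedI2)
          then show ?thesis using False by simp
        qed
      qed
      have kb: "\<bar>k n s\<bar> \<le> 1" "s > b \<Longrightarrow> k n s = 0" for n s
      proof -
        show "\<bar>k n s\<bar> \<le> 1" by (auto simp: k_def)
        assume "s > b"
        then have "real n * min (s - a) (b - s) \<le> 0"
          by (intro mult_nonneg_nonpos) auto
        then show "k n s = 0"
          unfolding k_def by (metis max.absorb1 min.coboundedI2)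
      qed
      show "AE s in half_line. norm (k n s * H s) \<le> \<bar>of_bool (s \<le> b) * H s\<bar>" for n
      proof (rule AE_I2)
        fix s
        show "norm (k n s * H s) \<le> \<bar>of_bool (s \<le> b) * H s\<bar>"
          using kb(2)[of s n] mult_right_mono[OF kb(1)[of n s], of "\<bar>H s\<bar>"]
          by (cases "s \<le> b") (auto simp: abs_mult)
      qed
    qed
    moreover have "(LINT s|half_line. k n s * H s) = 0" for n
    proof (rule A[where N = b and B = 1])
      show "continuous_on UNIV (k n)"
        unfolding k_def by (intro continuous_intros)
      have *: "k n s = 0" if "s \<le> a \<or> s > b" for s
      proof -
        have "real n * min (s - a) (b - s) \<le> 0"
          using that by (intro mult_nonneg_nonpos) auto
        then show ?thesis
          unfolding k_def by (metis max.absorb1 min.coboundedI2)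
      qed
      show "k n s = 0" if "s \<le> 0" for s using * that \<open>0 \<le> a\<close> by auto
      show "k n s = 0" if "s > b" for s using * that by auto
      show "\<bar>k n s\<bar> \<le> 1" for s by (auto simp: k_def)
    qed
    ultimately have "(\<lambda>n::nat. 0) \<longlonglongrightarrow> (LINT s|half_line. of_bool (a < s \<and> s < b) * H s)"
      by simp
    then show ?thesis
      using LIMSEQ_unique tendsto_const by blast
  qed
  \<comment> \<open>Integrability of H is known only up to finite times, so the conclusion is drawn
    on each (0, N) and the null sets are united.\<close>
  have "AE t in half_line. t < real N \<longrightarrow> H t = 0" for N
  proof -
    define h where "h t = indicator {0<..} t *\<^sub>R (of_bool (t < real N) * H t)" for t
    have "integrable half_line (\<lambda>t. of_bool (t < real N) * H t)"
      by (rule integrable_half_line_cutoff[OF H_int[of "real N"], where B = 1]) (auto intro: of_bool_le_borel)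
    then have hint: "integrable lborel h"
      unfolding h_def[abs_def] by (subst (asm) integrable_restrict_space) auto
    have "(LINT t|lborel. indicator {a<..} t * h t) = 0" for a
    proof -
      have "(LINT t|lborel. indicator {a<..} t * h t) = (LINT t|lborel. indicator {0<..} t *\<^sub>R (of_bool (max 0 a < t \<and> t < real N) * H t))"
        by (intro Bochner_Integration.integral_cong) (auto simp: h_def indicator_def)
      also have "\<dots> = (LINT t|half_line. of_bool (max 0 a < t \<and> t < real N) * H t)"
        by (rule integral_restrict_space[symmetric]) simp
      also have "\<dots> = 0" by (rule B) simp
      finally show ?thesis .
    qed
    then have "AE t in lborel. h t = 0"
      by (rule AE_zero_if_interval_integrals_zero[OF hint])
    then have "AE t in lborel. t \<in> {0<..} \<longrightarrow> t < real N \<longrightarrow> H t = 0"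
      by eventually_elim (auto simp: h_def)
    then show ?thesis
      by (subst AE_restrict_space_iff) auto
  qed
  then have "AE t in half_line. \<forall>N. t < real N \<longrightarrow> H t = 0"
    unfolding AE_all_countable by blast
  then show ?thesis
  proof eventually_elim
    case (elim t)
    then have "H t = 0" using reals_Archimedean2[of t] by blast
    then show ?case by (simp add: H_def J_def)
  qed
qed


section \<open>Completed measures and Lebesgue measure in time\<close>

text \<open>Weak solutions are defined with completed measures, whereas the construction lives on
  the uncompleted products. Integrands agree with product-measurable ones only almost everywhere:
  the drift in \<open>a\<close> is unspecified at the points x j, and the initial datum is replaced
  by a representative.\<close>

lemma completion_measurable_AE:
  fixes f g :: "'a \<Rightarrow> 'b::euclidean_space"
  assumes g: "g \<in> borel_measurable M" and AE: "AE x in M. f x = g x"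
  shows "f \<in> borel_measurable (completion M)"
proof (rule measurableI)
  fix A :: "'b set" assume A: "A \<in> sets borel"
  have gA: "g -` A \<inter> space M \<in> sets (completion M)"
    using measurable_sets[OF g A] by simp
  have "AE x in completion M. (x \<in> g -` A \<inter> space M) = (x \<in> f -` A \<inter> space M)"
    using AE_completion[OF AE] by eventually_elim simp
  from completion.in_sets_AE[OF this gA]
  show "f -` A \<inter> space (completion M) \<in> sets (completion M)" by simp
qed simp

lemma completion_integral_AE:
  fixes f g :: "'a \<Rightarrow> 'b::euclidean_space"
  assumes g: "g \<in> borel_measurable M" and AE: "AE x in M. f x = g x"
  shows "(LINT x|completion M. f x) = (LINT x|M. g x)"
proof -
  have "(LINT x|completion M. f x) = (LINT x|completion M. g x)"
    using completion_measurable_AE[OF assms] measurable_completion[OF g] AE_completion[OF AE]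
    by (rule integral_cong_AE)
  then show ?thesis using integral_completion[OF g] by simp
qed

lemma in_L2_completion: "in_L2 M g \<Longrightarrow> in_L2 (completion M) g"
  by (auto simp: in_L2_def integrable_completion measurable_completion)

lemma L2_norm_completion:
  "g \<in> borel_measurable M \<Longrightarrow> L2_norm (completion M) g = sqrt (LINT x|M. (norm (g x))\<^sup>2)"
  by (simp add: L2_norm_def integral_completion)

lemma AE_lebesgue_on_half_line:
  assumes "AE t in half_line. P t" "I \<in> sets borel" "I \<subseteq> {0<..}"
  shows "AE t in lebesgue_on I. P t"
proof -
  have "AE t in lborel. t \<in> {0<..} \<longrightarrow> P t"
    using assms(1) by (subst (asm) AE_restrict_space_iff) auto
  then have "AE t in lebesgue. t \<in> {0<..} \<longrightarrow> P t"
    by (rule AE_completion)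
  then have "AE t in lebesgue. t \<in> I \<longrightarrow> P t"
    by eventually_elim (use assms(3) in auto)
  then show ?thesis
    using assms(2) by (subst AE_restrict_space_iff) auto
qed

lemma lebesgue_on_integral:
  fixes h :: "real \<Rightarrow> real"
  assumes h: "h \<in> borel_measurable half_line"
  shows "integrable (lebesgue_on {0<..<T}) h \<longleftrightarrow> integrable half_line (\<lambda>t. of_bool (t < T) * h t)"
    and "(LINT t|lebesgue_on {0<..<T}. h t) = (LINT t|half_line. of_bool (t < T) * h t)"
proof -
  have eq: "indicator {0<..<T} t *\<^sub>R h t = indicator {0<..} t *\<^sub>R (of_bool (t < T) * h t)" for t
    by (auto simp: indicator_def)
  have "(\<lambda>t. of_bool (t < T) * h t) \<in> borel_measurable half_line"
    by (rule borel_measurable_times[OF of_bool_le_borel(2) h])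
  then have m: "(\<lambda>t. indicator {0<..<T} t *\<^sub>R h t) \<in> borel_measurable lborel"
    unfolding eq by (subst (asm) borel_measurable_restrict_space_iff) auto
  show "integrable (lebesgue_on {0<..<T}) h \<longleftrightarrow> integrable half_line (\<lambda>t. of_bool (t < T) * h t)"
  proof -
    have "integrable (lebesgue_on {0<..<T}) h \<longleftrightarrow> integrable lebesgue (\<lambda>t. indicator {0<..<T} t *\<^sub>R h t)"
      by (rule integrable_restrict_space) simp
    also have "\<dots> \<longleftrightarrow> integrable lborel (\<lambda>t. indicator {0<..<T} t *\<^sub>R h t)"
      by (rule integrable_completion[OF m])
    also have "\<dots> \<longleftrightarrow> integrable half_line (\<lambda>t. of_bool (t < T) * h t)"
      unfolding eq by (rule integrable_restrict_space[symmetric]) simp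
    finally show ?thesis .
  qed
  show "(LINT t|lebesgue_on {0<..<T}. h t) = (LINT t|half_line. of_bool (t < T) * h t)"
  proof -
    have "(LINT t|lebesgue_on {0<..<T}. h t) = (LINT t|lebesgue. indicator {0<..<T} t *\<^sub>R h t)"
      by (rule integral_restrict_space) simp
    also have "\<dots> = (LINT t|lborel. indicator {0<..<T} t *\<^sub>R h t)"
      by (rule integral_completion[OF m])
    also have "\<dots> = (LINT t|half_line. of_bool (t < T) * h t)"
      unfolding eq by (rule integral_restrict_space[symmetric]) simp
    finally show ?thesis .
  qed
qed

lemma integrable_componentwise:
  fixes f :: "'a \<Rightarrow> 'b::euclidean_space"
  assumes "\<And>i. i \<in> Basis \<Longrightarrow> integrable M (\<lambda>x. f x \<bullet> i)"
  shows "integrable M f"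
proof -
  have "integrable M (\<lambda>x. \<Sum>i\<in>Basis. (f x \<bullet> i) *\<^sub>R i)"
    using assms by (intro Bochner_Integration.integrable_sum integrable_scaleR_left) auto
  then show ?thesis by (simp add: euclidean_representation)
qed

section \<open>Regrouping of the variables and comparison of the drifts with
  \<open>Egrad\<close>\<close>

context potential
begin

abbreviation event_measure :: "real set \<Rightarrow> event measure"
  where "event_measure I \<equiv> angle_measure \<Otimes>\<^sub>M (restrict_space lborel D \<Otimes>\<^sub>M restrict_space lborel I)"

lemma phase_measure_eq: "phase_measure D = completion (state_measure D)"
  by (simp add: phase_measure_def)

lemma cylinder_measure_eq: "cylinder_measure D I = completion (event_measure I)"
  by (simp add: cylinder_measure_def)

lemma regroup_measurable:
  assumes "I \<subseteq> {0<..}"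
  shows "(\<lambda>(\<theta>, a, t). ((\<theta>, a), t)) \<in> event_measure I \<rightarrow>\<^sub>M evolution_measure"
proof -
  have I: "(\<lambda>t. t) \<in> restrict_space lborel I \<rightarrow>\<^sub>M half_line"
    using assms by (intro measurable_restrict_space2) (auto simp: space_restrict_space intro: measurable_restrict_space1)
  have "(\<lambda>e. ((fst e, fst (snd e)), snd (snd e))) \<in> event_measure I \<rightarrow>\<^sub>M evolution_measure"
    by (intro measurable_Pair measurable_fst measurable_compose[OF measurable_snd measurable_fst]
        measurable_compose[OF measurable_compose[OF measurable_snd measurable_snd] I])
  then show ?thesis by (simp add: case_prod_beta')
qed

lemma event_measurable: "event \<in> evolution_measure \<rightarrow>\<^sub>M event_measure {0<..}"
  unfolding event_def[abs_def]
  by (intro measurable_Pair measurable_snd measurable_compose[OF measurable_fst measurable_fst]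
      measurable_compose[OF measurable_fst measurable_snd])

sublocale DM: finite_measure "restrict_space lborel D" by (rule finite_domain_measure[OF D_open D_bounded])
sublocale SM: finite_measure "state_measure D" by (rule finite_state_measure)
sublocale DT: pair_sigma_finite "restrict_space lborel D" half_line ..
sublocale ST: pair_sigma_finite "state_measure D" half_line ..

text \<open>Associativity of the product measure, by Tonelli's theorem applied to indicator
  functions.\<close>

lemma event_measure_distr: "event_measure {0<..} = distr evolution_measure (event_measure {0<..}) event"
proof (rule measure_eqI)
  fix X assume X: "X \<in> sets (event_measure {0<..})"
  have ind: "(\<lambda>e. indicator X e :: ennreal) \<in> borel_measurable (event_measure {0<..})"
    using X by simp
  have ind2: "(\<lambda>z. indicator X (event z) :: ennreal) \<in> borel_measurable evolution_measure"
    by (rule measurable_compose[OF event_measurable ind])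
  have "emeasure (event_measure {0<..}) X = (\<integral>\<^sup>+e. indicator X e \<partial>event_measure {0<..})"
    using X by simp
  also have "\<dots> = (\<integral>\<^sup>+\<theta>. \<integral>\<^sup>+p. indicator X (\<theta>, p) \<partial>(restrict_space lborel D \<Otimes>\<^sub>M half_line) \<partial>angle_measure)"
    by (rule sigma_finite_measure.nn_integral_fst[OF DT.sigma_finite_measure_axioms ind, symmetric])
  also have "\<dots> = (\<integral>\<^sup>+\<theta>. \<integral>\<^sup>+a. \<integral>\<^sup>+t. indicator X (\<theta>, a, t) \<partial>half_line \<partial>restrict_space lborel D \<partial>angle_measure)"
  proof (rule nn_integral_cong)
    fix \<theta> assume "\<theta> \<in> space angle_measure"
    then have "(\<lambda>p. indicator X (\<theta>, p) :: ennreal) \<in> borel_measurable (restrict_space lborel D \<Otimes>\<^sub>M half_line)"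
      by (rule measurable_compose[OF measurable_Pair1' ind])
    then show "(\<integral>\<^sup>+p. indicator X (\<theta>, p) \<partial>(restrict_space lborel D \<Otimes>\<^sub>M half_line)) =
        (\<integral>\<^sup>+a. \<integral>\<^sup>+t. indicator X (\<theta>, a, t) \<partial>half_line \<partial>restrict_space lborel D)"
      by (rule gibbs.time.nn_integral_fst[symmetric])
  qed
  also have "\<dots> = (\<integral>\<^sup>+x. \<integral>\<^sup>+t. indicator X (event (x, t)) \<partial>half_line \<partial>state_measure D)"
  proof -
    have "(\<lambda>x. \<integral>\<^sup>+t. indicator X (event (x, t)) \<partial>half_line) \<in> borel_measurable (state_measure D)"
      by (rule gibbs.time.borel_measurable_nn_integral_fst[OF ind2])
    from DM.nn_integral_fst[OF this] show ?thesis by (simp add: event_def)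
  qed
  also have "\<dots> = (\<integral>\<^sup>+z. indicator X (event z) \<partial>evolution_measure)"
    by (rule gibbs.time.nn_integral_fst[OF ind2])
  also have "\<dots> = (\<integral>\<^sup>+e. indicator X e \<partial>distr evolution_measure (event_measure {0<..}) event)"
    by (subst nn_integral_distr[OF event_measurable]) (use ind in simp_all)
  also have "\<dots> = emeasure (distr evolution_measure (event_measure {0<..}) event) X"
    using X by simp
  finally show "emeasure (event_measure {0<..}) X = emeasure (distr evolution_measure (event_measure {0<..}) event) X" .
qed simp

lemma cylinder_measurable:
  fixes h :: "state \<times> real \<Rightarrow> 'b::euclidean_space"
  assumes "h \<in> borel_measurable evolution_measure" "I \<subseteq> {0<..}"
  shows "(\<lambda>(\<theta>, a, t). h ((\<theta>, a), t)) \<in> borel_measurable (cylinder_measure D I)"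
proof -
  have "(\<lambda>e. h ((\<lambda>(\<theta>, a, t). ((\<theta>, a), t)) e)) \<in> borel_measurable (event_measure I)"
    by (rule measurable_compose[OF regroup_measurable[OF assms(2)] assms(1)])
  then have "(\<lambda>(\<theta>, a, t). h ((\<theta>, a), t)) \<in> borel_measurable (event_measure I)"
    by (simp add: case_prod_beta')
  then show ?thesis
    unfolding cylinder_measure_eq by (rule measurable_completion)
qed

lemma cylinder_integral:
  fixes h :: "state \<times> real \<Rightarrow> 'b::euclidean_space"
  assumes h: "h \<in> borel_measurable evolution_measure"
  shows "(LINT (\<theta>, a, t)|cylinder_measure D {0<..}. h ((\<theta>, a), t)) = (LINT z|evolution_measure. h z)"
proof -
  have m: "(\<lambda>(\<theta>, a, t). h ((\<theta>, a), t)) \<in> borel_measurable (event_measure {0<..})"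
    using measurable_compose[OF regroup_measurable[OF order_refl] h] by (simp add: case_prod_beta')
  have "(LINT (\<theta>, a, t)|cylinder_measure D {0<..}. h ((\<theta>, a), t)) = (LINT (\<theta>, a, t)|event_measure {0<..}. h ((\<theta>, a), t))"
    unfolding cylinder_measure_eq by (rule integral_completion[OF m])
  also have "\<dots> = (LINT (\<theta>, a, t)|distr evolution_measure (event_measure {0<..}) event. h ((\<theta>, a), t))"
    using event_measure_distr by simp
  also have "\<dots> = (LINT z|evolution_measure. h z)"
    by (subst integral_distr[OF event_measurable m]) (simp add: event_def case_prod_beta')
  finally show ?thesis .
qed

lemma in_L2_L2I:
  fixes q :: "state \<times> real \<Rightarrow> 'b::euclidean_space"
  assumes q: "q \<in> borel_measurable evolution_measure"
    and loc: "in_L2 evolution_measure (\<lambda>z. of_bool (snd z \<le> T) *\<^sub>R q z)"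
  shows "in_L2_L2 {0<..<T} D (\<lambda>\<theta> a t. q ((\<theta>, a), t))"
  unfolding in_L2_L2_def
proof (intro conjI)
  show "(\<lambda>(\<theta>, a, t). q ((\<theta>, a), t)) \<in> borel_measurable (cylinder_measure D {0<..<T})"
    by (rule cylinder_measurable[OF q]) auto
  define n where "n z = (norm (of_bool (snd z \<le> T) *\<^sub>R q z))\<^sup>2" for z
  have n: "integrable evolution_measure n"
    using loc by (simp add: in_L2_def n_def[abs_def])
  have nq: "n (x, t) = (norm (q (x, t)))\<^sup>2" if "t < T" for x t
    using that by (simp add: n_def)
  have slice: "(\<lambda>x. q (x, t)) \<in> borel_measurable (state_measure D)" if "0 < t" for t
    by (rule measurable_compose[OF measurable_Pair2' q]) (use that in \<open>simp add: space_restrict_space\<close>)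
  have pe: "(\<lambda>(\<theta>, a). q ((\<theta>, a), t)) = (\<lambda>x. q (x, t))" for t
    by auto
  have "AE t in half_line. integrable (state_measure D) (\<lambda>x. n (x, t))"
    using ST.AE_integrable_snd[of "\<lambda>x t. n (x, t)"] n by simp
  then have "AE t in lebesgue_on {0<..<T}. integrable (state_measure D) (\<lambda>x. n (x, t))"
    by (rule AE_lebesgue_on_half_line) auto
  moreover have "AE t in lebesgue_on {0<..<T}. t \<in> space (lebesgue_on {0<..<T})"
    by (rule AE_space)
  ultimately show "AE t in lebesgue_on {0<..<T}. in_L2 (phase_measure D) (\<lambda>(\<theta>, a). q ((\<theta>, a), t))"
  proof eventually_elim
    case (elim t)
    then have t: "0 < t" "t < T" by (auto simp: space_restrict_space)
    have "in_L2 (state_measure D) (\<lambda>x. q (x, t))"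
      using elim slice[OF t(1)] by (simp add: in_L2_def nq[OF t(2)])
    then show ?case
      unfolding pe phase_measure_eq by (rule in_L2_completion)
  qed
  define N where "N t = (LINT x|state_measure D. n (x, t))" for t
  have N: "integrable half_line N"
    using ST.integrable_snd[of "\<lambda>x t. n (x, t)"] n by (simp add: N_def[abs_def])
  have "integrable half_line (\<lambda>t. of_bool (t < T) * N t)"
  proof (rule Bochner_Integration.integrable_bound[OF N])
    show "(\<lambda>t. of_bool (t < T) * N t) \<in> borel_measurable half_line"
      by (rule borel_measurable_times[OF of_bool_le_borel(2) borel_measurable_integrable[OF N]])
  qed auto
  then have "integrable (lebesgue_on {0<..<T}) N"
    using lebesgue_on_integral(1)[OF borel_measurable_integrable[OF N]] by blast
  moreover have "(L2_norm (phase_measure D) (\<lambda>(\<theta>, a). q ((\<theta>, a), t)))\<^sup>2 = N t"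
    if "t \<in> space (lebesgue_on {0<..<T})" for t
  proof -
    have t: "0 < t" "t < T" using that by (auto simp: space_restrict_space)
    show ?thesis
      unfolding pe phase_measure_eq by (simp add: L2_norm_completion[OF slice[OF t(1)]] N_def nq[OF t(2)])
  qed
  ultimately show "integrable (lebesgue_on {0<..<T}) (\<lambda>t. (L2_norm (phase_measure D) (\<lambda>(\<theta>, a). q ((\<theta>, a), t)))\<^sup>2)"
    by (subst Bochner_Integration.integrable_cong[OF refl]) auto
qed

text \<open>At these points \<open>v_a\<close> is unspecified; elsewhere it is a multiple of
  \<open>snd (Egrad (\<theta>, a))\<close>.\<close>

lemma AE_off_points: "AE z in state_measure D. snd z \<notin> range x"
proof (rule AE_I')
  have "range x \<inter> D \<in> null_sets lborel"
    by (rule finite_imp_null_set_lborel) simp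
  then have "emeasure lborel (range x \<inter> D) = 0" "range x \<inter> D \<in> sets lborel"
    by auto
  then have "range x \<inter> D \<in> sets (restrict_space lborel D)" "emeasure (restrict_space lborel D) (range x \<inter> D) = 0"
    using D_open by (auto simp: sets_restrict_space emeasure_restrict_space)
  moreover have "Omega \<in> sets angle_measure"
    using sets.top[of angle_measure] by (simp add: space_restrict_space plane_measure_def)
  ultimately show "Omega \<times> (range x \<inter> D) \<in> null_sets (state_measure D)"
    by (auto simp: null_sets_def DM.emeasure_pair_measure_Times)
qed (auto simp: space_state_measure)

lemma v_a_eq:
  assumes "a \<notin> range x"
  shows "v_a \<eta> \<sigma> x \<theta> a = - \<eta> *\<^sub>R snd (Egrad (\<theta>, a))"
proof -
  have "grad (energy \<sigma> x \<theta>) a \<bullet> u = snd (Egrad (\<theta>, a)) \<bullet> u" for u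
    using grad_inner[OF energy_a_derivative[OF assms]] by (simp add: Egrad_def)
  then have "grad (energy \<sigma> x \<theta>) a = snd (Egrad (\<theta>, a))"
    using vector_eq_rdot by blast
  then show ?thesis by (simp add: v_a_def)
qed

lemma v_theta_eq: "v_theta \<gamma> \<sigma> x \<theta> a = - (3 * \<gamma>) *\<^sub>R fst (Egrad (\<theta>, a))"
  by (simp add: v_theta_def Egrad_def)

end

section \<open>Time slices of the solution, the identity at almost every end time, and the weak
  gradient\<close>

locale local_field = potential +
  fixes V :: "state \<times> real \<Rightarrow> real \<times> state"
  assumes V_meas: "V \<in> borel_measurable evolution_measure"
    and V_loc: "\<And>T. in_L2 evolution_measure (\<lambda>z. of_bool (snd z \<le> T) *\<^sub>R V z)"
begin

lemma pairing_integrable: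
  assumes s: "s \<in> bounded_fields"
  shows "integrable evolution_measure (\<lambda>z. V z \<bullet> s z)"
proof -
  obtain C T where CT: "0 \<le> C" "\<And>x t. x \<in> space gibbs \<Longrightarrow> 0 < t \<Longrightarrow> norm (s (x, t)) \<le> C" "\<And>x t. t > T \<Longrightarrow> s (x, t) = 0"
    using gibbs.bounded_fields_bounds[OF s] by blast
  have sm: "s \<in> borel_measurable evolution_measure"
    using gibbs.bounded_fields_measurable[OF s] by (simp add: measurable_cong_sets[OF sets_gibbs_cyl refl])
  interpret S: time_cylinder "state_measure D" ..
  have "s \<in> S.bounded_fields"
    by (rule S.bounded_fieldsI[where C = C and T = T]) (use sm CT in \<open>auto simp: space_gibbs space_state_measure\<close>)
  then have "in_L2 evolution_measure s"
    by (rule S.bounded_fields_in_L2)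
  then have "integrable evolution_measure (\<lambda>z. (of_bool (snd z \<le> T) *\<^sub>R V z) \<bullet> s z)"
    by (rule in_L2_inner_integrable[OF V_loc])
  moreover have "(of_bool (snd z \<le> T) *\<^sub>R V z) \<bullet> s z = V z \<bullet> s z" for z
    using CT(3)[of "snd z" "fst z"] by (cases "snd z \<le> T") auto
  ultimately show ?thesis by (simp only:)
qed

text \<open>As a function of time this is the only form in which the field enters the du
  Bois-Reymond lemma; fixing \<open>h\<close> reduces the evolution to a scalar one.\<close>

definition pairing :: "(event \<Rightarrow> real \<times> state) \<Rightarrow> real \<Rightarrow> real" where
  "pairing h t = (LINT x|state_measure D. V (x, t) \<bullet> h (fst x, snd x, t))"

lemma pairing_Fubini:
  assumes h: "continuous_on UNIV h" and k: "continuous_on UNIV k" and z: "\<And>t. t > T \<Longrightarrow> k t = 0"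
  shows "integrable evolution_measure (\<lambda>z. k (snd z) * (V z \<bullet> h (event z)))"
    and "(LINT z|evolution_measure. k (snd z) * (V z \<bullet> h (event z))) = (LINT t|half_line. k t * pairing h t)"
    and "integrable half_line (\<lambda>t. k t * pairing h t)"
proof -
  have c: "continuous_on UNIV (\<lambda>e. k (snd (snd e)) *\<^sub>R h e)"
    by (intro continuous_intros h continuous_on_compose2[OF k]) auto
  have "integrable evolution_measure (\<lambda>z. V z \<bullet> (cut z *\<^sub>R (k (snd (snd (event z))) *\<^sub>R h (event z))))"
    by (rule pairing_integrable[OF cut_event_bounded_fields[OF c, of T]]) (simp add: z)
  moreover have "V z \<bullet> (cut z *\<^sub>R (k (snd (snd (event z))) *\<^sub>R h (event z))) = k (snd z) * (V z \<bullet> h (event z))"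
    if "z \<in> space evolution_measure" for z
    using that by (auto simp: space_evolution cut_def event_def)
  ultimately show i: "integrable evolution_measure (\<lambda>z. k (snd z) * (V z \<bullet> h (event z)))"
    by (subst (asm) Bochner_Integration.integrable_cong[OF refl]) auto
  show "(LINT z|evolution_measure. k (snd z) * (V z \<bullet> h (event z))) = (LINT t|half_line. k t * pairing h t)"
    using ST.integral_snd[of "\<lambda>x t. k t * (V (x, t) \<bullet> h (event (x, t)))"] i by (simp add: case_prod_beta' pairing_def event_def)
  show "integrable half_line (\<lambda>t. k t * pairing h t)"
    using ST.integrable_snd[of "\<lambda>x t. k t * (V (x, t) \<bullet> h (event (x, t)))"] i by (simp add: case_prod_beta' pairing_def event_def)
qed

lemma pairing_measurable:
  assumes h: "continuous_on UNIV h"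
  shows "pairing h \<in> borel_measurable half_line"
proof -
  interpret S: time_cylinder "state_measure D" ..
  have "(\<lambda>z. V z \<bullet> h (event z)) \<in> borel_measurable evolution_measure"
    by (rule borel_measurable_inner[OF V_meas cut_event_measurable(1)[OF h]])
  from S.measurable_slice_integral[OF this] show ?thesis
    by (simp add: pairing_def[abs_def] event_def)
qed

lemma pairing_locally_integrable:
  assumes h: "continuous_on UNIV h"
  shows "integrable half_line (\<lambda>t. of_bool (t \<le> T) * pairing h t)"
    and "integrable half_line (\<lambda>t. of_bool (t < T) * pairing h t)"
proof -
  \<comment> \<open>A continuous majorant of the indicator of t <= T with support bounded above:
    integrability, known for continuous multipliers, transfers to sharp cut-offs.\<close>
  define k where "k t = max 0 (min 1 (T + 1 - t))" for t
  have "integrable half_line (\<lambda>t. k t * pairing h t)"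
    by (rule pairing_Fubini(3)[OF h, where T = "T + 1"]) (auto simp: k_def intro!: continuous_intros)
  note * = Bochner_Integration.integrable_bound[OF this]
  show "integrable half_line (\<lambda>t. of_bool (t \<le> T) * pairing h t)"
    by (rule *, rule borel_measurable_times[OF of_bool_le_borel(1) pairing_measurable[OF h]]) (auto simp: k_def)
  show "integrable half_line (\<lambda>t. of_bool (t < T) * pairing h t)"
    by (rule *, rule borel_measurable_times[OF of_bool_le_borel(2) pairing_measurable[OF h]]) (auto simp: k_def)
qed

text \<open>A general \<Phi> need not vanish for late times, so it is tested as \<Phi> * k with a
  C^1 factor k of time that does. Letting k vary gives the hypothesis of
  \<open>du_bois_reymond\<close> for the scalar function t \<mapsto> \<integral> f \<Phi>, with the
  pairings with \<Phi>_t and the scaled \<nabla>\<Phi> as its derivative. The exceptional set of end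
  times may depend on \<Phi>, as the definition of weak solution allows.\<close>

lemma weak_identity:
  assumes \<Phi>: "Ck 1 \<Phi>"
    and test: "\<And>\<phi>. \<phi> \<in> final_tests \<Longrightarrow>
      (LINT z|evolution_measure. scale_flux b1 b2 (state_grad \<phi> (event z)) \<bullet> snd (V z)
         - fst (V z) * frechet_derivative \<phi> (at (event z)) (0, 0, 1)) =
      (LINT x|state_measure D. f0 x * \<phi> (fst x, snd x, 0))"
  shows "AE T in half_line. pairing (\<lambda>e. (\<Phi> e, 0)) T
      - (LINT t|half_line. of_bool (t < T) * pairing (\<lambda>e. (frechet_derivative \<Phi> (at e) (0, 0, 1), 0)) t)
      + (LINT t|half_line. of_bool (t < T) * pairing (\<lambda>e. (0, scale_flux b1 b2 (state_grad \<Phi> e))) t)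
      = (LINT x|state_measure D. f0 x * \<Phi> (fst x, snd x, 0))"
proof -
  interpret L: bounded_linear "scale_flux b1 b2" by (rule scale_flux_linear)
  define h where "h e = (\<Phi> e, 0::state)" for e
  define h1 where "h1 e = (frechet_derivative \<Phi> (at e) (0, 0, 1), 0::state)" for e
  define h2 where "h2 e = (0::real, scale_flux b1 b2 (state_grad \<Phi> e))" for e
  define c where "c = (LINT x|state_measure D. f0 x * \<Phi> (fst x, snd x, 0))"
  have hc: "continuous_on UNIV h" "continuous_on UNIV h1" "continuous_on UNIV h2"
    unfolding h_def[abs_def] h1_def[abs_def] h2_def[abs_def]
    by (rule continuous_on_Pair[OF Ck1_continuous[OF \<Phi>] continuous_on_const]
        continuous_on_Pair[OF Ck1_continuous_derivative[OF \<Phi>] continuous_on_const]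
        continuous_on_Pair[OF continuous_on_const L.continuous_on[OF state_grad_continuous[OF \<Phi>]]])+
  have "AE T in half_line. pairing h T = c + (LINT t|half_line. of_bool (t < T) * (pairing h1 t - pairing h2 t))"
  proof (rule du_bois_reymond)
    show "integrable half_line (\<lambda>t. of_bool (t \<le> T) * pairing h t)" for T
      by (rule pairing_locally_integrable[OF hc(1)])
    show "integrable half_line (\<lambda>t. of_bool (t \<le> T) * (pairing h1 t - pairing h2 t))" for T
      unfolding right_diff_distrib
      by (intro Bochner_Integration.integrable_diff pairing_locally_integrable hc)
    show "pairing h \<in> borel_measurable half_line" "(\<lambda>t. pairing h1 t - pairing h2 t) \<in> borel_measurable half_line"
      by (intro borel_measurable_diff pairing_measurable hc)+
    fix k k' :: "real \<Rightarrow> real" and T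
    assume k: "\<And>t. (k has_real_derivative k' t) (at t)" "continuous_on UNIV k'" "\<And>t. t > T \<Longrightarrow> k t = 0"
    have k0: "k' t = 0" if "t > T" for t
    proof -
      have "((\<lambda>_. 0) has_real_derivative k' t) (at t)"
        by (rule has_field_derivative_transform_within_open[OF k(1), of "{T<..}"]) (use that k(3) in auto)
      then show ?thesis
        using DERIV_unique DERIV_const by blast
    qed
    have kc: "continuous_on UNIV k"
      using k(1) by (meson DERIV_continuous_on has_field_derivative_at_within)
    define \<phi> where "\<phi> e = \<Phi> e * k (snd (snd e))" for e
    define d\<phi> where "d\<phi> e v = \<Phi> e * (k' (snd (snd e)) * snd (snd v)) + frechet_derivative \<Phi> (at e) v * k (snd (snd e))" for e v
    have d: "(\<phi> has_derivative d\<phi> e) (at e)" for e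
    proof -
      have "((\<lambda>e. k (snd (snd e))) has_derivative (\<lambda>v. k' (snd (snd e)) * snd (snd v))) (at e)"
        by (rule has_derivative_compose[where f = "\<lambda>e. snd (snd e)" and g = k and f' = "\<lambda>v. snd (snd v)" and g' = "(*) (k' (snd (snd e)))"])
          (use k(1) in \<open>auto simp: has_field_derivative_def intro!: derivative_eq_intros\<close>)
      from has_derivative_mult[OF Ck1_has_derivative[OF \<Phi>] this] show ?thesis
        by (simp add: \<phi>_def[abs_def] d\<phi>_def[abs_def])
    qed
    have C: "Ck 1 \<phi>"
      unfolding d\<phi>_def[abs_def]
      by (rule Ck1I[OF d]) (auto simp: d\<phi>_def intro!: continuous_intros Ck1_continuous[OF \<Phi>]
          Ck1_continuous_derivative[OF \<Phi>] continuous_on_compose2[OF kc] continuous_on_compose2[OF k(2)])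
    have "\<phi> \<in> final_tests"
      using C k(3) by (auto simp: final_tests_def \<phi>_def simp del: Ck.simps)
    from test[OF this]
    have "(LINT z|evolution_measure. scale_flux b1 b2 (state_grad \<phi> (event z)) \<bullet> snd (V z)
         - fst (V z) * frechet_derivative \<phi> (at (event z)) (0, 0, 1)) = (LINT x|state_measure D. k 0 * (f0 x * \<Phi> (fst x, snd x, 0)))"
      by (simp add: \<phi>_def mult_ac)
    also have "\<dots> = c * k 0"
      by (simp add: c_def)
    also have "(\<lambda>z. scale_flux b1 b2 (state_grad \<phi> (event z)) \<bullet> snd (V z)
         - fst (V z) * frechet_derivative \<phi> (at (event z)) (0, 0, 1)) =
       (\<lambda>z. k (snd z) * (V z \<bullet> h2 (event z)) - k (snd z) * (V z \<bullet> h1 (event z)) - k' (snd z) * (V z \<bullet> h (event z)))"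
    proof
      fix z
      have "state_grad \<phi> e = k (snd (snd e)) *\<^sub>R state_grad \<Phi> e" for e
        by (rule euclidean_eqI)
          (simp add: state_grad_inner[OF d] state_grad_inner[OF Ck1_has_derivative[OF \<Phi>]] d\<phi>_def direction_def)
      moreover have "frechet_derivative \<phi> (at e) = d\<phi> e" for e
        by (rule frechet_derivative_at[OF d, symmetric])
      ultimately show "scale_flux b1 b2 (state_grad \<phi> (event z)) \<bullet> snd (V z)
         - fst (V z) * frechet_derivative \<phi> (at (event z)) (0, 0, 1) =
         k (snd z) * (V z \<bullet> h2 (event z)) - k (snd z) * (V z \<bullet> h1 (event z)) - k' (snd z) * (V z \<bullet> h (event z))"
        by (simp add: d\<phi>_def L.scaleR h_def h1_def h2_def inner_prod_def[of "V z"] event_def inner_commute algebra_simps)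
    qed
    finally have "(LINT t|half_line. k t * pairing h2 t) - (LINT t|half_line. k t * pairing h1 t) - (LINT t|half_line. k' t * pairing h t) = c * k 0"
      using pairing_Fubini[OF hc(2) kc k(3)] pairing_Fubini[OF hc(3) kc k(3)] pairing_Fubini[OF hc(1) k(2) k0] by simp
    moreover have "(LINT t|half_line. k t * (pairing h1 t - pairing h2 t)) = (LINT t|half_line. k t * pairing h1 t) - (LINT t|half_line. k t * pairing h2 t)"
      using pairing_Fubini(3)[OF hc(2) kc k(3)] pairing_Fubini(3)[OF hc(3) kc k(3)] by (simp add: right_diff_distrib)
    ultimately show "(LINT t|half_line. k t * (pairing h1 t - pairing h2 t)) + (LINT t|half_line. k' t * pairing h t) = - (c * k 0)"
      by simp
  qed
  then show ?thesis
  proof eventually_elim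
    case (elim T)
    have "(LINT t|half_line. of_bool (t < T) * (pairing h1 t - pairing h2 t)) =
        (LINT t|half_line. of_bool (t < T) * pairing h1 t) - (LINT t|half_line. of_bool (t < T) * pairing h2 t)"
      unfolding right_diff_distrib
      by (intro Bochner_Integration.integral_diff pairing_locally_integrable hc)
    then show ?case
      using elim by (simp add: c_def h_def[abs_def] h1_def[abs_def] h2_def[abs_def])
  qed
qed

text \<open>The candidate for \<nabla>f, obtained by solving the formula flux = \<nabla>f + (f / d)
  \<nabla>E for it.\<close>

definition full_grad :: "state \<times> real \<Rightarrow> state" where
  "full_grad z = snd (V z) - (fst (V z) / d) *\<^sub>R Egrad (fst z)"

lemma full_grad_measurable: "full_grad \<in> borel_measurable evolution_measure"
proof -
  note [measurable] = borel_measurable_fst_snd[OF V_meas] state_fst_measurable[OF Egrad_measurable]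
  show ?thesis
    unfolding full_grad_def[abs_def] by measurable
qed

lemma full_grad_loc: "in_L2 evolution_measure (\<lambda>z. of_bool (snd z \<le> T) *\<^sub>R full_grad z)"
proof -
  obtain C where C: "\<forall>z\<in>Omega \<times> D. norm (Egrad z) \<le> C"
    using Egrad_bounded by blast
  show ?thesis
  proof (rule in_L2_bound[OF in_L2_scaleR[OF V_loc[of T], of "1 + C / d"]])
    have "(\<lambda>z. if snd z \<le> T then full_grad z else 0) \<in> borel_measurable evolution_measure"
      using full_grad_measurable half_line_id_borel by measurable
    then show "(\<lambda>z. of_bool (snd z \<le> T) *\<^sub>R full_grad z) \<in> borel_measurable evolution_measure"
      by (rule back_subst[where P = "\<lambda>f. f \<in> _"]) auto
    show "AE z in evolution_measure. norm (of_bool (snd z \<le> T) *\<^sub>R full_grad z) \<le>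
        norm ((1 + C / d) *\<^sub>R (of_bool (snd z \<le> T) *\<^sub>R V z))"
    proof (rule AE_I2)
      fix z assume "z \<in> space evolution_measure"
      then have z: "fst z \<in> Omega \<times> D"
        unfolding space_evolution by (cases z) simp
      have E: "norm (Egrad (fst z)) \<le> C"
        by (rule bspec[OF C z])
      then have C0: "0 \<le> C" by (rule order_trans[OF norm_ge_zero])
      have "norm (full_grad z) \<le> norm (snd (V z)) + \<bar>fst (V z)\<bar> / d * norm (Egrad (fst z))"
        unfolding full_grad_def using norm_triangle_ineq4[of "snd (V z)" "(fst (V z) / d) *\<^sub>R Egrad (fst z)"] d_pos by simp
      also have "\<dots> \<le> norm (V z) + norm (V z) / d * C"
        using norm_fst_le[of "fst (V z)" "snd (V z)"] norm_snd_le[of "snd (V z)" "fst (V z)"] d_pos E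
        by (intro add_mono mult_mono divide_right_mono) auto
      also have "\<dots> = norm ((1 + C / d) *\<^sub>R V z)"
      proof -
        have "\<bar>1 + C / d\<bar> = 1 + C / d"
          using C0 d_pos by simp
        then show ?thesis
          unfolding norm_scaleR by (simp add: algebra_simps)
      qed
      finally show "norm (of_bool (snd z \<le> T) *\<^sub>R full_grad z) \<le> norm ((1 + C / d) *\<^sub>R (of_bool (snd z \<le> T) *\<^sub>R V z))"
        by (cases "snd z \<le> T") auto
    qed
  qed
qed

text \<open>Rearranging the orthogonality relation leaves the defining identity of a distributional
  gradient, component by component. The integrability claims are stated as well because they allow
  the vector integrals to be split into angular and spatial parts.\<close>

lemma full_grad_weak:
  assumes \<psi>: "\<psi> \<in> interior_tests D"
    and orth: "\<And>i. i \<in> Basis \<Longrightarrow>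
      (LINT z|evolution_measure. fst (V z) * (state_grad \<psi> (event z) \<bullet> i - \<psi> (event z) * ((Egrad (fst z) \<bullet> i) / d))
         + \<psi> (event z) * (snd (V z) \<bullet> i)) = 0"
  shows "integrable evolution_measure (\<lambda>z. fst (V z) *\<^sub>R state_grad \<psi> (event z))"
    and "integrable evolution_measure (\<lambda>z. \<psi> (event z) *\<^sub>R full_grad z)"
    and "(LINT z|evolution_measure. fst (V z) *\<^sub>R state_grad \<psi> (event z)) = - (LINT z|evolution_measure. \<psi> (event z) *\<^sub>R full_grad z)"
proof -
  obtain C where C: "\<forall>z\<in>Omega \<times> D. norm (Egrad z) \<le> C"
    using Egrad_bounded by blast
  have i: "integrable evolution_measure (\<lambda>z. fst (V z) * (state_grad \<psi> (event z) \<bullet> i))"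
    "integrable evolution_measure (\<lambda>z. fst (V z) * (\<psi> (event z) * ((Egrad (fst z) \<bullet> i) / d)))"
    "integrable evolution_measure (\<lambda>z. \<psi> (event z) * (snd (V z) \<bullet> i))" if i: "i \<in> Basis" for i
  proof -
    have c: "cut z = 1" if "z \<in> space evolution_measure" for z
      using that by (auto simp: space_evolution cut_def)
    have l1: "bounded_linear (\<lambda>v::state. (v \<bullet> i, 0::state))" and l2: "bounded_linear (\<lambda>r::real. (r, 0::state))"
      and l3: "bounded_linear (\<lambda>r::real. (0::real, r *\<^sub>R i))"
      by (intro bounded_linear_Pair bounded_linear_inner_left bounded_linear_zero bounded_linear_ident bounded_linear_scaleR_left)+
    have E: "\<forall>z\<in>Omega \<times> D. \<bar>(Egrad z \<bullet> i) / d\<bar> \<le> C / d"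
    proof
      fix z assume "z \<in> Omega \<times> D"
      then have "\<bar>Egrad z \<bullet> i\<bar> \<le> C"
        using C Basis_le_norm[OF i, of "Egrad z"] order_trans by blast
      then show "\<bar>(Egrad z \<bullet> i) / d\<bar> \<le> C / d"
        using d_pos by (simp add: abs_divide divide_right_mono)
    qed
    have Em: "(\<lambda>z. (Egrad z \<bullet> i) / d) \<in> borel_measurable borel" by measurable
    note s1 = bounded_fields_bounded_linear[OF interior_tests_fields(2)[OF \<psi>] l1]
    note s2 = bounded_fields_bounded_linear[OF bounded_fields_mult_state[OF interior_tests_fields(1)[OF \<psi>] Em E] l2]
    note s3 = bounded_fields_bounded_linear[OF interior_tests_fields(1)[OF \<psi>] l3]
    note cong = Bochner_Integration.integrable_cong[OF refl, THEN iffD1, rotated]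
    show "integrable evolution_measure (\<lambda>z. fst (V z) * (state_grad \<psi> (event z) \<bullet> i))"
      by (rule cong[OF pairing_integrable[OF s1]]) (simp add: inner_prod_def[of "V z" for z] test_grad_def c)
    show "integrable evolution_measure (\<lambda>z. fst (V z) * (\<psi> (event z) * ((Egrad (fst z) \<bullet> i) / d)))"
      by (rule cong[OF pairing_integrable[OF s2]]) (simp add: inner_prod_def[of "V z" for z] test_value_def c)
    show "integrable evolution_measure (\<lambda>z. \<psi> (event z) * (snd (V z) \<bullet> i))"
      by (rule cong[OF pairing_integrable[OF s3]]) (simp add: inner_prod_def[of "V z" for z] test_value_def c)
  qed
  have fg: "(\<psi> (event z) *\<^sub>R full_grad z) \<bullet> i =
      \<psi> (event z) * (snd (V z) \<bullet> i) - fst (V z) * (\<psi> (event z) * ((Egrad (fst z) \<bullet> i) / d))" for z i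
    by (simp add: full_grad_def inner_diff_left algebra_simps)
  show I1: "integrable evolution_measure (\<lambda>z. fst (V z) *\<^sub>R state_grad \<psi> (event z))"
    by (rule integrable_componentwise) (simp add: i(1))
  show I2: "integrable evolution_measure (\<lambda>z. \<psi> (event z) *\<^sub>R full_grad z)"
    by (rule integrable_componentwise) (unfold fg, intro Bochner_Integration.integrable_diff i)
  show "(LINT z|evolution_measure. fst (V z) *\<^sub>R state_grad \<psi> (event z)) = - (LINT z|evolution_measure. \<psi> (event z) *\<^sub>R full_grad z)"
  proof (rule euclidean_eqI)
    fix j :: state assume j: "j \<in> Basis"
    have "(LINT z|evolution_measure. fst (V z) *\<^sub>R state_grad \<psi> (event z)) \<bullet> j =
        (LINT z|evolution_measure. fst (V z) * (state_grad \<psi> (event z) \<bullet> j))"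
      using integral_inner_left[OF I1, of j] by simp
    moreover have "(LINT z|evolution_measure. \<psi> (event z) *\<^sub>R full_grad z) \<bullet> j =
        (LINT z|evolution_measure. \<psi> (event z) * (snd (V z) \<bullet> j)) -
        (LINT z|evolution_measure. fst (V z) * (\<psi> (event z) * ((Egrad (fst z) \<bullet> j) / d)))"
      unfolding integral_inner_left[OF I2, of j, symmetric] fg by (rule Bochner_Integration.integral_diff[OF i(3)[OF j] i(2)[OF j]])
    moreover have "(LINT z|evolution_measure. fst (V z) * (state_grad \<psi> (event z) \<bullet> j)) -
        (LINT z|evolution_measure. fst (V z) * (\<psi> (event z) * ((Egrad (fst z) \<bullet> j) / d))) +
        (LINT z|evolution_measure. \<psi> (event z) * (snd (V z) \<bullet> j)) = 0"
      using orth[OF j] i[OF j] by (simp add: right_diff_distrib)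
    ultimately show "(LINT z|evolution_measure. fst (V z) *\<^sub>R state_grad \<psi> (event z)) \<bullet> j =
        - (LINT z|evolution_measure. \<psi> (event z) *\<^sub>R full_grad z) \<bullet> j"
      by simp
  qed
qed

end


section \<open>Assembly of the weak solution\<close>

lemma C1_real_derivative:
  fixes \<sigma> :: "real \<Rightarrow> real"
  assumes "\<sigma> C1_differentiable_on UNIV"
  obtains \<sigma>' where "\<And>r. (\<sigma> has_real_derivative \<sigma>' r) (at r)" "continuous_on UNIV \<sigma>'"
  using assms unfolding C1_differentiable_on_def has_real_derivative_iff_has_vector_derivative by blast

theorem proposition3p7:
  fixes \<gamma> \<eta> \<beta>\<theta> \<beta>a :: real
    and \<sigma> :: "real \<Rightarrow> real"
    and x :: "3 \<Rightarrow> real^2"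
    and \<Omega>TJ :: "(real^2) set"
    and f0 :: "real^3 \<Rightarrow> real^2 \<Rightarrow> real"
  assumes "\<gamma> > 0" "\<eta> > 0" "\<beta>\<theta> > 0" "\<beta>a > 0"
    and "6 * \<gamma> / \<beta>\<theta>\<^sup>2 = 2 * \<eta> / \<beta>a\<^sup>2"
    and "bounded_C2_domain \<Omega>TJ"
    and "\<sigma> C1_differentiable_on UNIV"
    and "in_L2 (phase_measure \<Omega>TJ) (\<lambda>(\<theta>, a). f0 \<theta> a)"
  shows "\<exists>f. weak_solution \<gamma> \<eta> \<beta>\<theta> \<beta>a \<sigma> x \<Omega>TJ f0 f"
proof -
  obtain \<sigma>' where \<sigma>': "\<And>r. (\<sigma> has_real_derivative \<sigma>' r) (at r)" "continuous_on UNIV \<sigma>'"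
    using C1_real_derivative[OF assms(7)] by metis
  define d where "d = \<beta>\<theta>\<^sup>2 / (6 * \<gamma>)"
  have d: "0 < d" using assms(1,3) by (simp add: d_def)
  define b1 where "b1 = \<beta>\<theta>\<^sup>2 / 2"
  define b2 where "b2 = \<beta>a\<^sup>2 / 2"
  have b: "0 < b1" "0 < b2" using assms(3,4) by (simp_all add: b1_def b2_def)
  have bd1: "b1 / d = 3 * \<gamma>"
    using assms(1,3) by (simp add: b1_def d_def field_simps)
  \<comment> \<open>Here the relation between the constants enters: the same d that turns b1 / d
    into 3 \<gamma> turns b2 / d into \<eta>, so one weight absorbs both drifts.\<close>
  have bd2: "b2 / d = \<eta>"
  proof -
    have "1 / d = 2 * \<eta> / \<beta>a\<^sup>2"
      using assms(1,3,5) by (simp add: d_def)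
    then have "b2 / d = b2 * (2 * \<eta> / \<beta>a\<^sup>2)" by (metis mult.right_neutral times_divide_eq_right)
    then show ?thesis using assms(4) by (simp add: b2_def)
  qed
  interpret potential \<sigma> \<sigma>' x d \<Omega>TJ
    using \<sigma>' d assms(6) by unfold_locales (auto simp: bounded_C2_domain_def)
  let ?D = \<Omega>TJ
  \<comment> \<open>The datum is measurable only for the completed measure; a representative
    measurable for the product itself is substituted.\<close>
  obtain g0 where g0: "g0 \<in> borel_measurable (state_measure ?D)" and g0_eq: "AE z in state_measure ?D. (case z of (\<theta>, a) \<Rightarrow> f0 \<theta> a) = g0 z"
    using completion_ex_borel_measurable_real[of "\<lambda>(\<theta>, a). f0 \<theta> a" "state_measure ?D"] assms(8)
    by (auto simp: in_L2_def phase_measure_eq)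
  have g0_L2: "in_L2 (state_measure ?D) g0"
  proof -
    have sq: "integrable (completion (state_measure ?D)) (\<lambda>z. (norm (case z of (\<theta>, a) \<Rightarrow> f0 \<theta> a))\<^sup>2)"
      using assms(8) by (simp add: in_L2_def phase_measure_eq)
    have m: "(\<lambda>z. (norm (g0 z))\<^sup>2) \<in> borel_measurable (state_measure ?D)"
      using g0 by measurable
    have "integrable (completion (state_measure ?D)) (\<lambda>z. (norm (g0 z))\<^sup>2)"
    proof (rule integrable_cong_AE_imp[OF sq measurable_completion[OF m]])
      show "AE z in completion (state_measure ?D). (norm (case z of (\<theta>, a) \<Rightarrow> f0 \<theta> a))\<^sup>2 = (norm (g0 z))\<^sup>2"
        using AE_completion[OF g0_eq] by eventually_elim simp
    qed
    then show ?thesis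
      using g0 integrable_completion[OF m] by (simp add: in_L2_def)
  qed
  obtain V C where V: "V \<in> borel_measurable evolution_measure"
    and V_loc: "\<And>T. in_L2 evolution_measure (\<lambda>z. of_bool (snd z \<le> T) *\<^sub>R V z)"
    and V_slice: "AE t in half_line. in_L2 (state_measure ?D) (\<lambda>x. fst (V (x, t))) \<and>
      (LINT x|state_measure ?D. (fst (V (x, t)))\<^sup>2) \<le> C"
    and V_test: "\<And>\<phi>. \<phi> \<in> final_tests \<Longrightarrow>
      (LINT z|evolution_measure. scale_flux b1 b2 (state_grad \<phi> (event z)) \<bullet> snd (V z)
         - fst (V z) * frechet_derivative \<phi> (at (event z)) (0, 0, 1)) =
      (LINT x|state_measure ?D. g0 x * \<phi> (fst x, snd x, 0))"
    and V_orth: "\<And>\<psi> i. \<psi> \<in> interior_tests ?D \<Longrightarrow> i \<in> Basis \<Longrightarrow>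
      (LINT z|evolution_measure. fst (V z) * (state_grad \<psi> (event z) \<bullet> i - \<psi> (event z) * ((Egrad (fst z) \<bullet> i) / d))
         + \<psi> (event z) * (snd (V z) \<bullet> i)) = 0"
    by (rule weak_evolution_exists[OF b g0_L2]) (rule that; assumption)
  interpret local_field \<sigma> \<sigma>' x d ?D V
    using V V_loc by unfold_locales
  define f where "f \<theta> a t = fst (V ((\<theta>, a), t))" for \<theta> a t
  define g\<theta> where "g\<theta> \<theta> a t = fst (full_grad ((\<theta>, a), t))" for \<theta> a t
  define ga where "ga \<theta> a t = snd (full_grad ((\<theta>, a), t))" for \<theta> a t
  note V_parts = borel_measurable_fst_snd[OF V]
  note grad_parts = borel_measurable_fst_snd[OF full_grad_measurable]
  have slice: "(\<lambda>x. h (x, t)) \<in> borel_measurable (state_measure ?D)"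
    if "h \<in> borel_measurable evolution_measure" "0 < t" for h :: "state \<times> real \<Rightarrow> 'b::euclidean_space" and t
    by (rule measurable_compose[OF measurable_Pair2' that(1)]) (use that(2) in \<open>simp add: space_restrict_space\<close>)
  have time_in: "AE t in half_line. 0 < t"
    using AE_space[of half_line] by eventually_elim (simp add: space_restrict_space)

  have "in_Linf_L2 {0<..} ?D f"
    unfolding in_Linf_L2_def
  proof (intro conjI exI)
    show "(\<lambda>(\<theta>, a, t). f \<theta> a t) \<in> borel_measurable (cylinder_measure ?D {0<..})"
      using cylinder_measurable[OF V_parts(1) order_refl] by (simp add: f_def)
    have "AE t in half_line. in_L2 (phase_measure ?D) (\<lambda>(\<theta>, a). f \<theta> a t) \<and>
        L2_norm (phase_measure ?D) (\<lambda>(\<theta>, a). f \<theta> a t) \<le> sqrt C"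
      using V_slice
    proof eventually_elim
      case (elim t)
      have "(\<lambda>(\<theta>, a). f \<theta> a t) = (\<lambda>x. fst (V (x, t)))"
        by (auto simp: f_def)
      then show ?case
        using elim in_L2_completion[of "state_measure ?D" "\<lambda>x. fst (V (x, t))"]
          L2_norm_completion[of "\<lambda>x. fst (V (x, t))" "state_measure ?D"]
        by (simp add: phase_measure_eq in_L2_def)
    qed
    then show "AE t in lebesgue_on {0<..}. in_L2 (phase_measure ?D) (\<lambda>(\<theta>, a). f \<theta> a t) \<and>
        L2_norm (phase_measure ?D) (\<lambda>(\<theta>, a). f \<theta> a t) \<le> sqrt C"
      by (rule AE_lebesgue_on_half_line) auto
  qed

  moreover have weak: "weak_tgrad ?D f g\<theta> \<and> weak_grad_a ?D f ga"
  proof -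
    have "(LINT (\<theta>, a, t)|cylinder_measure ?D {0<..}. f \<theta> a t *\<^sub>R tgrad (\<lambda>\<theta>'. \<psi> \<theta>' a t) \<theta>) =
        - (LINT (\<theta>, a, t)|cylinder_measure ?D {0<..}. \<psi> \<theta> a t *\<^sub>R g\<theta> \<theta> a t) \<and>
        (LINT (\<theta>, a, t)|cylinder_measure ?D {0<..}. f \<theta> a t *\<^sub>R grad (\<lambda>a'. \<psi> \<theta> a' t) a) =
        - (LINT (\<theta>, a, t)|cylinder_measure ?D {0<..}. \<psi> \<theta> a t *\<^sub>R ga \<theta> a t)"
      if \<psi>: "compact_test ?D \<psi>" for \<psi>
    proof -
      define \<Psi> where "\<Psi> = (\<lambda>(\<theta>, a, t). \<psi> \<theta> a t)"
      have "Ck 1 \<Psi>"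
        using \<psi> unfolding compact_test_def Cinfinity_def \<Psi>_def by blast
      then have T: "\<Psi> \<in> interior_tests ?D"
        using \<psi> unfolding compact_test_def interior_tests_def by (auto simp: \<Psi>_def simp del: Ck.simps)
      note w = full_grad_weak[OF T V_orth[OF T]]
      have m: "(\<lambda>z. fst (V z) *\<^sub>R state_grad \<Psi> (event z)) \<in> borel_measurable evolution_measure"
        "(\<lambda>z. \<Psi> (event z) *\<^sub>R full_grad z) \<in> borel_measurable evolution_measure"
        using w(1,2) by auto
      note mp = borel_measurable_fst_snd[OF m(1)] borel_measurable_fst_snd[OF m(2)]
      have p: "fst (fst (V ((\<theta>, a), t)) *\<^sub>R state_grad \<Psi> (event ((\<theta>, a), t))) = f \<theta> a t *\<^sub>R tgrad (\<lambda>\<theta>'. \<psi> \<theta>' a t) \<theta>"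
        "snd (fst (V ((\<theta>, a), t)) *\<^sub>R state_grad \<Psi> (event ((\<theta>, a), t))) = f \<theta> a t *\<^sub>R grad (\<lambda>a'. \<psi> \<theta> a' t) a"
        "fst (\<Psi> (event ((\<theta>, a), t)) *\<^sub>R full_grad ((\<theta>, a), t)) = \<psi> \<theta> a t *\<^sub>R g\<theta> \<theta> a t"
        "snd (\<Psi> (event ((\<theta>, a), t)) *\<^sub>R full_grad ((\<theta>, a), t)) = \<psi> \<theta> a t *\<^sub>R ga \<theta> a t" for \<theta> a t
        by (simp_all add: f_def g\<theta>_def ga_def \<Psi>_def event_def state_grad_def)
      show ?thesis
        using cylinder_integral[OF mp(1)] cylinder_integral[OF mp(2)] cylinder_integral[OF mp(3)] cylinder_integral[OF mp(4)]
          integral_fst[OF w(1)] integral_snd[OF w(1)] integral_fst[OF w(2)] integral_snd[OF w(2)] w(3)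
        unfolding p by simp
    qed
    then show ?thesis
      unfolding weak_tgrad_def weak_grad_a_def by blast
  qed

  moreover have "in_L2_L2 {0<..<T} ?D g\<theta> \<and> in_L2_L2 {0<..<T} ?D ga" for T
  proof -
    have loc: "in_L2 evolution_measure (\<lambda>z. of_bool (snd z \<le> T) *\<^sub>R fst (full_grad z))"
      "in_L2 evolution_measure (\<lambda>z. of_bool (snd z \<le> T) *\<^sub>R snd (full_grad z))"
    proof -
      note mm = borel_measurable_fst_snd[of "\<lambda>z. of_bool (snd z \<le> T) *\<^sub>R full_grad z" evolution_measure]
      have "(\<lambda>z. of_bool (snd z \<le> T) *\<^sub>R full_grad z) \<in> borel_measurable evolution_measure"
        using full_grad_loc[of T] by (simp add: in_L2_def)
      then show "in_L2 evolution_measure (\<lambda>z. of_bool (snd z \<le> T) *\<^sub>R fst (full_grad z))"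
        "in_L2 evolution_measure (\<lambda>z. of_bool (snd z \<le> T) *\<^sub>R snd (full_grad z))"
        using mm norm_fst_le[of "fst (full_grad z)" "snd (full_grad z)" for z] norm_snd_le[of "snd (full_grad z)" "fst (full_grad z)" for z]
        by (auto intro!: in_L2_bound[OF full_grad_loc[of T]] AE_I2 mult_left_mono)
    qed
    show ?thesis
      using in_L2_L2I[OF grad_parts(1) loc(1)] in_L2_L2I[OF grad_parts(2) loc(2)]
      by (simp add: g\<theta>_def[abs_def] ga_def[abs_def])
  qed

  moreover have "AE T in lebesgue_on {0<..}.
      (LINT (\<theta>, a)|phase_measure ?D. f \<theta> a T * \<phi> \<theta> a T)
      - (LINT t|lebesgue_on {0<..<T}. LINT (\<theta>, a)|phase_measure ?D. f \<theta> a t * deriv (\<phi> \<theta> a) t)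
      + (LINT t|lebesgue_on {0<..<T}. LINT (\<theta>, a)|phase_measure ?D.
           ((\<beta>\<theta>\<^sup>2 / 2) *\<^sub>R g\<theta> \<theta> a t - f \<theta> a t *\<^sub>R v_theta \<gamma> \<sigma> x \<theta> a) \<bullet> tgrad (\<lambda>\<theta>'. \<phi> \<theta>' a t) \<theta>
         + ((\<beta>a\<^sup>2 / 2) *\<^sub>R ga \<theta> a t - f \<theta> a t *\<^sub>R v_a \<eta> \<sigma> x \<theta> a) \<bullet> grad (\<lambda>a'. \<phi> \<theta> a' t) a)
      = (LINT (\<theta>, a)|phase_measure ?D. f0 \<theta> a * \<phi> \<theta> a 0)"
    if smooth: "Cinfinity (\<lambda>(\<theta>, a, t). \<phi> \<theta> a t)" for \<phi>
  proof -
    define \<Phi> where "\<Phi> = (\<lambda>(\<theta>, a, t). \<phi> \<theta> a t)"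
    have \<Phi>: "Ck 1 \<Phi>"
      using smooth unfolding Cinfinity_def \<Phi>_def by blast
    interpret L: bounded_linear "scale_flux b1 b2" by (rule scale_flux_linear)
    define h where "h e = (\<Phi> e, 0::state)" for e
    define h1 where "h1 e = (frechet_derivative \<Phi> (at e) (0, 0, 1), 0::state)" for e
    define h2 where "h2 e = (0::real, scale_flux b1 b2 (state_grad \<Phi> e))" for e
    have hc: "continuous_on UNIV h" "continuous_on UNIV h1" "continuous_on UNIV h2"
      unfolding h_def[abs_def] h1_def[abs_def] h2_def[abs_def]
      by (rule continuous_on_Pair[OF Ck1_continuous[OF \<Phi>] continuous_on_const]
          continuous_on_Pair[OF Ck1_continuous_derivative[OF \<Phi>] continuous_on_const]
          continuous_on_Pair[OF continuous_on_const L.continuous_on[OF state_grad_continuous[OF \<Phi>]]])+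
    have hm: "(\<lambda>x. V (x, t) \<bullet> k (fst x, snd x, t)) \<in> borel_measurable (state_measure ?D)"
      if "continuous_on UNIV k" "0 < t" for k t
      using slice[OF borel_measurable_inner[OF V cut_event_measurable(1)[OF that(1)]] that(2)]
      by (simp add: event_def)
    have initial: "(LINT (\<theta>, a)|phase_measure ?D. f0 \<theta> a * \<phi> \<theta> a 0) = (LINT x|state_measure ?D. g0 x * \<Phi> (fst x, snd x, 0))"
      unfolding phase_measure_eq
    proof (rule completion_integral_AE)
      have "continuous_on UNIV (\<lambda>x::state. \<Phi> (fst x, snd x, 0))"
        by (intro continuous_on_compose2[OF Ck1_continuous[OF \<Phi>]] continuous_intros) auto
      then show "(\<lambda>x. g0 x * \<Phi> (fst x, snd x, 0)) \<in> borel_measurable (state_measure ?D)"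
        by (intro borel_measurable_times g0 measurable_state_measure borel_measurable_continuous_onI)
      show "AE z in state_measure ?D. (case z of (\<theta>, a) \<Rightarrow> f0 \<theta> a * \<phi> \<theta> a 0) = g0 z * \<Phi> (fst z, snd z, 0)"
        using g0_eq by eventually_elim (auto simp: \<Phi>_def)
    qed
    have endpoint: "(LINT (\<theta>, a)|phase_measure ?D. f \<theta> a t * \<phi> \<theta> a t) = pairing h t" if "0 < t" for t
      unfolding phase_measure_eq pairing_def
      by (rule completion_integral_AE[OF hm[OF hc(1) that]])
        (auto simp: f_def h_def \<Phi>_def inner_prod_def[of "V z" for z] intro!: AE_I2)
    have rate: "(LINT (\<theta>, a)|phase_measure ?D. f \<theta> a t * deriv (\<phi> \<theta> a) t) = pairing h1 t" if "0 < t" for t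
      unfolding phase_measure_eq pairing_def
    proof (rule completion_integral_AE[OF hm[OF hc(2) that]])
      have "deriv (\<phi> \<theta> a) t = frechet_derivative \<Phi> (at (\<theta>, a, t)) (0, 0, 1)" for \<theta> a
        using DERIV_imp_deriv[OF partial_derivatives(3)[OF Ck1_has_derivative[OF \<Phi>, of "(\<theta>, a, t)"]]]
        by (simp add: \<Phi>_def)
      then show "AE z in state_measure ?D. (case z of (\<theta>, a) \<Rightarrow> f \<theta> a t * deriv (\<phi> \<theta> a) t) = V (z, t) \<bullet> h1 (fst z, snd z, t)"
        by (auto simp: f_def h1_def inner_prod_def[of "V z" for z] intro!: AE_I2)
    qed
    have flux: "(LINT (\<theta>, a)|phase_measure ?D.
           ((\<beta>\<theta>\<^sup>2 / 2) *\<^sub>R g\<theta> \<theta> a t - f \<theta> a t *\<^sub>R v_theta \<gamma> \<sigma> x \<theta> a) \<bullet> tgrad (\<lambda>\<theta>'. \<phi> \<theta>' a t) \<theta>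
         + ((\<beta>a\<^sup>2 / 2) *\<^sub>R ga \<theta> a t - f \<theta> a t *\<^sub>R v_a \<eta> \<sigma> x \<theta> a) \<bullet> grad (\<lambda>a'. \<phi> \<theta> a' t) a) = pairing h2 t"
      if "0 < t" for t
      unfolding phase_measure_eq pairing_def
    proof (rule completion_integral_AE[OF hm[OF hc(3) that]])
      show "AE z in state_measure ?D. (case z of (\<theta>, a) \<Rightarrow>
          ((\<beta>\<theta>\<^sup>2 / 2) *\<^sub>R g\<theta> \<theta> a t - f \<theta> a t *\<^sub>R v_theta \<gamma> \<sigma> x \<theta> a) \<bullet> tgrad (\<lambda>\<theta>'. \<phi> \<theta>' a t) \<theta>
         + ((\<beta>a\<^sup>2 / 2) *\<^sub>R ga \<theta> a t - f \<theta> a t *\<^sub>R v_a \<eta> \<sigma> x \<theta> a) \<bullet> grad (\<lambda>a'. \<phi> \<theta> a' t) a) = V (z, t) \<bullet> h2 (fst z, snd z, t)"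
        using AE_off_points
      proof eventually_elim
        case (elim z)
        obtain \<theta> a where z: "z = (\<theta>, a)" by (cases z)
        have a: "a \<notin> range x" using elim z by simp
        \<comment> \<open>The term (b1 / d) f \<nabla>E contained in the gradient cancels the drift
          exactly, leaving b1 times the flux; the same happens in \<open>a\<close> away from the
          points x j.\<close>
        have 1: "(\<beta>\<theta>\<^sup>2 / 2) *\<^sub>R g\<theta> \<theta> a t - f \<theta> a t *\<^sub>R v_theta \<gamma> \<sigma> x \<theta> a = b1 *\<^sub>R fst (snd (V (z, t)))"
          using d by (simp add: g\<theta>_def f_def full_grad_def v_theta_eq z bd1[symmetric] scaleR_diff_right flip: b1_def)
        have 2: "(\<beta>a\<^sup>2 / 2) *\<^sub>R ga \<theta> a t - f \<theta> a t *\<^sub>R v_a \<eta> \<sigma> x \<theta> a = b2 *\<^sub>R snd (snd (V (z, t)))"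
          using d by (simp add: ga_def f_def full_grad_def v_a_eq[OF a] z bd2[symmetric] scaleR_diff_right flip: b2_def)
        show ?case
          unfolding z prod.case 1 2
          by (simp add: h2_def scale_flux_def state_grad_def \<Phi>_def z inner_prod_def[of "V w" for w] inner_prod_def[of "snd w" for w])
      qed
    qed
    have space_T: "t \<in> space (lebesgue_on {0<..<T}) \<Longrightarrow> 0 < t" for t T :: real
      by (simp add: space_restrict_space)
    have r1: "(LINT t|lebesgue_on {0<..<T}. LINT (\<theta>, a)|phase_measure ?D. f \<theta> a t * deriv (\<phi> \<theta> a) t) =
        (LINT t|half_line. of_bool (t < T) * pairing h1 t)" for T
      unfolding lebesgue_on_integral(2)[OF pairing_measurable[OF hc(2)], symmetric]
      by (rule Bochner_Integration.integral_cong[OF refl]) (rule rate[OF space_T])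
    have r2: "(LINT t|lebesgue_on {0<..<T}. LINT (\<theta>, a)|phase_measure ?D.
           ((\<beta>\<theta>\<^sup>2 / 2) *\<^sub>R g\<theta> \<theta> a t - f \<theta> a t *\<^sub>R v_theta \<gamma> \<sigma> x \<theta> a) \<bullet> tgrad (\<lambda>\<theta>'. \<phi> \<theta>' a t) \<theta>
         + ((\<beta>a\<^sup>2 / 2) *\<^sub>R ga \<theta> a t - f \<theta> a t *\<^sub>R v_a \<eta> \<sigma> x \<theta> a) \<bullet> grad (\<lambda>a'. \<phi> \<theta> a' t) a) =
        (LINT t|half_line. of_bool (t < T) * pairing h2 t)" for T
      unfolding lebesgue_on_integral(2)[OF pairing_measurable[OF hc(3)], symmetric]
      by (rule Bochner_Integration.integral_cong[OF refl]) (rule flux[OF space_T])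
    have "AE T in half_line. pairing h T
      - (LINT t|half_line. of_bool (t < T) * pairing h1 t)
      + (LINT t|half_line. of_bool (t < T) * pairing h2 t)
      = (LINT x|state_measure ?D. g0 x * \<Phi> (fst x, snd x, 0))"
      using weak_identity[OF \<Phi> V_test] by (simp add: h_def[abs_def] h1_def[abs_def] h2_def[abs_def])
    then show ?thesis
    proof (rule AE_lebesgue_on_half_line[OF AE_mp])
      show "AE T in half_line. pairing h T
          - (LINT t|half_line. of_bool (t < T) * pairing h1 t)
          + (LINT t|half_line. of_bool (t < T) * pairing h2 t)
          = (LINT x|state_measure ?D. g0 x * \<Phi> (fst x, snd x, 0)) \<longrightarrow>
        (LINT (\<theta>, a)|phase_measure ?D. f \<theta> a T * \<phi> \<theta> a T)
      - (LINT t|lebesgue_on {0<..<T}. LINT (\<theta>, a)|phase_measure ?D. f \<theta> a t * deriv (\<phi> \<theta> a) t)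
      + (LINT t|lebesgue_on {0<..<T}. LINT (\<theta>, a)|phase_measure ?D.
           ((\<beta>\<theta>\<^sup>2 / 2) *\<^sub>R g\<theta> \<theta> a t - f \<theta> a t *\<^sub>R v_theta \<gamma> \<sigma> x \<theta> a) \<bullet> tgrad (\<lambda>\<theta>'. \<phi> \<theta>' a t) \<theta>
         + ((\<beta>a\<^sup>2 / 2) *\<^sub>R ga \<theta> a t - f \<theta> a t *\<^sub>R v_a \<eta> \<sigma> x \<theta> a) \<bullet> grad (\<lambda>a'. \<phi> \<theta> a' t) a)
      = (LINT (\<theta>, a)|phase_measure ?D. f0 \<theta> a * \<phi> \<theta> a 0)"
        using time_in
      proof eventually_elim
        case (elim T)
        show ?case
          unfolding r1 r2 initial endpoint[OF elim] by blast
      qed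
    qed auto
  qed
  ultimately have "weak_solution \<gamma> \<eta> \<beta>\<theta> \<beta>a \<sigma> x ?D f0 f"
    unfolding weak_solution_def by blast
  then show ?thesis by blast
qed

end
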